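(* Let $\mathcal{G}\subseteq\mathbb{M}^3$, the topology $\mathcal{T}$ on $\mathcal{G}$ and the collection of maps $\mathcal{A}$ be as defined in the context. Then $(\mathcal{G},\mathcal{T},\mathcal{A})$ is a Zariski-free manifold, that is, a $2$-dimensional topological nc-manifold with respect to the Zariski-free topology on $\mathbb{M}^2$.
   Context: **Basics.** $\mathbb{M}_n$ is the algebra of $n\times n$ complex matrices, $\mathbb{M}^d=\bigcup_{n\ge1}\mathbb{M}_n^d$ (disjoint union). Direct sums and similarities are taken componentwise. An *nc-set* is a subset of $\mathbb{M}^d$ closed under direct sums. A function $f:D\to\mathbb{M}^1$ is *graded* if $f(x)\in\mathbb{M}_n$ whenever $x\in D\cap\mathbb{M}_n^d$. An *nc-function* is a graded function $f$ on an nc-set $D$ such that $f(x\oplus y)=f(x)\oplus f(y)$, and $f(s^{-1}xs)=s^{-1}f(x)s$ whenever $x\in D\cap\mathbb{M}_n^d$, $s\in\mathbb{M}_n$ is invertible and $s^{-1}xs\in D$. An *nc-mapping* is a map between nc-sets whose components are nc-functions. **Topologies.** The *free topology* on $\mathbb{M}^d$ has as base the sets $B_\delta=\{x:\|[\delta_{ij}(x)]\|<1\}$, $\delta$ a (rectangular) matrix of free polynomials (polynomials over $\mathbb{C}$ in non-commuting variables); freely open sets are free domains. A graded function $f$ on a free domain $D$ is *freely holomorphic* if every $x\in D$ has a freely open neighborhood $U\subseteq D$ that is an nc-set on which $f$ is an nc-function, and a free neighborhood on which $f$ is bounded. A *free variety* in a free domain $D$ is a set $\{x\in D: g(x)=0\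 \forall g\in E\}$, $E$ a set of freely holomorphic functions on $D$. The *Zariski-free topology* has as base the sets $D\setminus T$, $D$ a free domain and $T$ a finite union of free varieties in $D$. **Topological nc-manifolds.** Let $\tau$ be a topology on $\mathbb{M}^d$ having a basis of nc-sets whose intersection with each $\mathbb{M}_n^d$ is open (the Zariski-free topology is such). A $d$-dimensional topological nc-manifold with respect to $\tau$ is a triple $(X,\mathcal{T},\mathcal{A})$ where $(X,\mathcal{T})$ is a topological space and $\mathcal{A}$ is a collection of homeomorphisms $\alpha:U_\alpha\to D_\alpha$, with $U_\alpha\in\mathcal{T}$ and $D_\alpha\subseteq\mathbb{M}^d$ a $\tau$-open nc-set with the relative $\tau$-topology, such that $\bigcup_\alpha U_\alpha=X$ and, for all $\alpha,\beta\in\mathcal{A}$, $\alpha(U_\alpha\cap U_\beta)$ is a union of nc-sets and the restriction of $\beta\circ\alpha^{-1}$ to every nc-subset of $\alpha(U_\alpha\cap U_\beta)$ is an nc-mapping. **Definition of $\mathcal{G}$.** Let $\Gamma$ be the set of finite subsets of $\mathbb{C}\setminus\{0\}$. For each $\gamma\in\Gamma$ fix $r_\gamma>0$ with $r_\gamma<\min\{\min_{c\in\gamma}|c|,\ \tfrac14\min_{c\ne d\in\gamma}|c-d|\}$, let $\Delta_\gamma=\bigcup_{c\in\gamma}\{z:|z-c|<r_\gamma\}$, and fix a holomorphic branch $s_\gamma$ of $\sqrt z$ on $\Delta_\gamma$. For $\tau\in\{-1,1\}^\gamma$ let $\iota_{\gamma\tau}(z)=\tau(c)$ if $|z-c|<r_\gamma$,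 $c\in\gamma$. Let $D_\gamma=\{x\in\mathbb{M}^1:\sigma(x)\subseteq\Delta_\gamma\}$ and, via the holomorphic functional calculus, $I_{\gamma\tau}(x)=\iota_{\gamma\tau}(x)$ and $S_{\gamma\tau}(x)=s_\gamma(x)\iota_{\gamma\tau}(x)$ for $x\in D_\gamma$. Let $\mathcal{U}_\gamma=\{(u,x)\in\mathbb{M}^2: x\in D_\gamma,\ uI_{\gamma\tau}(x)\ne I_{\gamma\tau}(x)u$ for every nonconstant $\tau\in\{-1,1\}^\gamma\}$. Put $\Phi_{\gamma\tau}(u,x)=(u,x,S_{\gamma\tau}(x)\,u\,S_{\gamma\tau}(x))$ for $(u,x)\in\mathcal{U}_\gamma$, $\mathcal{G}_{\gamma\tau}=\Phi_{\gamma\tau}(\mathcal{U}_\gamma)\subseteq\mathbb{M}^3$ and $\mathcal{G}=\bigcup_{\gamma\in\Gamma}\bigcup_{\tau\in\{-1,1\}^\gamma}\mathcal{G}_{\gamma\tau}$. $\mathcal{T}$ is the topology on $\mathcal{G}$ generated by (in fact having as base) the sets $\Phi_{\gamma\tau}(U)$ with $\gamma\in\Gamma$, $\tau\in\{-1,1\}^\gamma$ and $U\subseteq\mathcal{U}_\gamma$ Zariski-freely open. $\mathcal{A}=\{\Phi_{\gamma\tau}^{-1}:\mathcal{G}_{\gamma\tau}\to\mathcal{U}_\gamma\ |\ \gamma\in\Gamma,\ \tau\in\{-1,1\}^\gamma\}$. *)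

theory Defs
  imports
    "HOL-Complex_Analysis.Complex_Analysis"
    "HOL-Library.Poly_Mapping"
    "Jordan_Normal_Form.Spectral_Radius"
    "Jordan_Normal_Form.Gauss_Jordan_Elimination"
begin

(* A point of the d-dimensional nc-space is a list of d complex matrices of a common size n >= 1.
   For d >= 1 the levels M_level d n are pairwise disjoint, so their union is the disjoint union.
   A point of M^1 that is the value of a function, or the argument of the functional calculus,
   is written as a plain matrix. *)

type_synonym nc_point = "complex mat list"

definition M_level :: "nat \<Rightarrow> nat \<Rightarrow> nc_point set" where
  "M_level d n = {x. length x = d \<and> set x \<subseteq> carrier_mat n n}"

definition M_space :: "nat \<Rightarrow> nc_point set" where
  "M_space d = (\<Union>n\<in>{1..}. M_level d n)"

definition pt_size :: "nc_point \<Rightarrow> nat" where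
  "pt_size x = dim_row (hd x)"

definition mat_dsum :: "complex mat \<Rightarrow> complex mat \<Rightarrow> complex mat" where
  "mat_dsum A B =
     four_block_mat A (0\<^sub>m (dim_row A) (dim_col B)) (0\<^sub>m (dim_row B) (dim_col A)) B"

definition pt_dsum :: "nc_point \<Rightarrow> nc_point \<Rightarrow> nc_point" where
  "pt_dsum x y = map2 mat_dsum x y"

(* Meaningful for invertible square matrices only. *)
definition mat_inv' :: "complex mat \<Rightarrow> complex mat" where
  "mat_inv' A = the (mat_inverse A)"

definition pt_conj :: "complex mat \<Rightarrow> nc_point \<Rightarrow> nc_point" where
  "pt_conj s x = map (\<lambda>a. mat_inv' s * a * s) x"

definition nc_set :: "nat \<Rightarrow> nc_point set \<Rightarrow> bool" where
  "nc_set d D \<longleftrightarrow> D \<subseteq> M_space d \<and> (\<forall>x\<in>D. \<forall>y\<in>D. pt_dsum x y \<in> D)"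

definition graded :: "nat \<Rightarrow> nc_point set \<Rightarrow> (nc_point \<Rightarrow> complex mat) \<Rightarrow> bool" where
  "graded d D f \<longleftrightarrow> (\<forall>n\<ge>1. \<forall>x\<in>D \<inter> M_level d n. f x \<in> carrier_mat n n)"

definition nc_function :: "nat \<Rightarrow> nc_point set \<Rightarrow> (nc_point \<Rightarrow> complex mat) \<Rightarrow> bool" where
  "nc_function d D f \<longleftrightarrow>
     nc_set d D \<and> graded d D f \<and>
     (\<forall>x\<in>D. \<forall>y\<in>D. f (pt_dsum x y) = mat_dsum (f x) (f y)) \<and>
     (\<forall>n\<ge>1. \<forall>x\<in>D \<inter> M_level d n. \<forall>s\<in>carrier_mat n n.
        invertible_mat s \<longrightarrow> pt_conj s x \<in> D \<longrightarrow> f (pt_conj s x) = mat_inv' s * f x * s)"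

definition nc_mapping ::
    "nat \<Rightarrow> nc_point set \<Rightarrow> nat \<Rightarrow> nc_point set \<Rightarrow> (nc_point \<Rightarrow> nc_point) \<Rightarrow> bool" where
  "nc_mapping d D e E f \<longleftrightarrow>
     nc_set d D \<and> nc_set e E \<and> f ` D \<subseteq> E \<and> (\<forall>k<e. nc_function d D (\<lambda>x. f x ! k))"


(* Operator norm for the Euclidean norms on C^p and C^q. *)

definition vec_norm2 :: "complex vec \<Rightarrow> real" where
  "vec_norm2 v = sqrt (\<Sum>i<dim_vec v. (cmod (vec_index v i))\<^sup>2)"

definition op_norm :: "complex mat \<Rightarrow> real" where
  "op_norm A = Sup {vec_norm2 (A *\<^sub>v v) | v. v \<in> carrier_vec (dim_col A) \<and> vec_norm2 v \<le> 1}"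


(* A free polynomial in d variables is a finitely supported complex function on the words
   over the alphabet {0..<d}; the word [k1, ..., km] stands for the monomial x_k1 ... x_km. *)

type_synonym free_poly = "nat list \<Rightarrow>\<^sub>0 complex"

definition free_polys :: "nat \<Rightarrow> free_poly set" where
  "free_polys d = {p. Poly_Mapping.keys p \<subseteq> lists {..<d}}"

definition word_eval :: "nc_point \<Rightarrow> nat list \<Rightarrow> complex mat" where
  "word_eval x w = foldr (\<lambda>k A. x ! k * A) w (1\<^sub>m (pt_size x))"

definition poly_eval :: "free_poly \<Rightarrow> nc_point \<Rightarrow> complex mat" where
  "poly_eval p x = Matrix.mat (pt_size x) (pt_size x)
     (\<lambda>(i, j). \<Sum>w\<in>Poly_Mapping.keys p. Poly_Mapping.lookup p w * (word_eval x w $$ (i, j)))"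

(* The block matrix whose (k, l) block is the value at x of the (k, l) entry of \<delta>. *)
definition poly_mat_eval :: "free_poly mat \<Rightarrow> nc_point \<Rightarrow> complex mat" where
  "poly_mat_eval \<delta> x = (let n = pt_size x in
     Matrix.mat (dim_row \<delta> * n) (dim_col \<delta> * n)
       (\<lambda>(i, j). poly_eval (\<delta> $$ (i div n, j div n)) x $$ (i mod n, j mod n)))"

definition B_free :: "nat \<Rightarrow> free_poly mat \<Rightarrow> nc_point set" where
  "B_free d \<delta> = {x \<in> M_space d. op_norm (poly_mat_eval \<delta> x) < 1}"

(* The generating sets are closed under finite intersections (use block diagonal \<delta>), so they
   form a base.  The same holds for the Zariski-free topology below. *)
definition free_topology :: "nat \<Rightarrow> nc_point topology" where
  "free_topology d = topology_generated_by {B_free d \<delta> | \<delta>. elements_mat \<delta> \<subseteq> free_polys d}"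

definition free_domain :: "nat \<Rightarrow> nc_point set \<Rightarrow> bool" where
  "free_domain d D \<longleftrightarrow> openin (free_topology d) D"

definition freely_holomorphic ::
    "nat \<Rightarrow> nc_point set \<Rightarrow> (nc_point \<Rightarrow> complex mat) \<Rightarrow> bool" where
  "freely_holomorphic d D f \<longleftrightarrow>
     free_domain d D \<and> graded d D f \<and>
     (\<forall>x\<in>D.
        (\<exists>U. free_domain d U \<and> x \<in> U \<and> U \<subseteq> D \<and> nc_set d U \<and> nc_function d U f) \<and>
        (\<exists>V C. free_domain d V \<and> x \<in> V \<and> V \<subseteq> D \<and> (\<forall>y\<in>V. op_norm (f y) \<le> C)))"

definition free_variety :: "nat \<Rightarrow> nc_point set \<Rightarrow> nc_point set \<Rightarrow> bool" where
  "free_variety d D T \<longleftrightarrow>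
     (\<exists>E. (\<forall>g\<in>E. freely_holomorphic d D g) \<and>
          T = {x\<in>D. \<forall>g\<in>E. g x = 0\<^sub>m (pt_size x) (pt_size x)})"

definition zariski_free_topology :: "nat \<Rightarrow> nc_point topology" where
  "zariski_free_topology d = topology_generated_by
     {D - \<Union>\<V> | D \<V>. free_domain d D \<and> finite \<V> \<and> (\<forall>T\<in>\<V>. free_variety d D T)}"


(* Openness of the level-n part of U in the usual topology of n x n matrix d-tuples. *)
definition level_open :: "nat \<Rightarrow> nat \<Rightarrow> nc_point set \<Rightarrow> bool" where
  "level_open d n U \<longleftrightarrow>
     (\<forall>x\<in>U \<inter> M_level d n. \<exists>\<epsilon>>0. \<forall>y\<in>M_level d n.
        (\<forall>k<d. \<forall>i<n. \<forall>j<n. cmod (y ! k $$ (i, j) - x ! k $$ (i, j)) < \<epsilon>) \<longrightarrow> y \<in> U)"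

(* The standing requirement on the topology with respect to which nc-manifolds are defined. *)
definition nc_admissible_topology :: "nat \<Rightarrow> nc_point topology \<Rightarrow> bool" where
  "nc_admissible_topology d \<tau> \<longleftrightarrow>
     topspace \<tau> = M_space d \<and>
     (\<exists>\<B>. (\<forall>U\<in>\<B>. openin \<tau> U \<and> nc_set d U \<and> (\<forall>n\<ge>1. level_open d n U)) \<and>
          (\<forall>V. openin \<tau> V \<longrightarrow> (\<exists>\<B>'\<subseteq>\<B>. V = \<Union>\<B>')))"

(* A chart is a triple (U, \<alpha>, D) of its domain, the map, and its range D = \<alpha> ` U. *)
type_synonym 'a nc_chart = "'a set \<times> ('a \<Rightarrow> nc_point) \<times> nc_point set"

definition topological_nc_manifold ::
    "nat \<Rightarrow> nc_point topology \<Rightarrow> 'a set \<Rightarrow> 'a topology \<Rightarrow> 'a nc_chart set \<Rightarrow> bool" where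
  "topological_nc_manifold d \<tau> X \<T> \<A> \<longleftrightarrow>
     nc_admissible_topology d \<tau> \<and>
     topspace \<T> = X \<and>
     (\<forall>(U, \<alpha>, D)\<in>\<A>.
        openin \<T> U \<and> openin \<tau> D \<and> nc_set d D \<and>
        homeomorphic_map (subtopology \<T> U) (subtopology \<tau> D) \<alpha>) \<and>
     (\<Union>(U, \<alpha>, D)\<in>\<A>. U) = X \<and>
     (\<forall>(U, \<alpha>, D)\<in>\<A>. \<forall>(V, \<beta>, E)\<in>\<A>.
        (\<exists>\<N>. (\<forall>N\<in>\<N>. nc_set d N) \<and> \<alpha> ` (U \<inter> V) = \<Union>\<N>) \<and>
        (\<forall>N. nc_set d N \<and> N \<subseteq> \<alpha> ` (U \<inter> V) \<longrightarrow> nc_mapping d N d E (\<beta> \<circ> inv_into U \<alpha>)))"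


(* Riesz-Dunford calculus: the contour is the union of small positively oriented circles about the
   eigenvalues of x.  Since residue f a is (1 / (2 pi i)) times the integral of f over every
   sufficiently small circle about a, the (i, j) entry of
   (1 / (2 pi i)) \<integral> f(z) (z - x)^{-1} dz is the sum of the residues below. *)
definition hol_calc :: "(complex \<Rightarrow> complex) \<Rightarrow> complex mat \<Rightarrow> complex mat" where
  "hol_calc f x = Matrix.mat (dim_row x) (dim_row x)
     (\<lambda>(i, j). \<Sum>a\<in>spectrum x.
        residue (\<lambda>z. f z * (mat_inv' (z \<cdot>\<^sub>m 1\<^sub>m (dim_row x) - x) $$ (i, j))) a)"


(* The radii r and branches s are parameters, indexed by \<gamma>. *)

definition \<Gamma>_sets :: "complex set set" where
  "\<Gamma>_sets = {\<gamma>. finite \<gamma> \<and> \<gamma> \<subseteq> - {0}}"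

definition \<Delta>_set :: "(complex set \<Rightarrow> real) \<Rightarrow> complex set \<Rightarrow> complex set" where
  "\<Delta>_set r \<gamma> = (\<Union>c\<in>\<gamma>. {z. cmod (z - c) < r \<gamma>})"

definition signs :: "complex set \<Rightarrow> (complex \<Rightarrow> complex) set" where
  "signs \<gamma> = \<gamma> \<rightarrow>\<^sub>E {-1, 1}"

definition nonconst_on :: "complex set \<Rightarrow> (complex \<Rightarrow> complex) \<Rightarrow> bool" where
  "nonconst_on \<gamma> t \<longleftrightarrow> (\<exists>c\<in>\<gamma>. \<exists>c'\<in>\<gamma>. t c \<noteq> t c')"

(* The discs are disjoint for admissible r, so the disc containing z is unique;
   values outside \<Delta>_set r \<gamma> are irrelevant. *)
definition iota :: "(complex set \<Rightarrow> real) \<Rightarrow> complex set \<Rightarrow> (complex \<Rightarrow> complex) \<Rightarrow> complex \<Rightarrow> complex" where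
  "iota r \<gamma> t z = t (THE c. c \<in> \<gamma> \<and> cmod (z - c) < r \<gamma>)"

definition D_set :: "(complex set \<Rightarrow> real) \<Rightarrow> complex set \<Rightarrow> complex mat set" where
  "D_set r \<gamma> = {x. \<exists>n\<ge>1. x \<in> carrier_mat n n \<and> spectrum x \<subseteq> \<Delta>_set r \<gamma>}"

definition I_map :: "(complex set \<Rightarrow> real) \<Rightarrow> complex set \<Rightarrow> (complex \<Rightarrow> complex) \<Rightarrow> complex mat \<Rightarrow> complex mat" where
  "I_map r \<gamma> t x = hol_calc (iota r \<gamma> t) x"

definition S_map :: "(complex set \<Rightarrow> real) \<Rightarrow> (complex set \<Rightarrow> complex \<Rightarrow> complex) \<Rightarrow>
    complex set \<Rightarrow> (complex \<Rightarrow> complex) \<Rightarrow> complex mat \<Rightarrow> complex mat" where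
  "S_map r s \<gamma> t x = hol_calc (s \<gamma>) x * hol_calc (iota r \<gamma> t) x"

definition U_set :: "(complex set \<Rightarrow> real) \<Rightarrow> complex set \<Rightarrow> nc_point set" where
  "U_set r \<gamma> = {[u, x] | u x. [u, x] \<in> M_space 2 \<and> x \<in> D_set r \<gamma> \<and>
     (\<forall>t\<in>signs \<gamma>. nonconst_on \<gamma> t \<longrightarrow> u * I_map r \<gamma> t x \<noteq> I_map r \<gamma> t x * u)}"

definition \<Phi>_map :: "(complex set \<Rightarrow> real) \<Rightarrow> (complex set \<Rightarrow> complex \<Rightarrow> complex) \<Rightarrow>
    complex set \<Rightarrow> (complex \<Rightarrow> complex) \<Rightarrow> nc_point \<Rightarrow> nc_point" where
  "\<Phi>_map r s \<gamma> t p = (let u = p ! 0; x = p ! 1 in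
     [u, x, S_map r s \<gamma> t x * u * S_map r s \<gamma> t x])"

definition G_patch :: "(complex set \<Rightarrow> real) \<Rightarrow> (complex set \<Rightarrow> complex \<Rightarrow> complex) \<Rightarrow>
    complex set \<Rightarrow> (complex \<Rightarrow> complex) \<Rightarrow> nc_point set" where
  "G_patch r s \<gamma> t = \<Phi>_map r s \<gamma> t ` U_set r \<gamma>"

definition G_set :: "(complex set \<Rightarrow> real) \<Rightarrow> (complex set \<Rightarrow> complex \<Rightarrow> complex) \<Rightarrow> nc_point set" where
  "G_set r s = (\<Union>\<gamma>\<in>\<Gamma>_sets. \<Union>t\<in>signs \<gamma>. G_patch r s \<gamma> t)"

definition G_topology ::
    "(complex set \<Rightarrow> real) \<Rightarrow> (complex set \<Rightarrow> complex \<Rightarrow> complex) \<Rightarrow> nc_point topology" where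
  "G_topology r s = topology_generated_by
     {\<Phi>_map r s \<gamma> t ` U | \<gamma> t U. \<gamma> \<in> \<Gamma>_sets \<and> t \<in> signs \<gamma> \<and>
        U \<subseteq> U_set r \<gamma> \<and> openin (zariski_free_topology 2) U}"

definition G_atlas :: "(complex set \<Rightarrow> real) \<Rightarrow> (complex set \<Rightarrow> complex \<Rightarrow> complex) \<Rightarrow>
    nc_point nc_chart set" where
  "G_atlas r s =
     {(G_patch r s \<gamma> t, inv_into (U_set r \<gamma>) (\<Phi>_map r s \<gamma> t), U_set r \<gamma>) | \<gamma> t.
        \<gamma> \<in> \<Gamma>_sets \<and> t \<in> signs \<gamma>}"

end

theory Submission
  imports Defs
begin

text \<open>
  On a freely open set \<open>D\<close>, a locally bounded nc-function is continuous on every level, so the sets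
  \<open>W - \<Union>\<V>\<close> with \<open>W\<close> a finite intersection of sets \<open>B_free \<delta>\<close> and \<open>\<V>\<close> a finite family
  of free varieties are nc-sets, open on every level, and form a base of the Zariski-free topology.

  Near \<open>x\<^sub>0\<close> with spectrum in the discs, let \<open>p\<close> be a multiple of a polynomial with
  \<open>p(x\<^sub>0) = 0\<close>. The condition \<open>\<parallel>p(x)\<parallel> < 1\<close> controls the spectrum and the resolvent of
  \<open>x\<close> uniformly in the matrix size, so by the residue theorem \<open>I_map r \<gamma> t\<close> is bounded on a free
  neighbourhood. Hence the commutator of \<open>u\<close> and \<open>I_map r \<gamma> t x\<close> is freely holomorphic and
  \<open>U_set r \<gamma>\<close> is Zariski-freely open.

  Over the common part of two charts \<open>S' = S J\<close>, where \<open>J\<close> is a locally constant function of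
  \<open>x\<close> with values \<open>1\<close>, \<open>-1\<close>; if \<open>\<gamma>'\<close> has the smaller radius, then
  \<open>J = I_map r \<gamma>' e x\<close> for some signs \<open>e\<close>. As \<open>S' u S' = S u S\<close> holds iff \<open>u\<close> commutes with
  \<open>J\<close>, two sheets agree over the whole common part when \<open>e\<close> is constant and are disjoint
  otherwise. So all transition maps are identities between nc-sets.
\<close>

text \<open>A free neighbourhood contains matrices of all sizes, so boundedness on it tolerates no
  constant that depends on the size. Entrywise estimates of the calculus do not suffice, and the
  norm of \<open>I_map r \<gamma> t x\<close> has to come from a resolvent estimate in
  \<open>op_norm\<close>. A second obstacle is the definition of \<open>hol_calc\<close> by residues
  of entries, from which multiplicativity cannot be read off; it is obtained on Jordan blocks, where
  it is the Leibniz rule, and carried through direct sums and similarities. The factor 1/4 in the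
  bound on the radii serves the comparison of two families of discs: if a disc of radius at most
  \<open>r \<gamma>\<close> meets discs of radius \<open>r \<gamma>\<close> about \<open>c\<close>
  and \<open>b\<close>, then \<open>cmod (c - b) < 4 * r \<gamma>\<close>, hence
  \<open>c = b\<close>. The sign relating two branches is therefore constant on the part of each
  smaller disc where both are defined, and it comes from one of the finitely many sign functions
  that enter \<open>U_set\<close>. The non-commutation imposed there prevents two sheets from
  meeting over some points while differing over others.\<close>

hide_const (open) Finite_Cartesian_Product.mat Finite_Cartesian_Product.vec Determinants.det
  Finite_Cartesian_Product.row Finite_Cartesian_Product.transpose Inner_Product.real_inner_class.inner
no_notation Finite_Cartesian_Product.vec_nth (infixl "$" 90)
no_notation Inner_Product.real_inner_class.inner (infix "\<bullet>" 70)
no_notation fps_nth (infixl "$" 75)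

section \<open>Direct sums and inverses of matrices\<close>

lemma mat_dsum_dim [simp]:
  "dim_row (mat_dsum A B) = dim_row A + dim_row B"
  "dim_col (mat_dsum A B) = dim_col A + dim_col B"
  by (auto simp: mat_dsum_def)

lemma mat_dsum_carrier [simp, intro]:
  "A \<in> carrier_mat p q \<Longrightarrow> B \<in> carrier_mat p' q' \<Longrightarrow> mat_dsum A B \<in> carrier_mat (p + p') (q + q')"
  by (metis carrier_matD carrier_matI mat_dsum_dim)

lemma mat_dsum_index:
  "i < dim_row A + dim_row B \<Longrightarrow> j < dim_col A + dim_col B \<Longrightarrow>
   mat_dsum A B $$ (i, j) =
     (if i < dim_row A then if j < dim_col A then A $$ (i, j) else 0
      else if j < dim_col A then 0 else B $$ (i - dim_row A, j - dim_col A))"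
  by (auto simp: mat_dsum_def)

lemma mat_dsum_mult:
  assumes "A \<in> carrier_mat n n" "B \<in> carrier_mat m m" "C \<in> carrier_mat n n" "E \<in> carrier_mat m m"
  shows "mat_dsum A B * mat_dsum C E = mat_dsum (A * C) (B * E)"
  using assms unfolding mat_dsum_def
  by (subst mult_four_block_mat[of _ n n _ m _ m _ _ n _ m]) auto

lemma mat_dsum_minus:
  assumes "A \<in> carrier_mat p q" "B \<in> carrier_mat p' q'" "C \<in> carrier_mat p q" "E \<in> carrier_mat p' q'"
  shows "mat_dsum A B - mat_dsum C E = mat_dsum (A - C) (B - E)"
  by (rule eq_matI) (use assms in \<open>auto simp: mat_dsum_index\<close>)

lemma mat_dsum_one: "mat_dsum (1\<^sub>m n) (1\<^sub>m m) = 1\<^sub>m (n + m)"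
  by (rule eq_matI) (auto simp: mat_dsum_index)

lemma mat_dsum_zero: "mat_dsum (0\<^sub>m n n) (0\<^sub>m m m) = 0\<^sub>m (n + m) (n + m)"
  by (rule eq_matI) (auto simp: mat_dsum_index)

lemma mat_dsum_inject:
  assumes "A \<in> carrier_mat n n" "C \<in> carrier_mat n n" "B \<in> carrier_mat m m" "E \<in> carrier_mat m m"
    and eq: "mat_dsum A B = mat_dsum C E"
  shows "A = C \<and> B = E"
proof
  have *: "mat_dsum A B $$ (i, j) = mat_dsum C E $$ (i, j)" for i j using eq by simp
  show "A = C"
  proof (rule eq_matI)
    fix i j assume "i < dim_row C" "j < dim_col C"
    then show "A $$ (i, j) = C $$ (i, j)"
      using *[of i j] assms(1-4) by (auto simp: mat_dsum_index)
  qed (use assms in auto)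
  show "B = E"
  proof (rule eq_matI)
    fix i j assume "i < dim_row E" "j < dim_col E"
    then show "B $$ (i, j) = E $$ (i, j)"
      using *[of "i + n" "j + n"] assms(1-4) by (auto simp: mat_dsum_index)
  qed (use assms in auto)
qed

text \<open>\<open>mat_inverse\<close> returns an option, so \<open>the\<close> says something only
  once the matrix is known to be a unit of the matrix ring. For square matrices over a field a right
  inverse suffices, and uniqueness of inverses then identifies the computed one.\<close>

lemma mat_inv'_eqI:
  assumes A: "A \<in> carrier_mat n n" and B: "B \<in> carrier_mat n n" and AB: "A * B = 1\<^sub>m n"
  shows "mat_inv' A = B"
proof -
  have BA: "B * A = 1\<^sub>m n" using mat_mult_left_right_inverse[OF A B AB] .
  have "A \<in> Units (ring_mat TYPE(complex) n ())"
    unfolding Units_def ring_mat_def using A B AB BA by auto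
  then obtain C where C: "mat_inverse A = Some C"
    using mat_inverse(1)[OF A, of "()"] by (cases "mat_inverse A") auto
  from mat_inverse(2)[OF A C] have c: "C * A = 1\<^sub>m n" "C \<in> carrier_mat n n" by auto
  have "C = C * (A * B)" using AB c by simp
  also have "\<dots> = (C * A) * B" using A B c by (metis assoc_mult_mat)
  also have "\<dots> = B" using c B by simp
  finally show ?thesis using C by (simp add: mat_inv'_def)
qed

lemma mat_inv':
  assumes A: "A \<in> carrier_mat n n" and inv: "invertible_mat A"
  shows "mat_inv' A \<in> carrier_mat n n" "A * mat_inv' A = 1\<^sub>m n" "mat_inv' A * A = 1\<^sub>m n"
proof -
  obtain B where B: "A * B = 1\<^sub>m n" "B * A = 1\<^sub>m (dim_row B)"
    using inv A unfolding invertible_mat_def inverts_mat_def by auto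
  have "dim_col B = n" using arg_cong[OF B(1), of dim_col] A by simp
  moreover have "dim_row B = n" using arg_cong[OF B(2), of dim_col] A by simp
  ultimately have Bc: "B \<in> carrier_mat n n" by auto
  have "mat_inv' A = B" by (rule mat_inv'_eqI[OF A Bc B(1)])
  then show "mat_inv' A \<in> carrier_mat n n" "A * mat_inv' A = 1\<^sub>m n" "mat_inv' A * A = 1\<^sub>m n"
    using B Bc by auto
qed

lemma invertible_matI:
  assumes "(A :: complex mat) \<in> carrier_mat n n" "B \<in> carrier_mat n n" "A * B = 1\<^sub>m n"
  shows "invertible_mat A"
  using assms mat_mult_left_right_inverse[OF assms]
  unfolding invertible_mat_def inverts_mat_def by (auto simp: square_mat.simps)

text \<open>The size is read off the head of the list, which is the reason for the condition
  \<open>d \<ge> 1\<close> here and in what follows.\<close>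

lemma pt_size_M_level: "x \<in> M_level d n \<Longrightarrow> d \<ge> 1 \<Longrightarrow> pt_size x = n"
  unfolding M_level_def pt_size_def by (cases x) auto

lemma M_space_level: "x \<in> M_space d \<Longrightarrow> d \<ge> 1 \<Longrightarrow> x \<in> M_level d (pt_size x) \<and> pt_size x \<ge> 1"
  unfolding M_space_def using pt_size_M_level by auto

lemma M_level_nth: "x \<in> M_level d n \<Longrightarrow> k < d \<Longrightarrow> x ! k \<in> carrier_mat n n"
  unfolding M_level_def by auto

lemma M_level_space: "x \<in> M_level d n \<Longrightarrow> n \<ge> 1 \<Longrightarrow> x \<in> M_space d"
  unfolding M_space_def by auto

lemma pt_dsum_nth: "x \<in> M_level d n \<Longrightarrow> y \<in> M_level d m \<Longrightarrow> k < d \<Longrightarrow> pt_dsum x y ! k = mat_dsum (x ! k) (y ! k)"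
  unfolding M_level_def pt_dsum_def by auto

lemma pt_dsum_level: "x \<in> M_level d n \<Longrightarrow> y \<in> M_level d m \<Longrightarrow> pt_dsum x y \<in> M_level d (n + m)"
  unfolding M_level_def pt_dsum_def by (auto simp: set_zip) (metis mat_dsum_carrier nth_mem subset_iff)

section \<open>The operator norm\<close>

lemma vec_norm2_L2: "vec_norm2 v = L2_set (\<lambda>i. cmod (v $ i)) {..<dim_vec v}"
  unfolding vec_norm2_def L2_set_def by simp

lemma vec_norm2_nonneg [simp]: "vec_norm2 v \<ge> 0"
  by (simp add: vec_norm2_L2)

lemma vec_norm2_zero [simp]: "vec_norm2 (0\<^sub>v n) = 0"
  by (simp add: vec_norm2_def)

lemma vec_norm2_eq_0: "vec_norm2 v = 0 \<Longrightarrow> v = 0\<^sub>v (dim_vec v)"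
  unfolding vec_norm2_L2 by (subst (asm) L2_set_eq_0_iff) (auto intro!: eq_vecI)

lemma vec_norm2_smult: "vec_norm2 (c \<cdot>\<^sub>v v) = cmod c * vec_norm2 v"
proof -
  have "L2_set (\<lambda>i. cmod ((c \<cdot>\<^sub>v v) $ i)) {..<dim_vec v} = L2_set (\<lambda>i. cmod c * cmod (v $ i)) {..<dim_vec v}"
    by (rule L2_set_cong) (auto simp: norm_mult)
  then show ?thesis by (simp add: vec_norm2_L2 L2_set_right_distrib)
qed

lemma vec_norm2_triangle:
  assumes "v \<in> carrier_vec n" "w \<in> carrier_vec n"
  shows "vec_norm2 (v + w) \<le> vec_norm2 v + vec_norm2 w"
proof -
  have "L2_set (\<lambda>i. cmod ((v + w) $ i)) {..<n} \<le> L2_set (\<lambda>i. cmod (v $ i) + cmod (w $ i)) {..<n}"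
    by (rule L2_set_mono) (use assms in \<open>auto intro: norm_triangle_ineq\<close>)
  also have "\<dots> \<le> L2_set (\<lambda>i. cmod (v $ i)) {..<n} + L2_set (\<lambda>i. cmod (w $ i)) {..<n}"
    by (rule L2_set_triangle_ineq)
  finally show ?thesis using assms by (simp add: vec_norm2_L2)
qed

lemma vec_norm2_uminus: "vec_norm2 (- v) = vec_norm2 v"
  by (simp add: vec_norm2_def)

lemma vec_norm2_triangle_minus:
  assumes "v \<in> carrier_vec n" "w \<in> carrier_vec n"
  shows "vec_norm2 (v - w) \<le> vec_norm2 v + vec_norm2 w"
proof -
  have "v - w = v + (- w)" using assms by auto
  then show ?thesis using vec_norm2_triangle[of v n "- w"] assms by (simp add: vec_norm2_uminus)
qed

lemma cmod_vec_le: "i < dim_vec v \<Longrightarrow> cmod (v $ i) \<le> vec_norm2 v"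
  unfolding vec_norm2_L2 by (rule member_le_L2_set) auto

lemma vec_norm2_le_sum: "vec_norm2 v \<le> (\<Sum>i<dim_vec v. cmod (v $ i))"
  unfolding vec_norm2_L2 by (rule L2_set_le_sum) auto

lemma cauchy_schwarz_vec:
  assumes "v \<in> carrier_vec n" "w \<in> carrier_vec n"
  shows "cmod (\<Sum>i<n. v $ i * w $ i) \<le> vec_norm2 v * vec_norm2 w"
proof -
  have "cmod (\<Sum>i<n. v $ i * w $ i) \<le> (\<Sum>i<n. cmod (v $ i) * cmod (w $ i))"
    by (rule sum_norm_le) (auto simp: norm_mult)
  also have "\<dots> \<le> L2_set (\<lambda>i. cmod (v $ i)) {..<n} * L2_set (\<lambda>i. cmod (w $ i)) {..<n}"
    using L2_set_mult_ineq[of "\<lambda>i. cmod (v $ i)" "\<lambda>i. cmod (w $ i)" "{..<n}"] by simp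
  finally show ?thesis using assms by (simp add: vec_norm2_L2)
qed

lemma mult_mat_vec_index_sum:
  "v \<in> carrier_vec (dim_col A) \<Longrightarrow> i < dim_row A \<Longrightarrow> (A *\<^sub>v v) $ i = (\<Sum>j<dim_col A. A $$ (i, j) * v $ j)"
  by (auto simp: scalar_prod_def atLeast0LessThan)

lemma mult_mat_vec_bound:
  assumes v: "v \<in> carrier_vec (dim_col A)"
  shows "vec_norm2 (A *\<^sub>v v) \<le> (\<Sum>i<dim_row A. \<Sum>j<dim_col A. cmod (A $$ (i, j))) * vec_norm2 v"
proof -
  have "vec_norm2 (A *\<^sub>v v) \<le> (\<Sum>i<dim_row A. cmod ((A *\<^sub>v v) $ i))"
    using vec_norm2_le_sum[of "A *\<^sub>v v"] by simp
  also have "\<dots> \<le> (\<Sum>i<dim_row A. \<Sum>j<dim_col A. cmod (A $$ (i, j)) * vec_norm2 v)"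
  proof (rule sum_mono)
    fix i assume "i \<in> {..<dim_row A}"
    then have "cmod ((A *\<^sub>v v) $ i) = cmod (\<Sum>j<dim_col A. A $$ (i, j) * v $ j)"
      using v by (subst mult_mat_vec_index_sum) auto
    also have "\<dots> \<le> (\<Sum>j<dim_col A. cmod (A $$ (i, j)) * vec_norm2 v)"
      by (rule sum_norm_le) (use v cmod_vec_le[of _ v] in \<open>auto simp: norm_mult intro!: mult_left_mono\<close>)
    finally show "cmod ((A *\<^sub>v v) $ i) \<le> (\<Sum>j<dim_col A. cmod (A $$ (i, j)) * vec_norm2 v)" .
  qed
  finally show ?thesis by (simp add: sum_distrib_right)
qed

text \<open>\<open>Sup\<close> on the reals is informative only for bounded nonempty sets, so
  \<open>op_norm\<close> yields estimates only after this crude bound. It depends on the size of the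
  matrix, which is harmless because only finiteness matters here.\<close>

lemma op_norm_bdd: "bdd_above {vec_norm2 (A *\<^sub>v v) | v. v \<in> carrier_vec (dim_col A) \<and> vec_norm2 v \<le> 1}"
proof (rule bdd_aboveI, clarify)
  fix v assume v: "v \<in> carrier_vec (dim_col A)" "vec_norm2 v \<le> 1"
  have "vec_norm2 (A *\<^sub>v v) \<le> (\<Sum>i<dim_row A. \<Sum>j<dim_col A. cmod (A $$ (i, j))) * vec_norm2 v"
    by (rule mult_mat_vec_bound[OF v(1)])
  also have "\<dots> \<le> (\<Sum>i<dim_row A. \<Sum>j<dim_col A. cmod (A $$ (i, j)))"
    using v(2) by (intro mult_left_le sum_nonneg) auto
  finally show "vec_norm2 (A *\<^sub>v v) \<le> (\<Sum>i<dim_row A. \<Sum>j<dim_col A. cmod (A $$ (i, j)))" .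
qed

lemma op_norm_nonneg [simp]: "op_norm A \<ge> 0"
  unfolding op_norm_def
  by (rule cSup_upper2[where x = "vec_norm2 (A *\<^sub>v 0\<^sub>v (dim_col A))"])
     (auto intro!: op_norm_bdd exI[of _ "0\<^sub>v (dim_col A)"])

lemma op_norm_mult_vec:
  assumes v: "v \<in> carrier_vec (dim_col A)"
  shows "vec_norm2 (A *\<^sub>v v) \<le> op_norm A * vec_norm2 v"
proof (cases "vec_norm2 v = 0")
  case True
  then have "v = 0\<^sub>v (dim_col A)" using vec_norm2_eq_0[of v] v by (metis carrier_vecD)
  then have "A *\<^sub>v v = 0\<^sub>v (dim_row A)" by auto
  then show ?thesis using True by simp
next
  case False
  then have pos: "vec_norm2 v > 0" by (simp add: less_le)
  define w where "w = complex_of_real (1 / vec_norm2 v) \<cdot>\<^sub>v v"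
  have "vec_norm2 w = 1" using pos by (simp add: w_def vec_norm2_smult norm_divide)
  moreover have w: "w \<in> carrier_vec (dim_col A)" using v by (simp add: w_def)
  ultimately have "vec_norm2 (A *\<^sub>v w) \<le> op_norm A"
    unfolding op_norm_def by (intro cSup_upper op_norm_bdd) auto
  moreover have "A *\<^sub>v w = complex_of_real (1 / vec_norm2 v) \<cdot>\<^sub>v (A *\<^sub>v v)"
    unfolding w_def by (rule mult_mat_vec[OF _ v]) auto
  ultimately show ?thesis using pos by (simp add: vec_norm2_smult norm_divide field_simps)
qed

lemma op_norm_leI:
  assumes "\<And>v. v \<in> carrier_vec (dim_col A) \<Longrightarrow> vec_norm2 (A *\<^sub>v v) \<le> c * vec_norm2 v" "c \<ge> 0"
  shows "op_norm A \<le> c"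
  unfolding op_norm_def
proof (rule cSup_least)
  fix y assume "y \<in> {vec_norm2 (A *\<^sub>v v) |v. v \<in> carrier_vec (dim_col A) \<and> vec_norm2 v \<le> 1}"
  then obtain v where v: "y = vec_norm2 (A *\<^sub>v v)" "v \<in> carrier_vec (dim_col A)" "vec_norm2 v \<le> 1" by auto
  then have "y \<le> c * vec_norm2 v" using assms by simp
  also have "\<dots> \<le> c" using v(3) assms(2) by (simp add: mult_left_le)
  finally show "y \<le> c" .
qed (auto intro!: exI[of _ "0\<^sub>v (dim_col A)"])

text \<open>Intended for \<open>g\<close> that pads a vector by zeros, which compares a diagonal
  block with the whole matrix. The norms are squared because that is how they add over the parts of
  a vector.\<close>

lemma op_norm_le_of_embedding:
  assumes "\<And>v. v \<in> carrier_vec (dim_col A) \<Longrightarrow> g v \<in> carrier_vec (dim_col E)"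
    and "\<And>v. v \<in> carrier_vec (dim_col A) \<Longrightarrow> (vec_norm2 (g v))\<^sup>2 = (vec_norm2 v)\<^sup>2"
    and "\<And>v. v \<in> carrier_vec (dim_col A) \<Longrightarrow> (vec_norm2 (A *\<^sub>v v))\<^sup>2 \<le> (vec_norm2 (E *\<^sub>v g v))\<^sup>2"
  shows "op_norm A \<le> op_norm E"
proof (rule op_norm_leI)
  fix v :: "complex vec" assume v: "v \<in> carrier_vec (dim_col A)"
  have "vec_norm2 (g v) = vec_norm2 v" using assms(2)[OF v] by (simp add: power2_eq_iff_nonneg)
  then show "vec_norm2 (A *\<^sub>v v) \<le> op_norm E * vec_norm2 v"
    using op_norm_mult_vec[OF assms(1)[OF v]] power2_le_imp_le[OF assms(3)[OF v]] by simp
qed auto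

lemma cmod_entry_le_op_norm:
  assumes "i < dim_row A" "j < dim_col A"
  shows "cmod (A $$ (i, j)) \<le> op_norm A"
proof -
  have "(A *\<^sub>v unit_vec (dim_col A) j) $ i = A $$ (i, j)"
    using assms by (subst mult_mat_vec_index_sum) (auto simp: unit_vec_def if_distrib cong: if_cong)
  moreover have "vec_norm2 (unit_vec (dim_col A) j) = 1"
    using assms unfolding vec_norm2_def by (simp add: unit_vec_def if_distrib[of cmod] if_distrib[of "\<lambda>x. x ^ 2"] cong: if_cong)
  ultimately show ?thesis
    using cmod_vec_le[of i "A *\<^sub>v unit_vec (dim_col A) j"] op_norm_mult_vec[of "unit_vec (dim_col A) j" A] assms by simp
qed

lemma op_norm_le_sum: "op_norm A \<le> (\<Sum>i<dim_row A. \<Sum>j<dim_col A. cmod (A $$ (i, j)))"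
  by (rule op_norm_leI) (auto intro!: mult_mat_vec_bound sum_nonneg)

lemma op_norm_add:
  assumes "A \<in> carrier_mat p q" "B \<in> carrier_mat p q"
  shows "op_norm (A + B) \<le> op_norm A + op_norm B"
proof (rule op_norm_leI)
  fix v :: "complex vec" assume v: "v \<in> carrier_vec (dim_col (A + B))"
  have "(A + B) *\<^sub>v v = A *\<^sub>v v + B *\<^sub>v v" using assms v by (auto intro: add_mult_distrib_mat_vec)
  also have "vec_norm2 \<dots> \<le> vec_norm2 (A *\<^sub>v v) + vec_norm2 (B *\<^sub>v v)"
    by (rule vec_norm2_triangle[of _ p]) (use assms in \<open>auto intro!: carrier_vecI\<close>)
  also have "\<dots> \<le> op_norm A * vec_norm2 v + op_norm B * vec_norm2 v"
    by (intro add_mono op_norm_mult_vec) (use assms v in auto)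
  finally show "vec_norm2 ((A + B) *\<^sub>v v) \<le> (op_norm A + op_norm B) * vec_norm2 v" by (simp add: algebra_simps)
qed auto

lemma op_norm_smult: "op_norm (c \<cdot>\<^sub>m A) \<le> cmod c * op_norm A"
proof (rule op_norm_leI)
  fix v :: "complex vec" assume v: "v \<in> carrier_vec (dim_col (c \<cdot>\<^sub>m A))"
  have "(c \<cdot>\<^sub>m A) *\<^sub>v v = c \<cdot>\<^sub>v (A *\<^sub>v v)"
    by (rule eq_vecI) (use v in \<open>auto simp: smult_scalar_prod_distrib[of _ "dim_col A"] row_smult\<close>)
  then show "vec_norm2 ((c \<cdot>\<^sub>m A) *\<^sub>v v) \<le> (cmod c * op_norm A) * vec_norm2 v"
    using op_norm_mult_vec[of v A] v by (simp add: vec_norm2_smult mult.assoc mult_left_mono)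
qed auto

lemma op_norm_minus:
  assumes "A \<in> carrier_mat p q" "B \<in> carrier_mat p q"
  shows "op_norm (A - B) \<le> op_norm A + op_norm B"
proof -
  have "A - B = A + (-1) \<cdot>\<^sub>m B" by (rule eq_matI) (use assms in auto)
  then show ?thesis using op_norm_add[of A p q "(-1) \<cdot>\<^sub>m B"] op_norm_smult[of "-1" B] assms by simp
qed

lemma op_norm_mult:
  assumes "A \<in> carrier_mat p q" "B \<in> carrier_mat q s"
  shows "op_norm (A * B) \<le> op_norm A * op_norm B"
proof (rule op_norm_leI)
  fix v :: "complex vec" assume v: "v \<in> carrier_vec (dim_col (A * B))"
  have "(A * B) *\<^sub>v v = A *\<^sub>v (B *\<^sub>v v)" using assms v by (auto intro: assoc_mult_mat_vec)
  also have "vec_norm2 \<dots> \<le> op_norm A * vec_norm2 (B *\<^sub>v v)"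
    by (rule op_norm_mult_vec) (use assms in \<open>auto intro!: carrier_vecI\<close>)
  also have "\<dots> \<le> op_norm A * (op_norm B * vec_norm2 v)"
    by (intro mult_left_mono op_norm_mult_vec) (use assms v in auto)
  finally show "vec_norm2 ((A * B) *\<^sub>v v) \<le> (op_norm A * op_norm B) * vec_norm2 v" by (simp add: algebra_simps)
qed auto

section \<open>The functional calculus\<close>

text \<open>At a point of the spectrum the value is arbitrary. This does no harm, since a residue
  sees only a punctured neighbourhood of the point.\<close>

definition resolvent :: "complex mat \<Rightarrow> complex \<Rightarrow> complex mat" where
  "resolvent x z = mat_inv' (z \<cdot>\<^sub>m 1\<^sub>m (dim_row x) - x)"

lemma hol_calc_dim [simp]: "dim_row (hol_calc f x) = dim_row x" "dim_col (hol_calc f x) = dim_row x"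
  by (auto simp: hol_calc_def)

lemma hol_calc_carrier [simp, intro]: "x \<in> carrier_mat n n \<Longrightarrow> hol_calc f x \<in> carrier_mat n n"
  by (auto simp: hol_calc_def)

lemma hol_calc_index:
  "i < dim_row x \<Longrightarrow> j < dim_row x \<Longrightarrow>
    hol_calc f x $$ (i, j) = (\<Sum>a\<in>spectrum x. residue (\<lambda>z. f z * resolvent x z $$ (i, j)) a)"
  by (simp add: hol_calc_def resolvent_def)

lemma spectrum_det:
  assumes "(x :: complex mat) \<in> carrier_mat n n"
  shows "z \<in> spectrum x \<longleftrightarrow> det (z \<cdot>\<^sub>m 1\<^sub>m n - x) = 0"
proof -
  have "z \<cdot>\<^sub>m 1\<^sub>m n - x = (-1) \<cdot>\<^sub>m char_matrix x z"
    by (rule eq_matI) (use assms in \<open>auto simp: char_matrix_def\<close>)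
  moreover have "det ((-1) \<cdot>\<^sub>m char_matrix x z) = (-1) ^ dim_col (char_matrix x z) * det (char_matrix x z)"
    by (rule det_smult)
  ultimately show ?thesis
    using eigenvalue_det[OF assms, of z] by (simp add: spectrum_def)
qed

lemma spectrum_finite: "(x :: complex mat) \<in> carrier_mat n n \<Longrightarrow> finite (spectrum x)"
  by (rule card_finite_spectrum)

text \<open>The last form is Cramer's rule. It makes every entry a quotient of polynomials in
  \<open>z\<close>, from which holomorphy off the spectrum follows.\<close>

lemma resolvent_carrier_inverse:
  assumes x: "x \<in> carrier_mat n n" and z: "z \<notin> spectrum x"
  shows "resolvent x z \<in> carrier_mat n n"
    and "(z \<cdot>\<^sub>m 1\<^sub>m n - x) * resolvent x z = 1\<^sub>m n"
    and "resolvent x z * (z \<cdot>\<^sub>m 1\<^sub>m n - x) = 1\<^sub>m n"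
    and "resolvent x z = (1 / det (z \<cdot>\<^sub>m 1\<^sub>m n - x)) \<cdot>\<^sub>m adj_mat (z \<cdot>\<^sub>m 1\<^sub>m n - x)"
proof -
  let ?Z = "z \<cdot>\<^sub>m 1\<^sub>m n - x"
  have Z: "?Z \<in> carrier_mat n n" using x by auto
  have d: "det ?Z \<noteq> 0" using spectrum_det[OF x] z by auto
  note adj = adj_mat[OF Z]
  let ?R = "(1 / det ?Z) \<cdot>\<^sub>m adj_mat ?Z"
  have R: "?R \<in> carrier_mat n n" using adj by auto
  have ZR: "?Z * ?R = 1\<^sub>m n"
    using adj d by (simp add: mult_smult_distrib[OF Z adj(1)]) (auto intro!: eq_matI)
  have eq: "resolvent x z = ?R"
    using mat_inv'_eqI[OF Z R ZR] x by (simp add: resolvent_def)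
  show "resolvent x z = ?R" by (rule eq)
  show "resolvent x z \<in> carrier_mat n n" "?Z * resolvent x z = 1\<^sub>m n" using eq R ZR by auto
  show "resolvent x z * ?Z = 1\<^sub>m n" using mat_mult_left_right_inverse[OF Z R ZR] eq by simp
qed

lemma resolvent_eqI:
  assumes "x \<in> carrier_mat n n" "R \<in> carrier_mat n n" "(z \<cdot>\<^sub>m 1\<^sub>m n - x) * R = 1\<^sub>m n"
  shows "resolvent x z = R"
  using mat_inv'_eqI[of "z \<cdot>\<^sub>m 1\<^sub>m n - x" n R] assms by (auto simp: resolvent_def minus_carrier_mat)

lemma det_holomorphic_on:
  assumes "\<And>z. M z \<in> carrier_mat n n"
    and "\<And>i j. i < n \<Longrightarrow> j < n \<Longrightarrow> (\<lambda>z. M z $$ (i, j)) holomorphic_on S"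
  shows "(\<lambda>z. det (M z)) holomorphic_on S"
proof -
  have "(\<lambda>z. \<Sum>p\<in>{p. p permutes {0..<n}}. signof p * (\<Prod>i = 0..<n. M z $$ (i, p i))) holomorphic_on S"
    by (intro holomorphic_intros assms(2)) (auto dest: permutes_in_image)
  then show ?thesis by (simp add: det_def'[OF assms(1)])
qed

lemma resolvent_holomorphic_on:
  assumes x: "x \<in> carrier_mat n n" and ij: "i < n" "j < n"
  shows "(\<lambda>z. resolvent x z $$ (i, j)) holomorphic_on (- spectrum x)"
proof -
  let ?Z = "\<lambda>z. z \<cdot>\<^sub>m 1\<^sub>m n - x"
  have Z: "\<And>z. ?Z z \<in> carrier_mat n n" using x by auto
  have ent: "(\<lambda>z. ?Z z $$ (k, l)) holomorphic_on S" if "k < n" "l < n" for k l S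
  proof -
    have "(\<lambda>z. ?Z z $$ (k, l)) = (\<lambda>z. z * (if k = l then 1 else 0) - x $$ (k, l))"
      using that x by auto
    then show ?thesis by (auto intro!: holomorphic_intros)
  qed
  \<comment> \<open>The adjugate is the transpose of the cofactor matrix: its entry at
    \<open>(i, j)\<close> arises by deleting row \<open>j\<close> and column
    \<open>i\<close>.\<close>
  have "(\<lambda>z. det (mat_delete (?Z z) j i)) holomorphic_on - spectrum x"
  proof (rule det_holomorphic_on)
    fix k l assume "k < n - 1" "l < n - 1"
    then have eq: "(\<lambda>z. mat_delete (?Z z) j i $$ (k, l)) =
        (\<lambda>z. ?Z z $$ (if k < j then k else Suc k, if l < i then l else Suc l))"
      using x by (auto simp: mat_delete_def)
    have "(\<lambda>z. ?Z z $$ (if k < j then k else Suc k, if l < i then l else Suc l)) holomorphic_on - spectrum x"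
      by (rule ent) (use \<open>k < n - 1\<close> \<open>l < n - 1\<close> in auto)
    then show "(\<lambda>z. mat_delete (?Z z) j i $$ (k, l)) holomorphic_on - spectrum x" unfolding eq .
  qed (use x in \<open>auto simp: mat_delete_def\<close>)
  then have "(\<lambda>z. cofactor (?Z z) j i) holomorphic_on - spectrum x"
    unfolding cofactor_def by (intro holomorphic_intros)
  moreover have "(\<lambda>z. det (?Z z)) holomorphic_on - spectrum x"
    by (rule det_holomorphic_on[OF Z ent])
  ultimately have "(\<lambda>z. (1 / det (?Z z)) * cofactor (?Z z) j i) holomorphic_on - spectrum x"
    using spectrum_det[OF x] by (intro holomorphic_intros) auto
  then show ?thesis
  proof (rule holomorphic_transform)
    fix z assume "z \<in> - spectrum x"
    then have "resolvent x z = (1 / det (?Z z)) \<cdot>\<^sub>m adj_mat (?Z z)"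
      by (intro resolvent_carrier_inverse[OF x]) auto
    then show "(1 / det (?Z z)) * cofactor (?Z z) j i = resolvent x z $$ (i, j)"
      using ij x by (simp add: adj_mat_def)
  qed
qed

lemma eventually_at_notin_finite:
  fixes a :: complex
  assumes "finite T"
  shows "\<forall>\<^sub>F z in at a. z \<notin> T"
proof -
  have "open (- (T - {a}))" using assms by (intro open_Compl finite_imp_closed) auto
  then have "\<forall>\<^sub>F z in at a. z \<in> - (T - {a}) - {a}"
    by (intro eventually_at_in_open) auto
  then show ?thesis by eventually_elim auto
qed

lemma residue_sum:
  assumes "open S" "a \<in> S" "finite I" "\<And>i. i \<in> I \<Longrightarrow> f i holomorphic_on S - {a}"
  shows "residue (\<lambda>z. \<Sum>i\<in>I. f i z) a = (\<Sum>i\<in>I. residue (f i) a)"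
  using assms(3,4)
proof (induction I rule: finite_induct)
  case empty
  then show ?case using residue_const[of 0 a] by simp
next
  case (insert k I)
  then have "residue (\<lambda>z. f k z + (\<Sum>i\<in>I. f i z)) a = residue (f k) a + residue (\<lambda>z. \<Sum>i\<in>I. f i z) a"
    by (intro residue_add[OF assms(1,2)] holomorphic_intros) auto
  then show ?case using insert by simp
qed

text \<open>Additivity of residues asks for one open set on which all functions involved are
  holomorphic away from \<open>a\<close>; this set serves \<open>f\<close> and all entries of the
  resolvent at once, whether or not \<open>a\<close> is an eigenvalue.\<close>

lemma punctured_nbhd:
  assumes x: "x \<in> carrier_mat n n" and f: "f analytic_on {a}"
  obtains S where "open S" "a \<in> S" "f holomorphic_on S" "S \<inter> spectrum x \<subseteq> {a}"
proof -
  obtain e where e: "e > 0" "f holomorphic_on ball a e" using f unfolding analytic_on_def by auto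
  let ?S = "ball a e - (spectrum x - {a})"
  have "open ?S" using spectrum_finite[OF x] by (intro open_Diff finite_imp_closed) auto
  moreover have "f holomorphic_on ?S" using e(2) by (rule holomorphic_on_subset) auto
  ultimately show ?thesis using that[of ?S] e(1) by auto
qed

lemma residue_combination:
  assumes x: "x \<in> carrier_mat n n" and f: "f analytic_on {a}"
  shows "residue (\<lambda>z. f z * (\<Sum>k<n. \<Sum>l<n. c k l * resolvent x z $$ (k, l))) a =
    (\<Sum>k<n. \<Sum>l<n. c k l * residue (\<lambda>z. f z * resolvent x z $$ (k, l)) a)"
proof -
  obtain S where S: "open S" "a \<in> S" "f holomorphic_on S" "S \<inter> spectrum x \<subseteq> {a}"
    using punctured_nbhd[OF x f] by blast
  have h: "(\<lambda>z. f z * resolvent x z $$ (k, l)) holomorphic_on S - {a}" if "k < n" "l < n" for k l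
    by (intro holomorphic_intros holomorphic_on_subset[OF S(3)] holomorphic_on_subset[OF resolvent_holomorphic_on[OF x that]])
       (use S in auto)
  have "residue (\<lambda>z. f z * (\<Sum>k<n. \<Sum>l<n. c k l * resolvent x z $$ (k, l))) a
      = residue (\<lambda>z. \<Sum>k<n. \<Sum>l<n. c k l * (f z * resolvent x z $$ (k, l))) a"
    by (simp add: sum_distrib_left mult_ac)
  also have "\<dots> = (\<Sum>k<n. residue (\<lambda>z. \<Sum>l<n. c k l * (f z * resolvent x z $$ (k, l))) a)"
    by (rule residue_sum[OF S(1,2)]) (auto intro!: holomorphic_intros h)
  also have "\<dots> = (\<Sum>k<n. \<Sum>l<n. residue (\<lambda>z. c k l * (f z * resolvent x z $$ (k, l))) a)"
    by (intro sum.cong refl residue_sum[OF S(1,2)]) (auto intro!: holomorphic_intros h)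
  also have "\<dots> = (\<Sum>k<n. \<Sum>l<n. c k l * residue (\<lambda>z. f z * resolvent x z $$ (k, l)) a)"
    by (intro sum.cong refl residue_lmul[OF S(1,2)] h) auto
  finally show ?thesis .
qed

text \<open>A linear functional of the matrix \<open>hol_calc f x\<close> may be moved under the
  residues. With \<open>c k l\<close> the product of entries of \<open>P\<close> and
  \<open>Q\<close> this gives similarity invariance; with \<open>c k l = w $ k * v $ l\<close> it
  reduces the norm estimate to scalar functions.\<close>

lemma hol_calc_combination:
  assumes x: "x \<in> carrier_mat n n" and f: "f analytic_on spectrum x"
  shows "(\<Sum>k<n. \<Sum>l<n. c k l * hol_calc f x $$ (k, l)) =
    (\<Sum>a\<in>spectrum x. residue (\<lambda>z. f z * (\<Sum>k<n. \<Sum>l<n. c k l * resolvent x z $$ (k, l))) a)"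
proof -
  have "(\<Sum>k<n. \<Sum>l<n. c k l * hol_calc f x $$ (k, l)) =
      (\<Sum>k<n. \<Sum>l<n. \<Sum>a\<in>spectrum x. c k l * residue (\<lambda>z. f z * resolvent x z $$ (k, l)) a)"
    using x by (intro sum.cong refl) (simp add: hol_calc_index sum_distrib_left)
  also have "\<dots> = (\<Sum>a\<in>spectrum x. \<Sum>k<n. \<Sum>l<n. c k l * residue (\<lambda>z. f z * resolvent x z $$ (k, l)) a)"
    by (simp add: sum.swap[of _ "spectrum x"])
  also have "\<dots> = (\<Sum>a\<in>spectrum x. residue (\<lambda>z. f z * (\<Sum>k<n. \<Sum>l<n. c k l * resolvent x z $$ (k, l))) a)"
    by (intro sum.cong refl, subst residue_combination[OF x])
       (use f analytic_on_analytic_at in blast)+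
  finally show ?thesis .
qed

text \<open>Equality on an open set around the spectrum is asked for, not just on the spectrum: at a
  multiple eigenvalue the residue also involves derivatives of \<open>f\<close>.\<close>

lemma hol_calc_cong:
  assumes x: "x \<in> carrier_mat n n" and S: "open S" "spectrum x \<subseteq> S" and eq: "\<And>z. z \<in> S \<Longrightarrow> f z = g z"
  shows "hol_calc f x = hol_calc g x"
proof (rule eq_matI)
  fix i j assume "i < dim_row (hol_calc g x)" "j < dim_col (hol_calc g x)"
  then have ij: "i < dim_row x" "j < dim_row x" by auto
  have "residue (\<lambda>z. f z * resolvent x z $$ (i, j)) a = residue (\<lambda>z. g z * resolvent x z $$ (i, j)) a"
    if "a \<in> spectrum x" for a
  proof (rule residue_cong)
    have "eventually (\<lambda>z. z \<in> S) (at a)" using S that by (intro eventually_at_in_open') auto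
    then show "\<forall>\<^sub>F z in at a. f z * resolvent x z $$ (i, j) = g z * resolvent x z $$ (i, j)"
      by eventually_elim (simp add: eq)
  qed simp
  then show "hol_calc f x $$ (i, j) = hol_calc g x $$ (i, j)"
    using ij by (simp add: hol_calc_index)
qed auto

section \<open>Direct sums and similarities in the functional calculus\<close>

lemma dsum_shift:
  assumes "x \<in> carrier_mat n n" "y \<in> carrier_mat m m"
  shows "z \<cdot>\<^sub>m 1\<^sub>m (n + m) - mat_dsum x y = mat_dsum (z \<cdot>\<^sub>m 1\<^sub>m n - x) (z \<cdot>\<^sub>m 1\<^sub>m m - y)"
  by (rule eq_matI) (use assms in \<open>auto simp: mat_dsum_index\<close>)

lemma spectrum_dsum:
  assumes "(x :: complex mat) \<in> carrier_mat n n" "y \<in> carrier_mat m m"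
  shows "spectrum (mat_dsum x y) = spectrum x \<union> spectrum y"
proof -
  have "z \<in> spectrum (mat_dsum x y) \<longleftrightarrow> z \<in> spectrum x \<union> spectrum y" for z
  proof -
    have xy: "mat_dsum x y \<in> carrier_mat (n + m) (n + m)" using assms by auto
    note dsum_shift[OF assms, of z]
    also have "det (mat_dsum (z \<cdot>\<^sub>m 1\<^sub>m n - x) (z \<cdot>\<^sub>m 1\<^sub>m m - y)) = det (z \<cdot>\<^sub>m 1\<^sub>m n - x) * det (z \<cdot>\<^sub>m 1\<^sub>m m - y)"
      unfolding mat_dsum_def by (rule det_four_block_mat_upper_right_zero[of _ n _ m]) (use assms in auto)
    finally show ?thesis using spectrum_det[OF xy, of z] spectrum_det[OF assms(1), of z] spectrum_det[OF assms(2), of z] by simp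
  qed
  then show ?thesis by auto
qed

lemma resolvent_dsum:
  assumes x: "x \<in> carrier_mat n n" and y: "y \<in> carrier_mat m m"
    and z: "z \<notin> spectrum x" "z \<notin> spectrum y"
  shows "resolvent (mat_dsum x y) z = mat_dsum (resolvent x z) (resolvent y z)"
proof (rule resolvent_eqI)
  note rx = resolvent_carrier_inverse[OF x z(1)] and ry = resolvent_carrier_inverse[OF y z(2)]
  show "mat_dsum (resolvent x z) (resolvent y z) \<in> carrier_mat (n + m) (n + m)" using rx ry by auto
  show "mat_dsum x y \<in> carrier_mat (n + m) (n + m)" using x y by auto
  show "(z \<cdot>\<^sub>m 1\<^sub>m (n + m) - mat_dsum x y) * mat_dsum (resolvent x z) (resolvent y z) = 1\<^sub>m (n + m)"
    using mat_dsum_mult[of "z \<cdot>\<^sub>m 1\<^sub>m n - x" n "z \<cdot>\<^sub>m 1\<^sub>m m - y" m "resolvent x z" "resolvent y z"] rx ry x y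
    unfolding dsum_shift[OF x y] by (simp add: mat_dsum_one minus_carrier_mat)
qed

text \<open>At a point off the spectrum the integrand is holomorphic and contributes no residue. The
  two summands of a direct sum can thus be expanded over the union of their spectra.\<close>

lemma hol_calc_index_superset:
  assumes x: "x \<in> carrier_mat n n" and ij: "i < n" "j < n"
    and T: "finite T" "spectrum x \<subseteq> T" and f: "f analytic_on T"
  shows "hol_calc f x $$ (i, j) = (\<Sum>a\<in>T. residue (\<lambda>z. f z * resolvent x z $$ (i, j)) a)"
proof -
  have "residue (\<lambda>z. f z * resolvent x z $$ (i, j)) a = 0" if a: "a \<in> T - spectrum x" for a
  proof -
    have fa: "f analytic_on {a}" using f a analytic_on_subset by blast
    obtain S where S: "open S" "a \<in> S" "f holomorphic_on S" "S \<inter> spectrum x \<subseteq> {a}"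
      using punctured_nbhd[OF x fa] by blast
    have "(\<lambda>z. f z * resolvent x z $$ (i, j)) holomorphic_on S"
      by (intro holomorphic_intros S(3) holomorphic_on_subset[OF resolvent_holomorphic_on[OF x ij]])
         (use S a in auto)
    then show ?thesis using residue_holo[OF S(1,2)] by blast
  qed
  then show ?thesis
    using x ij T by (auto simp: hol_calc_index intro!: sum.mono_neutral_left)
qed

lemma hol_calc_dsum:
  assumes x: "x \<in> carrier_mat n n" and y: "y \<in> carrier_mat m m"
    and f: "f analytic_on spectrum x \<union> spectrum y"
  shows "hol_calc f (mat_dsum x y) = mat_dsum (hol_calc f x) (hol_calc f y)"
proof (rule eq_matI)
  let ?T = "spectrum x \<union> spectrum y"
  have fin: "finite ?T" using spectrum_finite x y by auto
  have ev: "\<forall>\<^sub>F z in at a. resolvent (mat_dsum x y) z = mat_dsum (resolvent x z) (resolvent y z)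
      \<and> resolvent x z \<in> carrier_mat n n \<and> resolvent y z \<in> carrier_mat m m" for a
  proof -
    have "\<forall>\<^sub>F z in at a. z \<notin> ?T" by (rule eventually_at_notin_finite[OF fin])
    then show ?thesis
      by eventually_elim (use resolvent_dsum[OF x y] resolvent_carrier_inverse(1)[OF x] resolvent_carrier_inverse(1)[OF y] in auto)
  qed
  fix i j assume "i < dim_row (mat_dsum (hol_calc f x) (hol_calc f y))"
    "j < dim_col (mat_dsum (hol_calc f x) (hol_calc f y))"
  then have ij: "i < n + m" "j < n + m" using x y by auto
  have *: "residue (\<lambda>z. f z * resolvent (mat_dsum x y) z $$ (i, j)) a =
     (if i < n then if j < n then residue (\<lambda>z. f z * resolvent x z $$ (i, j)) a else 0
      else if j < n then 0 else residue (\<lambda>z. f z * resolvent y z $$ (i - n, j - n)) a)" for a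
  proof -
    have "residue (\<lambda>z. f z * resolvent (mat_dsum x y) z $$ (i, j)) a =
      residue (\<lambda>z. if i < n then if j < n then f z * resolvent x z $$ (i, j) else 0
      else if j < n then 0 else f z * resolvent y z $$ (i - n, j - n)) a"
      by (rule residue_cong[OF eventually_mono[OF ev[of a]]]) (use ij in \<open>auto simp: mat_dsum_index\<close>)
    then show ?thesis using residue_const[of 0 a] by auto
  qed
  have c: "i \<notin> {..<n} \<Longrightarrow> i - n < m" "j \<notin> {..<n} \<Longrightarrow> j - n < m" using ij by auto
  show "hol_calc f (mat_dsum x y) $$ (i, j) = mat_dsum (hol_calc f x) (hol_calc f y) $$ (i, j)"
    using ij x y c hol_calc_index_superset[OF x _ _ fin _ f, of i j]
      hol_calc_index_superset[OF y _ _ fin _ f, of "i - n" "j - n"]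
    by (auto simp: mat_dsum_index hol_calc_index spectrum_dsum[OF x y] *)
qed (use x y in auto)

lemma similar_shift:
  fixes x :: "complex mat"
  assumes x: "x \<in> carrier_mat n n" and PQ: "P \<in> carrier_mat n n" "Q \<in> carrier_mat n n" "P * Q = 1\<^sub>m n"
  shows "z \<cdot>\<^sub>m 1\<^sub>m n - P * x * Q = P * (z \<cdot>\<^sub>m 1\<^sub>m n - x) * Q"
proof -
  have "P * (z \<cdot>\<^sub>m 1\<^sub>m n - x) * Q = (z \<cdot>\<^sub>m P - P * x) * Q"
    using x PQ(1) mult_smult_distrib[OF PQ(1), of "1\<^sub>m n" n z]
    by (subst mult_minus_distrib_mat[of _ n n _ n]) auto
  also have "\<dots> = z \<cdot>\<^sub>m (P * Q) - P * x * Q"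
    using x PQ by (subst minus_mult_distrib_mat[of _ n n _ _ n]) (auto simp: mult_smult_assoc_mat)
  finally show ?thesis using PQ by simp
qed

lemma similar_resolvent:
  assumes x: "x \<in> carrier_mat n n" and PQ: "P \<in> carrier_mat n n" "Q \<in> carrier_mat n n" "P * Q = 1\<^sub>m n"
  shows "spectrum (P * x * Q) = spectrum x"
    and "z \<notin> spectrum x \<Longrightarrow> resolvent (P * x * Q) z = P * resolvent x z * Q"
proof -
  have QP: "Q * P = 1\<^sub>m n" by (rule mat_mult_left_right_inverse[OF PQ])
  note eq = similar_shift[OF x PQ]
  have PxQ: "P * x * Q \<in> carrier_mat n n" using x PQ by auto
  have dPQ: "det P * det Q = 1" using det_mult[OF PQ(1,2)] PQ(3) by simp
  have "det (z \<cdot>\<^sub>m 1\<^sub>m n - P * x * Q) = det (z \<cdot>\<^sub>m 1\<^sub>m n - x)" for z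
  proof -
    have "det (P * (z \<cdot>\<^sub>m 1\<^sub>m n - x) * Q) = det P * det (z \<cdot>\<^sub>m 1\<^sub>m n - x) * det Q"
    proof -
      have "z \<cdot>\<^sub>m 1\<^sub>m n - x \<in> carrier_mat n n" using x by auto
      then show ?thesis using PQ det_mult[of "P * (z \<cdot>\<^sub>m 1\<^sub>m n - x)" n Q] det_mult[of P n "z \<cdot>\<^sub>m 1\<^sub>m n - x"]
        by (metis mult_carrier_mat)
    qed
    also have "\<dots> = det (z \<cdot>\<^sub>m 1\<^sub>m n - x) * (det P * det Q)" by (simp only: mult_ac)
    finally show ?thesis unfolding eq dPQ by simp
  qed
  then show sp: "spectrum (P * x * Q) = spectrum x"
    using spectrum_det[OF PxQ] spectrum_det[OF x] by auto
  assume z: "z \<notin> spectrum x"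
  note r = resolvent_carrier_inverse[OF x z]
  show "resolvent (P * x * Q) z = P * resolvent x z * Q"
  proof (rule resolvent_eqI[OF PxQ])
    show "P * resolvent x z * Q \<in> carrier_mat n n" using r PQ by auto
    let ?Z = "z \<cdot>\<^sub>m 1\<^sub>m n - x" let ?R = "resolvent x z"
    have Z: "?Z \<in> carrier_mat n n" using x by auto
    have "P * ?Z * Q * (P * ?R * Q) = P * (?Z * ((Q * P) * (?R * Q)))"
      using PQ Z r(1) by (simp add: assoc_mult_mat[of _ n n _ n _ n])
    also have "\<dots> = P * ((?Z * ?R) * Q)"
      using PQ Z r(1) QP by (simp add: assoc_mult_mat[of _ n n _ n _ n])
    also have "\<dots> = 1\<^sub>m n" using r PQ by simp
    finally show "(z \<cdot>\<^sub>m 1\<^sub>m n - P * x * Q) * (P * ?R * Q) = 1\<^sub>m n" unfolding eq .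
  qed
qed

lemma mat_triple_index:
  assumes "A \<in> carrier_mat n n" "(B :: complex mat) \<in> carrier_mat n n" "C \<in> carrier_mat n n" "i < n" "j < n"
  shows "(A * B * C) $$ (i, j) = (\<Sum>k<n. \<Sum>l<n. (A $$ (i, k) * C $$ (l, j)) * B $$ (k, l))"
proof -
  have "(A * B * C) $$ (i, j) = (\<Sum>k<n. A $$ (i, k) * (\<Sum>l<n. B $$ (k, l) * C $$ (l, j)))"
    using assms by (simp add: scalar_prod_def atLeast0LessThan)
  then show ?thesis by (simp add: sum_distrib_left mult_ac)
qed

lemma hol_calc_similar:
  assumes x: "x \<in> carrier_mat n n" and PQ: "P \<in> carrier_mat n n" "Q \<in> carrier_mat n n" "P * Q = 1\<^sub>m n"
    and f: "f analytic_on spectrum x"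
  shows "hol_calc f (P * x * Q) = P * hol_calc f x * Q"
proof (rule eq_matI)
  note sp = similar_resolvent[OF x PQ]
  fix i j assume "i < dim_row (P * hol_calc f x * Q)" "j < dim_col (P * hol_calc f x * Q)"
  then have ij: "i < n" "j < n" using PQ by auto
  have "hol_calc f (P * x * Q) $$ (i, j) =
      (\<Sum>a\<in>spectrum x. residue (\<lambda>z. f z * resolvent (P * x * Q) z $$ (i, j)) a)"
    using ij PQ x sp by (simp add: hol_calc_index)
  also have "\<dots> = (\<Sum>a\<in>spectrum x. residue (\<lambda>z. f z * (\<Sum>k<n. \<Sum>l<n. (P $$ (i, k) * Q $$ (l, j)) * resolvent x z $$ (k, l))) a)"
  proof (intro sum.cong refl residue_cong)
    fix a
    have "\<forall>\<^sub>F z in at a. z \<notin> spectrum x" by (rule eventually_at_notin_finite[OF spectrum_finite[OF x]])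
    then show "\<forall>\<^sub>F z in at a. f z * resolvent (P * x * Q) z $$ (i, j)
        = f z * (\<Sum>k<n. \<Sum>l<n. (P $$ (i, k) * Q $$ (l, j)) * resolvent x z $$ (k, l))"
      by eventually_elim (use sp(2) mat_triple_index[OF PQ(1) resolvent_carrier_inverse(1)[OF x] PQ(2) ij] in auto)
  qed
  also have "\<dots> = (\<Sum>k<n. \<Sum>l<n. (P $$ (i, k) * Q $$ (l, j)) * hol_calc f x $$ (k, l))"
    by (rule hol_calc_combination[OF x f, symmetric])
  also have "\<dots> = (P * hol_calc f x * Q) $$ (i, j)"
    using mat_triple_index[OF PQ(1) hol_calc_carrier[OF x] PQ(2) ij] by simp
  finally show "hol_calc f (P * x * Q) $$ (i, j) = (P * hol_calc f x * Q) $$ (i, j)" .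
qed (use x PQ in auto)

section \<open>Reduction to Jordan blocks and multiplicativity\<close>

text \<open>The Jordan normal form as an induction principle. Peeling off one block at a time turns
  the Jordan matrix into iterated binary sums that end in the empty matrix, so a property has to be
  checked on single blocks and shown to be stable under \<open>mat_dsum\<close> and
  similarity.\<close>

lemma jordan_dsum_induct [consumes 1, case_names zero block dsum similar]:
  assumes x: "(x :: complex mat) \<in> carrier_mat n n"
    and "Q (0\<^sub>m 0 0)"
    and block: "\<And>k a. Q (jordan_block k a)"
    and dsum: "\<And>A B p q. A \<in> carrier_mat p p \<Longrightarrow> B \<in> carrier_mat q q \<Longrightarrow> Q A \<Longrightarrow> Q B \<Longrightarrow> Q (mat_dsum A B)"
    and similar: "\<And>A p U V. A \<in> carrier_mat p p \<Longrightarrow> U \<in> carrier_mat p p \<Longrightarrow> V \<in> carrier_mat p p \<Longrightarrow>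
       U * V = 1\<^sub>m p \<Longrightarrow> Q A \<Longrightarrow> Q (U * A * V)"
  shows "Q x"
proof -
  obtain as where "char_poly x = (\<Prod>a\<leftarrow>as. [:- a, 1:])" using char_poly_factorized[OF x] by auto
  from jordan_nf_exists[OF x this] obtain nas where "similar_mat x (jordan_matrix nas)"
    unfolding jordan_nf_def by auto
  from similar_matD[OF this] obtain m U V where UV: "{x, jordan_matrix nas, U, V} \<subseteq> carrier_mat m m"
    "U * V = 1\<^sub>m m" "x = U * jordan_matrix nas * V" by auto
  have "Q (jordan_matrix nas)"
  proof (induction nas)
    case Nil
    then show ?case using assms(2) by (simp add: jordan_matrix_def)
  next
    case (Cons na nas)
    obtain k a where na: "na = (k, a)" by force
    have "jordan_matrix (na # nas) = mat_dsum (jordan_block k a) (jordan_matrix nas)"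
      unfolding na jordan_matrix_def by (simp add: Let_def mat_dsum_def)
    then show ?case using dsum[OF _ _ block Cons.IH] jordan_block_carrier jordan_matrix_carrier by metis
  qed
  then show ?thesis using similar[of "jordan_matrix nas" m U V] UV by auto
qed

lemma spectrum_jordan_block: "spectrum (jordan_block n (a :: complex)) = (if n = 0 then {} else {a})"
  using spectrum_root_char_poly[OF jordan_block_carrier, of n a] by (auto simp: jordan_block_char_poly)

text \<open>The finite Neumann series: for the nilpotent shift \<open>N\<close> the inverse of
  \<open>(z - a) - N\<close> is the sum of \<open>N^k / (z - a)^(k + 1)\<close>.\<close>

lemma resolvent_jordan_block:
  assumes "z \<noteq> a"
  shows "resolvent (jordan_block n a) z = mat n n (\<lambda>(i, j). if i \<le> j then 1 / (z - a) ^ Suc (j - i) else 0)"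
    (is "_ = ?B")
proof (rule resolvent_eqI[OF jordan_block_carrier])
  show "?B \<in> carrier_mat n n" by simp
  let ?b = "\<lambda>i j. if i \<le> j then 1 / (z - a) ^ Suc (j - i) else 0"
  show "(z \<cdot>\<^sub>m 1\<^sub>m n - jordan_block n a) * ?B = 1\<^sub>m n"
  proof (rule eq_matI)
    fix i j assume "i < dim_row (1\<^sub>m n)" "j < dim_col (1\<^sub>m n)"
    then have ij: "i < n" "j < n" by auto
    have "((z \<cdot>\<^sub>m 1\<^sub>m n - jordan_block n a) * ?B) $$ (i, j)
        = (\<Sum>k<n. (z \<cdot>\<^sub>m 1\<^sub>m n - jordan_block n a) $$ (i, k) * ?b k j)"
      using ij by (simp add: scalar_prod_def atLeast0LessThan)
    also have "\<dots> = (\<Sum>k<n. (if k = i then (z - a) * ?b i j else 0) + (if k = Suc i then - ?b (Suc i) j else 0))"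
      using ij by (intro sum.cong refl) auto
    also have "\<dots> = (z - a) * ?b i j - (if Suc i < n then ?b (Suc i) j else 0)"
      using ij by (simp add: sum.distrib)
    also have "\<dots> = 1\<^sub>m n $$ (i, j)"
    proof -
      consider "i = j" | "j < i" | m where "j = Suc (i + m)"
        by (metis less_iff_Suc_add linorder_neqE_nat)
      then show ?thesis
      proof cases
        \<comment> \<open>Above the diagonal the two terms cancel, both being
          \<open>1 / (z - a) ^ Suc m\<close>.\<close>
        case 3
        then have "j - i = Suc m" "j - Suc i = m" "Suc i < n" "i \<le> j" "Suc i \<le> j" "i \<noteq> j" using ij by auto
        then show ?thesis using assms ij by simp
      qed (use assms ij in auto)
    qed
    finally show "((z \<cdot>\<^sub>m 1\<^sub>m n - jordan_block n a) * ?B) $$ (i, j) = 1\<^sub>m n $$ (i, j)" .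
  qed auto
qed

text \<open>The residue of \<open>f z / (z - a)^(k + 1)\<close> at \<open>a\<close> is the Taylor
  coefficient of order \<open>k\<close>, so \<open>f\<close> of a Jordan block is the upper
  triangular Toeplitz matrix of the Taylor coefficients of \<open>f\<close> at
  \<open>a\<close>.\<close>

lemma hol_calc_jordan_block:
  assumes f: "f analytic_on {a}" and ij: "i < n" "j < n"
  shows "hol_calc f (jordan_block n a) $$ (i, j) =
    (if i \<le> j then (deriv ^^ (j - i)) f a / fact (j - i) else 0)"
proof -
  obtain e where e: "e > 0" "f holomorphic_on ball a e" using f unfolding analytic_on_def by auto
  have "hol_calc f (jordan_block n a) $$ (i, j) = residue (\<lambda>z. f z * resolvent (jordan_block n a) z $$ (i, j)) a"
    using ij by (simp add: hol_calc_index spectrum_jordan_block)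
  also have "\<dots> = residue (\<lambda>z. if i \<le> j then f z / (z - a) ^ Suc (j - i) else 0) a"
    by (rule residue_cong)
       (use ij in \<open>auto simp: eventually_at_filter resolvent_jordan_block intro!: always_eventually\<close>)
  also have "\<dots> = (if i \<le> j then (deriv ^^ (j - i)) f a / fact (j - i) else 0)"
    using residue_holomorphic_over_power[of "ball a e" a f "j - i"] e residue_const[of 0 a] by auto
  finally show ?thesis .
qed

text \<open>The product of two upper triangular Toeplitz matrices convolves their coefficients, and
  for Taylor coefficients this convolution is the Leibniz rule.\<close>

lemma hol_calc_mult_jordan_block:
  assumes f: "f analytic_on {a}" and g: "g analytic_on {a}"
  shows "hol_calc (\<lambda>z. f z * g z) (jordan_block n a) = hol_calc f (jordan_block n a) * hol_calc g (jordan_block n a)"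
proof (rule eq_matI)
  let ?J = "jordan_block n a"
  fix i j assume "i < dim_row (hol_calc f ?J * hol_calc g ?J)" "j < dim_col (hol_calc f ?J * hol_calc g ?J)"
  then have ij: "i < n" "j < n" by auto
  obtain e e' where e: "e > 0" "f holomorphic_on ball a e" "e' > 0" "g holomorphic_on ball a e'"
    using f g unfolding analytic_on_def by auto
  let ?S = "ball a (min e e')"
  have S: "f holomorphic_on ?S" "g holomorphic_on ?S" "open ?S" "a \<in> ?S"
    using e by (auto intro: holomorphic_on_subset)
  let ?d = "\<lambda>f m. (deriv ^^ m) f a / fact m"
  have fg: "(\<lambda>z. f z * g z) analytic_on {a}" using f g by (intro analytic_intros)
  have "(hol_calc f ?J * hol_calc g ?J) $$ (i, j) = (\<Sum>k<n. hol_calc f ?J $$ (i, k) * hol_calc g ?J $$ (k, j))"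
    using ij by (simp add: scalar_prod_def atLeast0LessThan)
  also have "\<dots> = (\<Sum>k<n. if i \<le> k \<and> k \<le> j then ?d f (k - i) * ?d g (j - k) else 0)"
    using ij by (intro sum.cong refl) (auto simp: hol_calc_jordan_block[OF f] hol_calc_jordan_block[OF g])
  also have "\<dots> = (\<Sum>k\<in>{i..j}. ?d f (k - i) * ?d g (j - k))"
    using ij by (intro sum.mono_neutral_cong_right) auto
  also have "\<dots> = (if i \<le> j then \<Sum>m = 0..j - i. ?d f m * ?d g (j - i - m) else 0)"
  proof (cases "i \<le> j")
    case True
    have "(\<Sum>k\<in>{i..j}. ?d f (k - i) * ?d g (j - k)) = (\<Sum>m = 0..j - i. ?d f m * ?d g (j - i - m))"
      by (rule sum.reindex_bij_witness[of _ "\<lambda>m. m + i" "\<lambda>k. k - i"]) (use True in auto)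
    then show ?thesis using True by simp
  qed simp
  also have "\<dots> = (if i \<le> j then ?d (\<lambda>z. f z * g z) (j - i) else 0)"
  proof -
    have "?d (\<lambda>z. f z * g z) m = (\<Sum>l = 0..m. ?d f l * ?d g (m - l))" for m
      unfolding higher_deriv_mult[OF S] sum_divide_distrib
      by (intro sum.cong refl) (simp add: binomial_fact)
    then show ?thesis by simp
  qed
  also have "\<dots> = hol_calc (\<lambda>z. f z * g z) ?J $$ (i, j)"
    by (rule hol_calc_jordan_block[OF fg ij, symmetric])
  finally show "hol_calc (\<lambda>z. f z * g z) ?J $$ (i, j) = (hol_calc f ?J * hol_calc g ?J) $$ (i, j)" by simp
qed auto

lemma mat_0_eq: "A \<in> carrier_mat 0 0 \<Longrightarrow> B \<in> carrier_mat 0 0 \<Longrightarrow> A = B"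
  by (rule eq_matI) auto

lemma similar_mult:
  assumes "(A :: complex mat) \<in> carrier_mat n n" "B \<in> carrier_mat n n" "U \<in> carrier_mat n n" "V \<in> carrier_mat n n"
    and UV: "U * V = 1\<^sub>m n"
  shows "U * (A * B) * V = (U * A * V) * (U * B * V)"
proof -
  have VU: "V * U = 1\<^sub>m n" by (rule mat_mult_left_right_inverse[OF assms(3,4) UV])
  have "(U * A * V) * (U * B * V) = U * (A * ((V * U) * (B * V)))"
    using assms by (simp add: assoc_mult_mat[of _ n n _ n _ n])
  also have "\<dots> = U * (A * B) * V"
    using assms VU by (simp add: assoc_mult_mat[of _ n n _ n _ n])
  finally show ?thesis by simp
qed

lemma hol_calc_mult:
  assumes "x \<in> carrier_mat n n" "f analytic_on spectrum x" "g analytic_on spectrum x"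
  shows "hol_calc (\<lambda>z. f z * g z) x = hol_calc f x * hol_calc g x"
proof -
  \<comment> \<open>The analyticity conditions belong to the induction predicate, because they speak
    of the spectrum of the matrix that varies in the induction.\<close>
  have "f analytic_on spectrum x \<longrightarrow> g analytic_on spectrum x \<longrightarrow>
      hol_calc (\<lambda>z. f z * g z) x = hol_calc f x * hol_calc g x"
    using assms(1)
  proof (induction rule: jordan_dsum_induct)
    case zero
    show ?case by (auto intro!: mat_0_eq)
  next
    case (block k a)
    show ?case
    proof (cases "k = 0")
      case True
      then show ?thesis using mat_0_eq[of "hol_calc (\<lambda>z. f z * g z) (jordan_block k a)"
          "hol_calc f (jordan_block k a) * hol_calc g (jordan_block k a)"]
        by (auto intro!: carrier_matI)
    qed (use hol_calc_mult_jordan_block in \<open>auto simp: spectrum_jordan_block\<close>)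
  next
    case (dsum A B p q)
    show ?case
    proof (intro impI)
      assume f: "f analytic_on spectrum (mat_dsum A B)" and g: "g analytic_on spectrum (mat_dsum A B)"
      have "f analytic_on spectrum A \<union> spectrum B" "g analytic_on spectrum A \<union> spectrum B"
        using f g spectrum_dsum[OF dsum(1,2)] by auto
      moreover from this have "f analytic_on spectrum A" "f analytic_on spectrum B"
        "g analytic_on spectrum A" "g analytic_on spectrum B" by (auto intro: analytic_on_subset)
      moreover have "(\<lambda>z. f z * g z) analytic_on spectrum A \<union> spectrum B"
        by (intro analytic_intros calculation)
      ultimately show "hol_calc (\<lambda>z. f z * g z) (mat_dsum A B) = hol_calc f (mat_dsum A B) * hol_calc g (mat_dsum A B)"
        using dsum by (simp add: hol_calc_dsum[OF dsum(1,2)] mat_dsum_mult[of _ p _ q])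
    qed
  next
    case (similar A p U V)
    note sp = similar_resolvent(1)[OF similar(1-4)]
    show ?case
    proof (intro impI)
      assume "f analytic_on spectrum (U * A * V)" and "g analytic_on spectrum (U * A * V)"
      then have fg: "f analytic_on spectrum A" "g analytic_on spectrum A" using sp by auto
      then have "(\<lambda>z. f z * g z) analytic_on spectrum A" by (intro analytic_intros)
      then show "hol_calc (\<lambda>z. f z * g z) (U * A * V) = hol_calc f (U * A * V) * hol_calc g (U * A * V)"
        using fg similar(5) similar_mult[of "hol_calc f A" p "hol_calc g A" U V] similar(1-4)
        by (simp add: hol_calc_similar[OF similar(1-4)] del: assoc_mult_mat)
    qed
  qed
  then show ?thesis using assms by blast
qed

lemma hol_calc_one:
  assumes "x \<in> carrier_mat n n"
  shows "hol_calc (\<lambda>z. 1) x = 1\<^sub>m n"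
proof -
  have "hol_calc (\<lambda>z. 1) x = 1\<^sub>m (dim_row x)"
    using assms
  proof (induction rule: jordan_dsum_induct)
    case zero
    show ?case by (auto intro!: mat_0_eq)
  next
    case (block k a)
    show ?case
    proof (rule eq_matI)
      fix i j assume "i < dim_row (1\<^sub>m (dim_row (jordan_block k a)))" "j < dim_col (1\<^sub>m (dim_row (jordan_block k a)))"
      then have ij: "i < k" "j < k" by auto
      show "hol_calc (\<lambda>z. 1) (jordan_block k a) $$ (i, j) = 1\<^sub>m (dim_row (jordan_block k a)) $$ (i, j)"
        using ij by (subst hol_calc_jordan_block) (auto simp: analytic_on_const higher_deriv_const)
    qed auto
  next
    case (dsum A B p q)
    then show ?case by (simp add: hol_calc_dsum[OF dsum(1,2)] analytic_on_const mat_dsum_one)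
  next
    case (similar A p U V)
    have "hol_calc (\<lambda>z. 1) (U * A * V) = U * 1\<^sub>m p * V"
      using similar by (simp add: hol_calc_similar[OF similar(1-4)] analytic_on_const del: assoc_mult_mat)
    then show ?case using similar by simp
  qed
  then show ?thesis using assms by simp
qed

lemma hol_calc_const:
  assumes x: "x \<in> carrier_mat n n"
  shows "hol_calc (\<lambda>z. c) x = c \<cdot>\<^sub>m 1\<^sub>m n"
proof (rule eq_matI)
  fix i j assume "i < dim_row (c \<cdot>\<^sub>m 1\<^sub>m n)" "j < dim_col (c \<cdot>\<^sub>m 1\<^sub>m n)"
  then have ij: "i < n" "j < n" by auto
  have "residue (\<lambda>z. c * resolvent x z $$ (i, j)) a = c * residue (\<lambda>z. 1 * resolvent x z $$ (i, j)) a" for a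
  proof -
    obtain S where S: "open S" "a \<in> S" "S \<inter> spectrum x \<subseteq> {a}"
      using punctured_nbhd[OF x analytic_on_const[of 0]] by blast
    show ?thesis
      using residue_lmul[OF S(1,2) holomorphic_on_subset[OF resolvent_holomorphic_on[OF x ij]], of c] S by auto
  qed
  then have "hol_calc (\<lambda>z. c) x $$ (i, j) = c * hol_calc (\<lambda>z. 1) x $$ (i, j)"
    using ij x by (simp add: hol_calc_index sum_distrib_left)
  then show "hol_calc (\<lambda>z. c) x $$ (i, j) = (c \<cdot>\<^sub>m 1\<^sub>m n) $$ (i, j)"
    using ij hol_calc_one[OF x] by simp
qed (use x in auto)

section \<open>Bounds for the functional calculus\<close>

text \<open>The value at \<open>x\<close> of the monic polynomial with root list \<open>as\<close>,
  multiplicities being repetitions. The factored form is kept because the estimates below proceed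
  root by root.\<close>

definition root_prod :: "complex list \<Rightarrow> complex mat \<Rightarrow> complex mat" where
  "root_prod as x = foldr (\<lambda>a M. (x - a \<cdot>\<^sub>m 1\<^sub>m (dim_row x)) * M) as (1\<^sub>m (dim_row x))"

lemma root_prod_Nil [simp]: "root_prod [] x = 1\<^sub>m (dim_row x)"
  by (simp add: root_prod_def)

lemma root_prod_Cons [simp]: "root_prod (a # as) x = (x - a \<cdot>\<^sub>m 1\<^sub>m (dim_row x)) * root_prod as x"
  by (simp add: root_prod_def)

lemma root_prod_carrier [simp, intro]: "x \<in> carrier_mat n n \<Longrightarrow> root_prod as x \<in> carrier_mat n n"
  by (induction as) (auto simp: minus_carrier_mat)

lemma root_prod_append:
  assumes x: "x \<in> carrier_mat n n"
  shows "root_prod (as @ bs) x = root_prod as x * root_prod bs x"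
proof (induction as)
  case Nil
  then show ?case using x left_mult_one_mat[OF root_prod_carrier[OF x, of bs]] by simp
next
  case (Cons a as)
  have "x - a \<cdot>\<^sub>m 1\<^sub>m n \<in> carrier_mat n n" by auto
  then show ?case using x root_prod_carrier[OF x] Cons by (simp add: assoc_mult_mat[of _ n n _ n _ n])
qed

lemma root_prod_dsum:
  assumes "x \<in> carrier_mat n n" "y \<in> carrier_mat m m"
  shows "root_prod as (mat_dsum x y) = mat_dsum (root_prod as x) (root_prod as y)"
proof (induction as)
  case Nil
  then show ?case by (simp add: mat_dsum_one)
next
  case (Cons a as)
  have "mat_dsum x y - a \<cdot>\<^sub>m 1\<^sub>m (n + m) = mat_dsum (x - a \<cdot>\<^sub>m 1\<^sub>m n) (y - a \<cdot>\<^sub>m 1\<^sub>m m)"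
    by (rule eq_matI) (use assms in \<open>auto simp: mat_dsum_index\<close>)
  then show ?case using Cons assms
    by (simp add: mat_dsum_mult[of _ n _ m] minus_carrier_mat)
qed

lemma root_prod_similar:
  assumes x: "x \<in> carrier_mat n n" and UV: "U \<in> carrier_mat n n" "V \<in> carrier_mat n n" "U * V = 1\<^sub>m n"
  shows "root_prod as (U * x * V) = U * root_prod as x * V"
proof (induction as)
  case Nil
  then show ?case using assms by simp
next
  case (Cons a as)
  have "U * (x - a \<cdot>\<^sub>m 1\<^sub>m n) * V = (U * x - a \<cdot>\<^sub>m U) * V"
    using x UV(1) mult_smult_distrib[OF UV(1), of "1\<^sub>m n" n a]
    by (subst mult_minus_distrib_mat[of _ n n _ n]) auto
  also have "\<dots> = U * x * V - a \<cdot>\<^sub>m (U * V)"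
    using x UV by (subst minus_mult_distrib_mat[of _ n n _ _ n]) (auto simp: mult_smult_assoc_mat)
  finally have *: "U * x * V - a \<cdot>\<^sub>m 1\<^sub>m n = U * (x - a \<cdot>\<^sub>m 1\<^sub>m n) * V" using UV by simp
  have "root_prod (a # as) (U * x * V) = (U * (x - a \<cdot>\<^sub>m 1\<^sub>m n) * V) * (U * root_prod as x * V)"
    using Cons * UV by (simp del: assoc_mult_mat)
  also have "\<dots> = U * ((x - a \<cdot>\<^sub>m 1\<^sub>m n) * root_prod as x) * V"
    by (rule similar_mult[symmetric]) (use x UV in auto)
  finally show ?case using x by simp
qed

lemma root_prod_jordan_block:
  "root_prod (replicate m a) (jordan_block n a) = mat n n (\<lambda>(i, j). if j = i + m then 1 else 0)"
proof (induction m)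
  case 0
  then show ?case by (auto intro!: eq_matI)
next
  case (Suc m)
  let ?N = "jordan_block n a - a \<cdot>\<^sub>m 1\<^sub>m n"
  have "root_prod (replicate (Suc m) a) (jordan_block n a) = ?N * mat n n (\<lambda>(i, j). if j = i + m then 1 else 0)"
    using Suc by simp
  also have "\<dots> = mat n n (\<lambda>(i, j). if j = i + Suc m then 1 else 0)"
  proof (rule eq_matI)
    fix i j assume "i < dim_row (mat n n (\<lambda>(i, j). if j = i + Suc m then 1 else 0 :: complex))"
      "j < dim_col (mat n n (\<lambda>(i, j). if j = i + Suc m then 1 else 0 :: complex))"
    then have ij: "i < n" "j < n" by auto
    have "(?N * mat n n (\<lambda>(i, j). if j = i + m then 1 else 0)) $$ (i, j)
        = (\<Sum>k<n. ?N $$ (i, k) * (if j = k + m then 1 else 0))"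
      using ij by (simp add: scalar_prod_def atLeast0LessThan)
    also have "\<dots> = (\<Sum>k<n. if k = Suc i then if j = Suc i + m then 1 else 0 else 0)"
      using ij by (intro sum.cong refl) auto
    also have "\<dots> = mat n n (\<lambda>(i, j). if j = i + Suc m then 1 else 0) $$ (i, j)"
      using ij by auto
    finally show "(?N * mat n n (\<lambda>(i, j). if j = i + m then 1 else 0)) $$ (i, j)
      = mat n n (\<lambda>(i, j). if j = i + Suc m then 1 else 0) $$ (i, j)" .
  qed auto
  finally show ?case .
qed

text \<open>A block of size \<open>k\<close> is annihilated by the \<open>k\<close>-th power of its
  shift, and the root lists of direct summands are concatenated. That all roots are eigenvalues is
  essential later: it makes the polynomial large at every point far from the spectrum.\<close>

lemma ex_annihilating_roots:
  assumes "x \<in> carrier_mat n n"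
  shows "\<exists>as. set as \<subseteq> spectrum x \<and> root_prod as x = 0\<^sub>m n n"
proof -
  have "\<exists>as. set as \<subseteq> spectrum x \<and> root_prod as x = 0\<^sub>m (dim_row x) (dim_row x)"
    using assms
  proof (induction rule: jordan_dsum_induct)
    case zero
    show ?case by (auto intro!: exI[of _ "[]"] mat_0_eq)
  next
    case (block k a)
    have "root_prod (replicate k a) (jordan_block k a) = 0\<^sub>m k k"
      unfolding root_prod_jordan_block by (rule eq_matI) auto
    then show ?case by (intro exI[of _ "replicate k a"]) (auto simp: spectrum_jordan_block)
  next
    case (dsum A B p q)
    then obtain as bs where as: "set as \<subseteq> spectrum A" "root_prod as A = 0\<^sub>m p p"
      and bs: "set bs \<subseteq> spectrum B" "root_prod bs B = 0\<^sub>m q q" by auto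
    have "root_prod (as @ bs) (mat_dsum A B) = 0\<^sub>m (p + q) (p + q)"
      using dsum(1,2) as(2) bs(2) left_mult_zero_mat[OF root_prod_carrier[of A p bs]]
        right_mult_zero_mat[OF root_prod_carrier[of B q as]]
      by (simp add: root_prod_dsum[OF dsum(1,2)] root_prod_append[OF dsum(1)] root_prod_append[OF dsum(2)] mat_dsum_zero)
    then show ?case using dsum as bs spectrum_dsum[OF dsum(1,2)] by (intro exI[of _ "as @ bs"]) auto
  next
    case (similar A p U V)
    then obtain as where as: "set as \<subseteq> spectrum A" "root_prod as A = 0\<^sub>m p p" by auto
    have "root_prod as (U * A * V) = 0\<^sub>m p p"
      unfolding root_prod_similar[OF similar(1-4)] as(2) using similar by simp
    then show ?case using as similar_resolvent(1)[OF similar(1-4)] similar(2)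
      by (intro exI[of _ as]) (auto simp del: assoc_mult_mat)
  qed
  then show ?thesis using assms by auto
qed

section \<open>Comparison of p(y) with p(z), and the contour estimate\<close>

definition root_poly :: "complex list \<Rightarrow> complex \<Rightarrow> complex" where
  "root_poly as z = (\<Prod>a\<leftarrow>as. z - a)"

lemma root_poly_simps [simp]: "root_poly [] z = 1" "root_poly (a # as) z = (z - a) * root_poly as z"
  by (auto simp: root_poly_def)

text \<open>\<open>p(z) - p(y)\<close> is divisible by \<open>z - y\<close>, with a quotient bounded independently of the size of \<open>y\<close>.\<close>

lemma root_prod_difference_bound:
  assumes "M \<ge> 0" "R \<ge> 0"
  shows "\<exists>K\<ge>0. \<forall>n y z v. y \<in> carrier_mat n n \<longrightarrow> op_norm y \<le> M \<longrightarrow> cmod z \<le> R \<longrightarrow> v \<in> carrier_vec n \<longrightarrow>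
     vec_norm2 (root_prod as y *\<^sub>v v - root_poly as z \<cdot>\<^sub>v v) \<le> K * vec_norm2 ((z \<cdot>\<^sub>m 1\<^sub>m n - y) *\<^sub>v v)"
proof (induction as)
  case Nil
  have "vec_norm2 (root_prod [] y *\<^sub>v v - root_poly [] z \<cdot>\<^sub>v v) = 0"
    if "y \<in> carrier_mat n n" "v \<in> carrier_vec n" for y n z v
  proof -
    have "root_prod [] y *\<^sub>v v - root_poly [] z \<cdot>\<^sub>v v = 0\<^sub>v n" using that by auto
    then show ?thesis by simp
  qed
  then show ?case by (intro exI[of _ 0]) auto
next
  case (Cons a as)
  then obtain K where K: "K \<ge> 0" "\<And>n y z v. y \<in> carrier_mat n n \<Longrightarrow> op_norm y \<le> M \<Longrightarrow> cmod z \<le> R \<Longrightarrow> v \<in> carrier_vec n \<Longrightarrow>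
     vec_norm2 (root_prod as y *\<^sub>v v - root_poly as z \<cdot>\<^sub>v v) \<le> K * vec_norm2 ((z \<cdot>\<^sub>m 1\<^sub>m n - y) *\<^sub>v v)" by blast
  define B where "B = (\<Prod>a\<leftarrow>as. R + cmod a)"
  have B0: "B \<ge> 0" unfolding B_def using assms by (induction as) auto
  have B: "cmod (root_poly as z) \<le> B" if "cmod z \<le> R" for z
    unfolding B_def
  proof (induction as)
    case (Cons b as)
    have "cmod (z - b) \<le> R + cmod b" using norm_triangle_ineq4[of z b] that by simp
    then show ?case using Cons assms by (auto simp: norm_mult intro!: mult_mono)
  qed simp
  show ?case
  proof (intro exI conjI allI impI)
    show "(M + cmod a) * K + B \<ge> 0" using K assms B0 by simp
    fix n y z and v :: "complex vec"
    assume y: "y \<in> carrier_mat n n" "op_norm y \<le> M" and z: "cmod z \<le> R" and v: "v \<in> carrier_vec n"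
    let ?Y = "y - a \<cdot>\<^sub>m 1\<^sub>m n" let ?w = "root_prod as y *\<^sub>v v - root_poly as z \<cdot>\<^sub>v v"
    let ?u = "(z \<cdot>\<^sub>m 1\<^sub>m n - y) *\<^sub>v v"
    have Y: "?Y \<in> carrier_mat n n" by auto
    have pv: "root_prod as y *\<^sub>v v \<in> carrier_vec n" using root_prod_carrier[OF y(1), of as] by (auto intro!: carrier_vecI)
    have w: "?w \<in> carrier_vec n" using v pv by (intro minus_carrier_vec smult_carrier_vec) auto
    have u: "?u \<in> carrier_vec n" using y by (auto intro!: carrier_vecI)
    have Yv: "?Y *\<^sub>v u' = y *\<^sub>v u' - a \<cdot>\<^sub>v u'" if "u' \<in> carrier_vec n" for u'
      using that y by (subst minus_mult_distrib_mat_vec[of _ n n]) auto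
    have uv: "?u = z \<cdot>\<^sub>v v - y *\<^sub>v v"
      using v y by (subst minus_mult_distrib_mat_vec[of _ n n]) auto
    \<comment> \<open>For \<open>p(z) = (z - a) q(z)\<close> this is the identity
      \<open>p(y) v - p(z) v = (y - a) (q(y) v - q(z) v) - q(z) (z - y) v\<close>. The induction
      hypothesis bounds the first term and \<open>B\<close> the factor \<open>q(z)\<close>, whence
      the constant \<open>(M + cmod a) * K + B\<close>.\<close>
    have "root_prod (a # as) y *\<^sub>v v - root_poly (a # as) z \<cdot>\<^sub>v v = ?Y *\<^sub>v ?w - root_poly as z \<cdot>\<^sub>v ?u"
    proof -
      have "?Y *\<^sub>v ?w = ?Y *\<^sub>v (root_prod as y *\<^sub>v v) - root_poly as z \<cdot>\<^sub>v (?Y *\<^sub>v v)"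
        using v pv Y by (subst mult_minus_distrib_mat_vec[of _ n n]) (auto simp: mult_mat_vec[OF Y])
      moreover have "root_prod (a # as) y *\<^sub>v v = ?Y *\<^sub>v (root_prod as y *\<^sub>v v)"
        using y v assoc_mult_mat_vec[OF Y root_prod_carrier[OF y(1), of as] v] by simp
      ultimately show ?thesis
        using v pv y by (auto simp: Yv uv algebra_simps intro!: eq_vecI)
    qed
    also have "vec_norm2 \<dots> \<le> vec_norm2 (?Y *\<^sub>v ?w) + vec_norm2 (root_poly as z \<cdot>\<^sub>v ?u)"
      by (rule vec_norm2_triangle_minus[of _ n]) (use Y u in \<open>auto intro!: carrier_vecI\<close>)
    also have "vec_norm2 (?Y *\<^sub>v ?w) \<le> (M + cmod a) * vec_norm2 ?w"
    proof -
      have "vec_norm2 (?Y *\<^sub>v ?w) \<le> vec_norm2 (y *\<^sub>v ?w) + vec_norm2 (a \<cdot>\<^sub>v ?w)"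
        unfolding Yv[OF w] by (rule vec_norm2_triangle_minus[of _ n]) (use w y in \<open>auto intro!: carrier_vecI\<close>)
      also have "vec_norm2 (y *\<^sub>v ?w) \<le> M * vec_norm2 ?w"
        using op_norm_mult_vec[of ?w y] w y mult_right_mono[OF y(2), of "vec_norm2 ?w"] by auto
      finally show ?thesis by (simp add: vec_norm2_smult algebra_simps)
    qed
    also have "(M + cmod a) * vec_norm2 ?w \<le> (M + cmod a) * (K * vec_norm2 ?u)"
      by (intro mult_left_mono K y z v) (use assms in auto)
    also have "vec_norm2 (root_poly as z \<cdot>\<^sub>v ?u) \<le> B * vec_norm2 ?u"
      unfolding vec_norm2_smult by (intro mult_right_mono B z) auto
    finally show "vec_norm2 (root_prod (a # as) y *\<^sub>v v - root_poly (a # as) z \<cdot>\<^sub>v v)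
       \<le> ((M + cmod a) * K + B) * vec_norm2 ?u" by (simp add: algebra_simps)
  qed
qed

text \<open>The difference bound with right-hand side zero, since \<open>z - y\<close> annihilates
  the eigenvector.\<close>

lemma root_prod_eigenvector:
  assumes y: "y \<in> carrier_mat n n" and v: "v \<in> carrier_vec n" "y *\<^sub>v v = z \<cdot>\<^sub>v v"
  shows "root_prod as y *\<^sub>v v = root_poly as z \<cdot>\<^sub>v v"
proof -
  have "\<exists>K\<ge>0. vec_norm2 (root_prod as y *\<^sub>v v - root_poly as z \<cdot>\<^sub>v v) \<le> K * vec_norm2 ((z \<cdot>\<^sub>m 1\<^sub>m n - y) *\<^sub>v v)"
    using root_prod_difference_bound[of "op_norm y" "cmod z" as] y v(1) by (meson norm_ge_zero op_norm_nonneg order_refl)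
  moreover have "(z \<cdot>\<^sub>m 1\<^sub>m n - y) *\<^sub>v v = 0\<^sub>v n"
    using v y by (subst minus_mult_distrib_mat_vec[of _ n n]) auto
  ultimately have "vec_norm2 (root_prod as y *\<^sub>v v - root_poly as z \<cdot>\<^sub>v v) = 0" by (simp add: antisym)
  from vec_norm2_eq_0[OF this] have 0: "root_prod as y *\<^sub>v v - root_poly as z \<cdot>\<^sub>v v = 0\<^sub>v n" using v by simp
  have "dim_row (root_prod as y) = n" using root_prod_carrier[OF y] by blast
  moreover have "(root_prod as y *\<^sub>v v) $ i = (root_poly as z \<cdot>\<^sub>v v) $ i" if "i < n" for i
    using arg_cong[OF 0, of "\<lambda>u. u $ i"] that v(1) by (simp del: index_mult_mat_vec)
  ultimately show ?thesis using v(1) by (intro eq_vecI) (auto simp del: index_mult_mat_vec)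
qed

text \<open>The norm of \<open>f x\<close> is read off the scalar functions \<open>z \<mapsto> f z * (w \<bullet> (resolvent x z *\<^sub>v v))\<close>
  by the scalar residue theorem on each circle, with \<open>w\<close> the conjugate of \<open>f x *\<^sub>v v\<close>.\<close>

lemma hol_calc_op_norm_bound:
  assumes x: "x \<in> carrier_mat n n" and C: "finite C" and \<rho>: "0 < \<rho>" "\<rho> < r"
    and disj: "\<And>c c'. c \<in> C \<Longrightarrow> c' \<in> C \<Longrightarrow> c \<noteq> c' \<Longrightarrow> ball c r \<inter> ball c' r = {}"
    and f: "f holomorphic_on (\<Union>c\<in>C. ball c r)"
    and sp: "spectrum x \<subseteq> (\<Union>c\<in>C. ball c \<rho>)"
    and F: "\<And>c z. c \<in> C \<Longrightarrow> cmod (z - c) = \<rho> \<Longrightarrow> cmod (f z) \<le> F" and F0: "F \<ge> 0"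
    and L: "\<And>c z v. c \<in> C \<Longrightarrow> cmod (z - c) = \<rho> \<Longrightarrow> v \<in> carrier_vec n \<Longrightarrow>
       vec_norm2 v \<le> L * vec_norm2 ((z \<cdot>\<^sub>m 1\<^sub>m n - x) *\<^sub>v v)" and L0: "L \<ge> 0"
  shows "op_norm (hol_calc f x) \<le> real (card C) * (\<rho> * F * L)"
proof (rule op_norm_leI)
  fix v :: "complex vec" assume "v \<in> carrier_vec (dim_col (hol_calc f x))"
  then have v: "v \<in> carrier_vec n" using x by simp
  let ?u = "hol_calc f x *\<^sub>v v"
  have u: "?u \<in> carrier_vec n" using x by (auto intro!: carrier_vecI)
  define w where "w = vec n (\<lambda>k. cnj (?u $ k))"
  have w: "w \<in> carrier_vec n" by (simp add: w_def)
  have wn: "vec_norm2 w = vec_norm2 ?u" using x by (simp add: w_def vec_norm2_def)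
  define g where "g = (\<lambda>z. \<Sum>k<n. \<Sum>l<n. (w $ k * v $ l) * resolvent x z $$ (k, l))"
  define G where "G = (\<lambda>z. f z * g z)"
  have fan: "f analytic_on spectrum x"
  proof -
    have "f analytic_on (\<Union>c\<in>C. ball c r)" using f by (subst analytic_on_open) auto
    then show ?thesis using sp \<rho> by (elim analytic_on_subset) (force simp: subset_iff)
  qed
  have g_eq: "g z = (\<Sum>k<n. w $ k * (resolvent x z *\<^sub>v v) $ k)" if "z \<notin> spectrum x" for z
    using resolvent_carrier_inverse(1)[OF x that] v
    by (auto simp: g_def mult_mat_vec_index_sum sum_distrib_left mult_ac simp del: index_mult_mat_vec intro!: sum.cong)
  have "complex_of_real ((vec_norm2 ?u)\<^sup>2) = (\<Sum>k<n. w $ k * ?u $ k)"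
    using x by (simp add: vec_norm2_def w_def sum_nonneg complex_norm_square[symmetric] mult.commute[of "cnj _"] del: index_mult_mat_vec)
  also have "\<dots> = (\<Sum>k<n. \<Sum>l<n. (w $ k * v $ l) * hol_calc f x $$ (k, l))"
    using x v by (auto simp: mult_mat_vec_index_sum sum_distrib_left mult_ac simp del: index_mult_mat_vec intro!: sum.cong)
  also have "\<dots> = (\<Sum>a\<in>spectrum x. residue G a)"
    unfolding G_def g_def by (rule hol_calc_combination[OF x fan])
  also have "\<dots> = (\<Sum>a\<in>(\<Union>c\<in>C. spectrum x \<inter> ball c \<rho>). residue G a)"
    using sp by (intro sum.cong) auto
  also have "\<dots> = (\<Sum>c\<in>C. \<Sum>a\<in>spectrum x \<inter> ball c \<rho>. residue G a)"
  proof (rule sum.UNION_disjoint[OF C])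
    show "\<forall>c\<in>C. \<forall>c'\<in>C. c \<noteq> c' \<longrightarrow> (spectrum x \<inter> ball c \<rho>) \<inter> (spectrum x \<inter> ball c' \<rho>) = {}"
    proof (intro ballI impI)
      fix c c' assume "c \<in> C" "c' \<in> C" "c \<noteq> c'"
      moreover have "ball c \<rho> \<subseteq> ball c r" "ball c' \<rho> \<subseteq> ball c' r" using \<rho> by auto
      ultimately show "(spectrum x \<inter> ball c \<rho>) \<inter> (spectrum x \<inter> ball c' \<rho>) = {}"
        using disj[of c c'] by blast
    qed
  qed (use spectrum_finite[OF x] in auto)
  finally have total: "complex_of_real ((vec_norm2 ?u)\<^sup>2) = (\<Sum>c\<in>C. \<Sum>a\<in>spectrum x \<inter> ball c \<rho>. residue G a)" .
  have disc: "cmod (\<Sum>a\<in>spectrum x \<inter> ball c \<rho>. residue G a) \<le> \<rho> * F * L * (vec_norm2 ?u * vec_norm2 v)"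
    if c: "c \<in> C" for c
  proof -
    \<comment> \<open>The larger discs are disjoint, so an eigenvalue inside \<open>ball c r\<close>
      can only be covered by the smaller disc about the same centre. Hence the circle of radius
      \<open>\<rho>\<close> misses the spectrum and encloses all eigenvalues in
      \<open>ball c r\<close>.\<close>
    have pts: "spectrum x \<inter> ball c r = spectrum x \<inter> ball c \<rho>"
    proof
      show "spectrum x \<inter> ball c r \<subseteq> spectrum x \<inter> ball c \<rho>"
      proof
        fix a assume a: "a \<in> spectrum x \<inter> ball c r"
        then obtain c' where c': "c' \<in> C" "a \<in> ball c' \<rho>" using sp by auto
          then have "a \<in> ball c' r" using \<rho> by auto
          then have "c' = c" using disj[OF c c'(1)] a by blast
        then show "a \<in> spectrum x \<inter> ball c \<rho>" using a c' by auto
      qed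
    qed (use \<rho> in auto)
    have off: "z \<notin> spectrum x" if "cmod (z - c) = \<rho>" for z
      using that pts \<rho> by (auto simp: set_eq_iff dist_norm norm_minus_commute)
    have holo: "G holomorphic_on ball c r - (spectrum x \<inter> ball c \<rho>)"
      unfolding G_def g_def
      by (intro holomorphic_intros holomorphic_on_subset[OF f] holomorphic_on_subset[OF resolvent_holomorphic_on[OF x]])
         (use c pts in auto)
    have path: "path_image (circlepath c \<rho>) = {z. cmod (z - c) = \<rho>}"
      using \<rho> by (auto simp: sphere_def dist_norm norm_minus_commute)
    have sub: "path_image (circlepath c \<rho>) \<subseteq> ball c r - (spectrum x \<inter> ball c \<rho>)"
      unfolding path using \<rho> by (auto simp: dist_norm norm_minus_commute)
    have "contour_integral (circlepath c \<rho>) G = 2 * pi * \<i> *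
        (\<Sum>a\<in>spectrum x \<inter> ball c \<rho>. winding_number (circlepath c \<rho>) a * residue G a)"
    proof (rule Residue_theorem[of "ball c r"])
      show "\<forall>z. z \<notin> ball c r \<longrightarrow> winding_number (circlepath c \<rho>) z = 0"
        using \<rho> by (intro allI impI winding_number_zero_outside[of _ "cball c \<rho>"])
           (auto simp: dist_norm norm_minus_commute)
    qed (use holo sub spectrum_finite[OF x] in auto)
    also have "\<dots> = 2 * pi * \<i> * (\<Sum>a\<in>spectrum x \<inter> ball c \<rho>. residue G a)"
      by (intro arg_cong2[of _ _ _ _ "(*)"] refl sum.cong, subst winding_number_circlepath)
         (auto simp: dist_norm norm_minus_commute)
    finally have int: "contour_integral (circlepath c \<rho>) G = 2 * pi * \<i> * (\<Sum>a\<in>spectrum x \<inter> ball c \<rho>. residue G a)" .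
    have "(G has_contour_integral contour_integral (circlepath c \<rho>) G) (circlepath c \<rho>)"
    proof (rule has_contour_integral_integral, rule contour_integrable_continuous_circlepath)
      show "continuous_on (path_image (circlepath c \<rho>)) G"
        by (rule holomorphic_on_imp_continuous_on, rule holomorphic_on_subset[OF holo sub])
    qed
    then have "cmod (contour_integral (circlepath c \<rho>) G) \<le> (F * (vec_norm2 ?u * (L * vec_norm2 v))) * (2 * pi * \<rho>)"
    proof (rule has_contour_integral_bound_circlepath)
      fix z assume z: "cmod (z - c) = \<rho>"
      note R = resolvent_carrier_inverse[OF x off[OF z]]
      have Rv: "resolvent x z *\<^sub>v v \<in> carrier_vec n" using R by (auto intro!: carrier_vecI)
      have "cmod (g z) \<le> vec_norm2 w * vec_norm2 (resolvent x z *\<^sub>v v)"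
        unfolding g_eq[OF off[OF z]] by (rule cauchy_schwarz_vec[OF w Rv])
      also have "\<dots> \<le> vec_norm2 ?u * (L * vec_norm2 v)"
      proof -
        \<comment> \<open>The lower bound \<open>L\<close> for \<open>z - x\<close> becomes a bound
          for the resolvent when it is applied to the vector
          \<open>resolvent x z *\<^sub>v v\<close>, which \<open>z - x\<close> maps to
          \<open>v\<close>.\<close>
        have "(z \<cdot>\<^sub>m 1\<^sub>m n - x) *\<^sub>v (resolvent x z *\<^sub>v v) = ((z \<cdot>\<^sub>m 1\<^sub>m n - x) * resolvent x z) *\<^sub>v v"
          using R(1) x v by (subst assoc_mult_mat_vec[of _ n n _ n]) (auto simp: minus_carrier_mat)
        also have "\<dots> = v" using R(2) v by simp
        finally show ?thesis using L[OF c z Rv] wn by (auto intro!: mult_left_mono)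
      qed
      finally show "cmod (G z) \<le> F * (vec_norm2 ?u * (L * vec_norm2 v))"
        unfolding G_def norm_mult using F[OF c z] F0 by (intro mult_mono) auto
    qed (use F0 L0 \<rho> in auto)
    then have "2 * pi * cmod (\<Sum>a\<in>spectrum x \<inter> ball c \<rho>. residue G a) \<le> 2 * pi * (\<rho> * F * L * (vec_norm2 ?u * vec_norm2 v))"
      unfolding int by (simp add: norm_mult mult_ac)
    then show ?thesis by simp
  qed
  have "(vec_norm2 ?u)\<^sup>2 = cmod (complex_of_real ((vec_norm2 ?u)\<^sup>2))" by (simp del: of_real_power)
  also have "\<dots> \<le> (\<Sum>c\<in>C. \<rho> * F * L * (vec_norm2 ?u * vec_norm2 v))"
    unfolding total by (intro sum_norm_le disc)
  \<comment> \<open>The estimate is quadratic in \<open>vec_norm2 ?u\<close> because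
    \<open>w\<close> was built from \<open>?u\<close>; one factor cancels.\<close>
  finally have "vec_norm2 ?u * vec_norm2 ?u \<le> vec_norm2 ?u * (real (card C) * (\<rho> * F * L) * vec_norm2 v)"
    by (simp add: power2_eq_square mult_ac)
  then show "vec_norm2 ?u \<le> real (card C) * (\<rho> * F * L) * vec_norm2 v"
    using F0 L0 \<rho> vec_norm2_nonneg[of ?u] by (cases "vec_norm2 ?u = 0") (auto simp: mult_le_cancel_left)
qed (use F0 L0 \<rho> in auto)

section \<open>The free topology\<close>

text \<open>The neighbourhood filter of \<open>x\<close> within level \<open>n\<close> for entrywise
  convergence. Openness on a level becomes an \<open>eventually\<close> statement, and limit rules
  take over from explicit radii.\<close>

definition lev_nhd :: "nat \<Rightarrow> nat \<Rightarrow> nc_point \<Rightarrow> nc_point filter" where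
  "lev_nhd d n x = (INF e\<in>{0<..}. principal {y \<in> M_level d n.
     \<forall>k<d. \<forall>i<n. \<forall>j<n. cmod (y ! k $$ (i, j) - x ! k $$ (i, j)) < e})"

lemma eventually_lev_nhd:
  "eventually P (lev_nhd d n x) \<longleftrightarrow> (\<exists>e>0. \<forall>y\<in>M_level d n.
     (\<forall>k<d. \<forall>i<n. \<forall>j<n. cmod (y ! k $$ (i, j) - x ! k $$ (i, j)) < e) \<longrightarrow> P y)"
  unfolding lev_nhd_def
proof (subst eventually_INF_base)
  fix a b :: real assume "a \<in> {0<..}" "b \<in> {0<..}"
  then show "\<exists>c\<in>{0<..}. principal {y \<in> M_level d n. \<forall>k<d. \<forall>i<n. \<forall>j<n. cmod (y ! k $$ (i, j) - x ! k $$ (i, j)) < c}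
     \<le> inf (principal {y \<in> M_level d n. \<forall>k<d. \<forall>i<n. \<forall>j<n. cmod (y ! k $$ (i, j) - x ! k $$ (i, j)) < a})
        (principal {y \<in> M_level d n. \<forall>k<d. \<forall>i<n. \<forall>j<n. cmod (y ! k $$ (i, j) - x ! k $$ (i, j)) < b})"
    by (intro bexI[of _ "min a b"]) auto
next
  show "(\<exists>b\<in>{0<..}. eventually P (principal {y \<in> M_level d n.
      \<forall>k<d. \<forall>i<n. \<forall>j<n. cmod (y ! k $$ (i, j) - x ! k $$ (i, j)) < b})) \<longleftrightarrow> (\<exists>e>0. \<forall>y\<in>M_level d n.
      (\<forall>k<d. \<forall>i<n. \<forall>j<n. cmod (y ! k $$ (i, j) - x ! k $$ (i, j)) < e) \<longrightarrow> P y)"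
    unfolding eventually_principal Bex_def greaterThan_iff by (rule ex_cong1) blast
qed auto

lemma level_open_iff:
  "level_open d n U \<longleftrightarrow> (\<forall>x\<in>U \<inter> M_level d n. \<forall>\<^sub>F y in lev_nhd d n x. y \<in> U)"
  unfolding level_open_def eventually_lev_nhd by simp

lemma eventually_lev_nhd_level: "\<forall>\<^sub>F y in lev_nhd d n x. y \<in> M_level d n"
  unfolding eventually_lev_nhd by (auto intro: exI[of _ 1])

lemma tendsto_lev_nhd_entry:
  assumes "k < d" "i < n" "j < n"
  shows "((\<lambda>y. y ! k $$ (i, j)) \<longlongrightarrow> x ! k $$ (i, j)) (lev_nhd d n x)"
  unfolding tendsto_iff dist_norm eventually_lev_nhd using assms by blast

section \<open>Evaluation of free polynomials at direct sums\<close>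

lemma word_eval_Nil: "word_eval x [] = 1\<^sub>m (pt_size x)"
  by (simp add: word_eval_def)

lemma word_eval_Cons: "word_eval x (k # w) = x ! k * word_eval x w"
  by (simp add: word_eval_def)

lemma word_eval_carrier:
  assumes "x \<in> M_level d n" "d \<ge> 1" "w \<in> lists {..<d}"
  shows "word_eval x w \<in> carrier_mat n n"
  using assms(3)
proof (induction w)
  case Nil
  then show ?case using assms by (simp add: word_eval_Nil pt_size_M_level)
next
  case (Cons k w)
  then show ?case using M_level_nth[OF assms(1), of k] by (auto simp: word_eval_Cons)
qed

lemma poly_eval_carrier: "x \<in> M_level d n \<Longrightarrow> d \<ge> 1 \<Longrightarrow> poly_eval p x \<in> carrier_mat n n"
  by (simp add: poly_eval_def pt_size_M_level)

lemma poly_eval_index: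
  "x \<in> M_level d n \<Longrightarrow> d \<ge> 1 \<Longrightarrow> i < n \<Longrightarrow> j < n \<Longrightarrow>
   poly_eval p x $$ (i, j) = (\<Sum>w\<in>Poly_Mapping.keys p. Poly_Mapping.lookup p w * (word_eval x w $$ (i, j)))"
  by (simp add: poly_eval_def pt_size_M_level)

lemma word_eval_dsum:
  assumes x: "x \<in> M_level d n" and y: "y \<in> M_level d m" and "d \<ge> 1" "w \<in> lists {..<d}"
  shows "word_eval (pt_dsum x y) w = mat_dsum (word_eval x w) (word_eval y w)"
  using assms(4)
proof (induction w)
  case Nil
  then show ?case using assms(3) pt_dsum_level[OF x y] x y
    by (simp add: word_eval_Nil pt_size_M_level mat_dsum_one)
next
  case (Cons k w)
  then have k: "k < d" "w \<in> lists {..<d}" by auto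
  show ?case using Cons
    by (simp add: word_eval_Cons pt_dsum_nth[OF x y k(1)] mat_dsum_mult[OF M_level_nth[OF x k(1)] M_level_nth[OF y k(1)]
      word_eval_carrier[OF x assms(3) k(2)] word_eval_carrier[OF y assms(3) k(2)]])
qed

lemma poly_eval_dsum:
  assumes x: "x \<in> M_level d n" and y: "y \<in> M_level d m" and d: "d \<ge> 1" and p: "p \<in> free_polys d"
  shows "poly_eval p (pt_dsum x y) = mat_dsum (poly_eval p x) (poly_eval p y)"
proof (rule eq_matI)
  have car: "poly_eval p x \<in> carrier_mat n n" "poly_eval p y \<in> carrier_mat m m"
    using poly_eval_carrier x y d by auto
  fix i j assume "i < dim_row (mat_dsum (poly_eval p x) (poly_eval p y))" "j < dim_col (mat_dsum (poly_eval p x) (poly_eval p y))"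
  then have ij: "i < n + m" "j < n + m" using car by auto
  have keys: "w \<in> lists {..<d}" if "w \<in> Poly_Mapping.keys p" for w
    using that p by (auto simp: free_polys_def)
  have "poly_eval p (pt_dsum x y) $$ (i, j) = (\<Sum>w\<in>Poly_Mapping.keys p. Poly_Mapping.lookup p w *
      (mat_dsum (word_eval x w) (word_eval y w) $$ (i, j)))"
    using poly_eval_index[OF pt_dsum_level[OF x y] d ij]
    by (auto simp: word_eval_dsum[OF x y d keys] intro!: sum.cong)
  also have "\<dots> = (\<Sum>w\<in>Poly_Mapping.keys p. if i < n then if j < n then Poly_Mapping.lookup p w * word_eval x w $$ (i, j) else 0
      else if j < n then 0 else Poly_Mapping.lookup p w * word_eval y w $$ (i - n, j - n))"
  proof (intro sum.cong refl)
    fix w assume w: "w \<in> Poly_Mapping.keys p"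
    show "Poly_Mapping.lookup p w * (mat_dsum (word_eval x w) (word_eval y w) $$ (i, j)) =
      (if i < n then if j < n then Poly_Mapping.lookup p w * word_eval x w $$ (i, j) else 0
      else if j < n then 0 else Poly_Mapping.lookup p w * word_eval y w $$ (i - n, j - n))"
      using ij carrier_matD[OF word_eval_carrier[OF x d keys[OF w]]] carrier_matD[OF word_eval_carrier[OF y d keys[OF w]]]
      by (auto simp: mat_dsum_index)
  qed
  also have "\<dots> = mat_dsum (poly_eval p x) (poly_eval p y) $$ (i, j)"
    using ij car by (auto simp: mat_dsum_index poly_eval_index[OF x d] poly_eval_index[OF y d])
  finally show "poly_eval p (pt_dsum x y) $$ (i, j) = mat_dsum (poly_eval p x) (poly_eval p y) $$ (i, j)" .
qed (use carrier_matD[OF poly_eval_carrier[OF x d]] carrier_matD[OF poly_eval_carrier[OF y d]]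
  carrier_matD[OF poly_eval_carrier[OF pt_dsum_level[OF x y] d]] in auto)

text \<open>In \<open>poly_mat_eval \<delta> (pt_dsum x y)\<close>, with \<open>x\<close>, \<open>y\<close> of sizes \<open>n\<close>, \<open>m\<close>, the index ranges are
  cut into consecutive intervals of length \<open>n + m\<close>, each of them split into a part for \<open>x\<close> and a part
  for \<open>y\<close>; \<open>left_ix\<close> and \<open>right_ix\<close> embed the indices of the two evaluations.\<close>

definition left_ix :: "nat \<Rightarrow> nat \<Rightarrow> nat \<Rightarrow> nat" where
  "left_ix n m j = j div n * (n + m) + j mod n"

definition right_ix :: "nat \<Rightarrow> nat \<Rightarrow> nat \<Rightarrow> nat" where
  "right_ix n m j = j div m * (n + m) + (n + j mod m)"

lemma block_ix_less: "b < q \<Longrightarrow> j < (k :: nat) \<Longrightarrow> b * k + j < q * k"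
  by (metis add.commute add_mult_distrib2 le_less_trans less_eq_Suc_le mult_Suc mult_le_mono1 nat_add_left_cancel_less not_less)

lemma left_ix:
  assumes "n > 0" "j < q * n"
  shows "left_ix n m j < q * (n + m)" "left_ix n m j div (n + m) = j div n" "left_ix n m j mod (n + m) = j mod n"
proof -
  have 1: "j mod n < n + m" using assms(1) by (simp add: trans_less_add1)
  have 2: "j div n < q" using assms by (simp add: less_mult_imp_div_less)
  show "left_ix n m j < q * (n + m)" unfolding left_ix_def by (rule block_ix_less[OF 2 1])
  show "left_ix n m j div (n + m) = j div n" "left_ix n m j mod (n + m) = j mod n"
    unfolding left_ix_def using 1 assms(1) by (simp_all add: div_mult_self3)
qed

lemma right_ix:
  assumes "m > 0" "j < q * m"
  shows "right_ix n m j < q * (n + m)" "right_ix n m j div (n + m) = j div m" "right_ix n m j mod (n + m) = n + j mod m"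
proof -
  have 1: "n + j mod m < n + m" using assms(1) by simp
  have 2: "j div m < q" using assms by (simp add: less_mult_imp_div_less)
  show "right_ix n m j < q * (n + m)" unfolding right_ix_def by (rule block_ix_less[OF 2 1])
  show "right_ix n m j div (n + m) = j div m" "right_ix n m j mod (n + m) = n + j mod m"
    unfolding right_ix_def using 1 by auto
qed

lemma sum_blocks: "(\<Sum>j<q * k. h j) = (\<Sum>b<q. \<Sum>j<k. h (b * k + j))" for h :: "nat \<Rightarrow> 'a :: comm_monoid_add"
proof -
  have "(\<Sum>j<q * k. h j) = (\<Sum>b<q. sum h {b * k..<b * k + k})" by (rule sum.nat_group[symmetric])
  also have "\<dots> = (\<Sum>b<q. \<Sum>j<k. h (b * k + j))"
    using sum.shift_bounds_nat_ivl[of h 0 "b * k" k for b] by (auto simp: atLeast0LessThan add.commute intro!: sum.cong)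
  finally show ?thesis .
qed

lemma sum_left_right:
  fixes h :: "nat \<Rightarrow> 'a :: comm_monoid_add"
  assumes "n > 0" "m > 0"
  shows "(\<Sum>j<q * (n + m). h j) = (\<Sum>j<q * n. h (left_ix n m j)) + (\<Sum>j<q * m. h (right_ix n m j))"
proof -
  have "(\<Sum>j<n + m. g j) = (\<Sum>j<n. g j) + (\<Sum>j<m. g (n + j))" for g :: "nat \<Rightarrow> 'a"
    using sum.nat_group[of g n 1] sum.atLeastLessThan_concat[of 0 n "n + m" g] sum.shift_bounds_nat_ivl[of g 0 n m]
    by (simp add: atLeast0LessThan add.commute)
  then have "(\<Sum>j<q * (n + m). h j) = (\<Sum>b<q. (\<Sum>j<n. h (b * (n + m) + j)) + (\<Sum>j<m. h (b * (n + m) + (n + j))))"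
    unfolding sum_blocks by simp
  also have "\<dots> = (\<Sum>b<q. \<Sum>j<n. h (left_ix n m (b * n + j))) + (\<Sum>b<q. \<Sum>j<m. h (right_ix n m (b * m + j)))"
    unfolding sum.distrib left_ix_def right_ix_def using assms by auto
  finally show ?thesis by (simp add: sum_blocks)
qed

text \<open>Up to the order of the indices \<open>E\<close> is the block sum of \<open>A\<close> and
  \<open>B\<close>. Squared norms add over the two parts of a vector, which gives the upper bound;
  vectors supported on one part give the lower one.\<close>

lemma op_norm_block_sum:
  assumes nm: "n > 0" "m > 0"
    and A: "A \<in> carrier_mat (p * n) (q * n)" and B: "B \<in> carrier_mat (p * m) (q * m)"
    and E: "E \<in> carrier_mat (p * (n + m)) (q * (n + m))"
    and EA: "\<And>i j. i < p * n \<Longrightarrow> j < q * n \<Longrightarrow> E $$ (left_ix n m i, left_ix n m j) = A $$ (i, j)"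
    and EB: "\<And>i j. i < p * m \<Longrightarrow> j < q * m \<Longrightarrow> E $$ (right_ix n m i, right_ix n m j) = B $$ (i, j)"
    and E0: "\<And>i j. i < p * n \<Longrightarrow> j < q * m \<Longrightarrow> E $$ (left_ix n m i, right_ix n m j) = 0"
      "\<And>i j. i < p * m \<Longrightarrow> j < q * n \<Longrightarrow> E $$ (right_ix n m i, left_ix n m j) = 0"
  shows "op_norm E = max (op_norm A) (op_norm B)"
proof -
  define vl where "vl = (\<lambda>q v. vec (q * n) (\<lambda>j. (v :: complex vec) $ left_ix n m j))"
  define vr where "vr = (\<lambda>q v. vec (q * m) (\<lambda>j. (v :: complex vec) $ right_ix n m j))"
  have norm: "(vec_norm2 v)\<^sup>2 = (vec_norm2 (vl q v))\<^sup>2 + (vec_norm2 (vr q v))\<^sup>2"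
    if "v \<in> carrier_vec (q * (n + m))" for v q
    using that by (simp add: vec_norm2_def sum_nonneg sum_left_right[OF nm] vl_def vr_def)
  have El: "vl p (E *\<^sub>v v) = A *\<^sub>v vl q v" and Er: "vr p (E *\<^sub>v v) = B *\<^sub>v vr q v"
    if v: "v \<in> carrier_vec (q * (n + m))" for v
  proof -
    show "vl p (E *\<^sub>v v) = A *\<^sub>v vl q v"
    proof (rule eq_vecI)
      fix i assume "i < dim_vec (A *\<^sub>v vl q v)"
      then have i: "i < p * n" using A by simp
      have "(E *\<^sub>v v) $ left_ix n m i = (\<Sum>j<q * (n + m). E $$ (left_ix n m i, j) * v $ j)"
        using E v left_ix[OF nm(1) i] by (subst mult_mat_vec_index_sum) auto
      also have "\<dots> = (\<Sum>j<q * n. A $$ (i, j) * v $ left_ix n m j)"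
        unfolding sum_left_right[OF nm] using EA[OF i] E0(1)[OF i] by simp
      also have "\<dots> = (A *\<^sub>v vl q v) $ i"
        using A i by (subst mult_mat_vec_index_sum) (auto simp: vl_def)
      finally show "vl p (E *\<^sub>v v) $ i = (A *\<^sub>v vl q v) $ i" using i by (simp add: vl_def)
    qed (use A in \<open>simp add: vl_def\<close>)
    show "vr p (E *\<^sub>v v) = B *\<^sub>v vr q v"
    proof (rule eq_vecI)
      fix i assume "i < dim_vec (B *\<^sub>v vr q v)"
      then have i: "i < p * m" using B by simp
      have "(E *\<^sub>v v) $ right_ix n m i = (\<Sum>j<q * (n + m). E $$ (right_ix n m i, j) * v $ j)"
        using E v right_ix[OF nm(2) i] by (subst mult_mat_vec_index_sum) auto
      also have "\<dots> = (\<Sum>j<q * m. B $$ (i, j) * v $ right_ix n m j)"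
        unfolding sum_left_right[OF nm] using EB[OF i] E0(2)[OF i] by simp
      also have "\<dots> = (B *\<^sub>v vr q v) $ i"
        using B i by (subst mult_mat_vec_index_sum) (auto simp: vr_def)
      finally show "vr p (E *\<^sub>v v) $ i = (B *\<^sub>v vr q v) $ i" using i by (simp add: vr_def)
    qed (use B in \<open>simp add: vr_def\<close>)
  qed
  have Ev: "E *\<^sub>v v \<in> carrier_vec (p * (n + m))" for v using E by (auto intro!: carrier_vecI)
  \<comment> \<open>The inverse of the splitting \<open>vl\<close>, \<open>vr\<close>. Joining a
    vector with zero realizes \<open>A\<close> or \<open>B\<close> as a restriction of
    \<open>E\<close>.\<close>
  define join where "join = (\<lambda>(v :: complex vec) (w :: complex vec). vec (q * (n + m)) (\<lambda>j. if j mod (n + m) < n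
    then v $ (j div (n + m) * n + j mod (n + m)) else w $ (j div (n + m) * m + (j mod (n + m) - n))))"
  have join: "join v w \<in> carrier_vec (q * (n + m)) \<and> vl q (join v w) = v \<and> vr q (join v w) = w"
    if "v \<in> carrier_vec (q * n)" "w \<in> carrier_vec (q * m)" for v w
    using that nm by (auto simp: join_def vl_def vr_def left_ix right_ix intro!: eq_vecI)
  have le: "op_norm E \<le> max (op_norm A) (op_norm B)"
  proof (rule op_norm_leI)
    fix v :: "complex vec" assume "v \<in> carrier_vec (dim_col E)"
    then have v: "v \<in> carrier_vec (q * (n + m))" using E by simp
    let ?M = "max (op_norm A) (op_norm B)"
    have "vec_norm2 (A *\<^sub>v vl q v) \<le> ?M * vec_norm2 (vl q v)"
      using op_norm_mult_vec[of "vl q v" A] A mult_right_mono[of "op_norm A" ?M "vec_norm2 (vl q v)"] by (simp add: vl_def)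
    moreover have "vec_norm2 (B *\<^sub>v vr q v) \<le> ?M * vec_norm2 (vr q v)"
      using op_norm_mult_vec[of "vr q v" B] B mult_right_mono[of "op_norm B" ?M "vec_norm2 (vr q v)"] by (simp add: vr_def)
    ultimately have "(vec_norm2 (E *\<^sub>v v))\<^sup>2 \<le> (?M * vec_norm2 (vl q v))\<^sup>2 + (?M * vec_norm2 (vr q v))\<^sup>2"
      unfolding norm[OF Ev] El[OF v] Er[OF v] by (intro add_mono power_mono) auto
    also have "\<dots> = (?M * vec_norm2 v)\<^sup>2"
      by (simp add: power_mult_distrib norm[OF v] algebra_simps)
    finally show "vec_norm2 (E *\<^sub>v v) \<le> ?M * vec_norm2 v"
      by (rule power2_le_imp_le) (auto intro!: mult_nonneg_nonneg simp: le_max_iff_disj)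
  qed (auto simp: le_max_iff_disj)
  moreover have "op_norm A \<le> op_norm E"
  proof (rule op_norm_le_of_embedding)
    fix v :: "complex vec" assume "v \<in> carrier_vec (dim_col A)"
    then have v: "v \<in> carrier_vec (q * n)" using A by simp
    let ?v = "join v (0\<^sub>v (q * m))"
    have j: "?v \<in> carrier_vec (q * (n + m))" "vl q ?v = v" "vr q ?v = 0\<^sub>v (q * m)" using join[OF v] by auto
    show "?v \<in> carrier_vec (dim_col E)" using j(1) E by simp
    show "(vec_norm2 ?v)\<^sup>2 = (vec_norm2 v)\<^sup>2" using norm[OF j(1)] j by simp
    show "(vec_norm2 (A *\<^sub>v v))\<^sup>2 \<le> (vec_norm2 (E *\<^sub>v ?v))\<^sup>2" unfolding norm[OF Ev] El[OF j(1)] j by simp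
  qed
  moreover have "op_norm B \<le> op_norm E"
  proof (rule op_norm_le_of_embedding)
    fix v :: "complex vec" assume "v \<in> carrier_vec (dim_col B)"
    then have v: "v \<in> carrier_vec (q * m)" using B by simp
    let ?v = "join (0\<^sub>v (q * n)) v"
    have j: "?v \<in> carrier_vec (q * (n + m))" "vr q ?v = v" "vl q ?v = 0\<^sub>v (q * n)" using join[OF _ v] by auto
    show "?v \<in> carrier_vec (dim_col E)" using j(1) E by simp
    show "(vec_norm2 ?v)\<^sup>2 = (vec_norm2 v)\<^sup>2" using norm[OF j(1)] j by simp
    show "(vec_norm2 (B *\<^sub>v v))\<^sup>2 \<le> (vec_norm2 (E *\<^sub>v ?v))\<^sup>2" unfolding norm[OF Ev] Er[OF j(1)] j by simp
  qed
  ultimately show ?thesis by auto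
qed

lemma poly_mat_eval_carrier:
  "x \<in> M_level d n \<Longrightarrow> d \<ge> 1 \<Longrightarrow> poly_mat_eval \<delta> x \<in> carrier_mat (dim_row \<delta> * n) (dim_col \<delta> * n)"
  by (simp add: poly_mat_eval_def Let_def pt_size_M_level)

lemma poly_mat_eval_index:
  "x \<in> M_level d n \<Longrightarrow> d \<ge> 1 \<Longrightarrow> i < dim_row \<delta> * n \<Longrightarrow> j < dim_col \<delta> * n \<Longrightarrow>
   poly_mat_eval \<delta> x $$ (i, j) = poly_eval (\<delta> $$ (i div n, j div n)) x $$ (i mod n, j mod n)"
  by (simp add: poly_mat_eval_def Let_def pt_size_M_level)

text \<open>An equality rather than an estimate: it makes \<open>B_free\<close> closed both under
  direct sums and under passage to direct summands.\<close>

lemma op_norm_poly_mat_eval_dsum: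
  assumes x: "x \<in> M_level d n" and y: "y \<in> M_level d m" and d: "d \<ge> 1" and nm: "n \<ge> 1" "m \<ge> 1"
    and \<delta>: "elements_mat \<delta> \<subseteq> free_polys d"
  shows "op_norm (poly_mat_eval \<delta> (pt_dsum x y)) = max (op_norm (poly_mat_eval \<delta> x)) (op_norm (poly_mat_eval \<delta> y))"
proof (rule op_norm_block_sum)
  note xy = pt_dsum_level[OF x y]
  show nm': "n > 0" "m > 0" using nm by auto
  show "poly_mat_eval \<delta> x \<in> carrier_mat (dim_row \<delta> * n) (dim_col \<delta> * n)"
    "poly_mat_eval \<delta> y \<in> carrier_mat (dim_row \<delta> * m) (dim_col \<delta> * m)"
    "poly_mat_eval \<delta> (pt_dsum x y) \<in> carrier_mat (dim_row \<delta> * (n + m)) (dim_col \<delta> * (n + m))"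
    using poly_mat_eval_carrier x y xy d by auto
  have ent: "poly_eval (\<delta> $$ (a, b)) (pt_dsum x y) = mat_dsum (poly_eval (\<delta> $$ (a, b)) x) (poly_eval (\<delta> $$ (a, b)) y)"
    if "a < dim_row \<delta>" "b < dim_col \<delta>" for a b
    using \<delta> that by (intro poly_eval_dsum[OF x y d]) (auto intro!: elements_matI subsetD[OF \<delta>])
  note simps = left_ix[OF nm'(1)] right_ix[OF nm'(2)] poly_mat_eval_index[OF xy d] poly_mat_eval_index[OF x d]
    poly_mat_eval_index[OF y d] ent less_mult_imp_div_less mat_dsum_index carrier_matD[OF poly_eval_carrier[OF x d]] carrier_matD[OF poly_eval_carrier[OF y d]]
  show "poly_mat_eval \<delta> (pt_dsum x y) $$ (left_ix n m i, left_ix n m j) = poly_mat_eval \<delta> x $$ (i, j)"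
    if "i < dim_row \<delta> * n" "j < dim_col \<delta> * n" for i j using that nm' by (simp add: simps trans_less_add1)
  show "poly_mat_eval \<delta> (pt_dsum x y) $$ (right_ix n m i, right_ix n m j) = poly_mat_eval \<delta> y $$ (i, j)"
    if "i < dim_row \<delta> * m" "j < dim_col \<delta> * m" for i j using that nm' by (simp add: simps)
  show "poly_mat_eval \<delta> (pt_dsum x y) $$ (left_ix n m i, right_ix n m j) = 0"
    if "i < dim_row \<delta> * n" "j < dim_col \<delta> * m" for i j using that nm' by (simp add: simps trans_less_add1)
  show "poly_mat_eval \<delta> (pt_dsum x y) $$ (right_ix n m i, left_ix n m j) = 0"
    if "i < dim_row \<delta> * m" "j < dim_col \<delta> * n" for i j using that nm' by (simp add: simps trans_less_add1)
qed

section \<open>Free domains on a single level\<close>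

lemma tendsto_word_eval:
  assumes x: "x \<in> M_level d n" and d: "d \<ge> 1" and w: "w \<in> lists {..<d}" and ij: "i < n" "j < n"
  shows "((\<lambda>y. word_eval y w $$ (i, j)) \<longlongrightarrow> word_eval x w $$ (i, j)) (lev_nhd d n x)"
  using w ij
proof (induction w arbitrary: i)
  case Nil
  have "\<forall>\<^sub>F y in lev_nhd d n x. word_eval x [] $$ (i, j) = word_eval y [] $$ (i, j)"
    using eventually_lev_nhd_level by eventually_elim (use x d in \<open>simp add: word_eval_Nil pt_size_M_level\<close>)
  then show ?case by (rule Lim_transform_eventually[OF tendsto_const])
next
  case (Cons k w)
  then have k: "k < d" "w \<in> lists {..<d}" by auto
  have eq: "word_eval y (k # w) $$ (i, j) = (\<Sum>l<n. y ! k $$ (i, l) * word_eval y w $$ (l, j))"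
    if "y \<in> M_level d n" for y
    using M_level_nth[OF that k(1)] word_eval_carrier[OF that d k(2)] Cons.prems
    by (simp add: word_eval_Cons scalar_prod_def atLeast0LessThan)
  have "((\<lambda>y. \<Sum>l<n. y ! k $$ (i, l) * word_eval y w $$ (l, j)) \<longlongrightarrow>
      (\<Sum>l<n. x ! k $$ (i, l) * word_eval x w $$ (l, j))) (lev_nhd d n x)"
    by (intro tendsto_intros tendsto_lev_nhd_entry k Cons.IH) (use Cons.prems in auto)
  moreover have "\<forall>\<^sub>F y in lev_nhd d n x. (\<Sum>l<n. y ! k $$ (i, l) * word_eval y w $$ (l, j)) = word_eval y (k # w) $$ (i, j)"
    using eventually_lev_nhd_level by eventually_elim (simp add: eq)
  ultimately show ?case unfolding eq[OF x] by (rule Lim_transform_eventually)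
qed

lemma tendsto_poly_eval:
  assumes x: "x \<in> M_level d n" and d: "d \<ge> 1" and p: "p \<in> free_polys d" and ij: "i < n" "j < n"
  shows "((\<lambda>y. poly_eval p y $$ (i, j)) \<longlongrightarrow> poly_eval p x $$ (i, j)) (lev_nhd d n x)"
proof -
  have "((\<lambda>y. \<Sum>w\<in>Poly_Mapping.keys p. Poly_Mapping.lookup p w * (word_eval y w $$ (i, j))) \<longlongrightarrow>
      (\<Sum>w\<in>Poly_Mapping.keys p. Poly_Mapping.lookup p w * (word_eval x w $$ (i, j)))) (lev_nhd d n x)"
    by (intro tendsto_intros tendsto_word_eval[OF x d] ij) (use p in \<open>auto simp: free_polys_def\<close>)
  moreover have "\<forall>\<^sub>F y in lev_nhd d n x. (\<Sum>w\<in>Poly_Mapping.keys p. Poly_Mapping.lookup p w * (word_eval y w $$ (i, j)))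
      = poly_eval p y $$ (i, j)"
    using eventually_lev_nhd_level by eventually_elim (simp add: poly_eval_index[OF _ d ij])
  ultimately show ?thesis unfolding poly_eval_index[OF x d ij] by (rule Lim_transform_eventually)
qed

lemma level_open_B_free:
  assumes d: "d \<ge> 1" and \<delta>: "elements_mat \<delta> \<subseteq> free_polys d" and n: "n \<ge> 1"
  shows "level_open d n (B_free d \<delta>)"
  unfolding level_open_iff
proof
  fix x assume "x \<in> B_free d \<delta> \<inter> M_level d n"
  then have x: "x \<in> M_level d n" and lt: "op_norm (poly_mat_eval \<delta> x) < 1" by (auto simp: B_free_def)
  let ?A = "poly_mat_eval \<delta>"
  \<comment> \<open>An upper bound for \<open>op_norm (?A y)\<close> by the triangle inequality. On
    a fixed level it is a finite sum of continuous functions of the entries, with the right value at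
    \<open>x\<close>, so continuity of \<open>op_norm\<close> itself is not called for.\<close>
  define g where "g = (\<lambda>y. op_norm (?A x) + (\<Sum>i<dim_row \<delta> * n. \<Sum>j<dim_col \<delta> * n. cmod (?A y $$ (i, j) - ?A x $$ (i, j))))"
  have ent: "((\<lambda>y. ?A y $$ (i, j)) \<longlongrightarrow> ?A x $$ (i, j)) (lev_nhd d n x)"
    if ij: "i < dim_row \<delta> * n" "j < dim_col \<delta> * n" for i j
  proof -
    have "\<delta> $$ (i div n, j div n) \<in> free_polys d"
      using \<delta> less_mult_imp_div_less[OF ij(1)] less_mult_imp_div_less[OF ij(2)] by (auto intro!: elements_matI subsetD[OF \<delta>])
    from tendsto_poly_eval[OF x d this, of "i mod n" "j mod n"]
    have "((\<lambda>y. poly_eval (\<delta> $$ (i div n, j div n)) y $$ (i mod n, j mod n)) \<longlongrightarrow> ?A x $$ (i, j)) (lev_nhd d n x)"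
      using n by (simp add: poly_mat_eval_index[OF x d ij])
    moreover have "\<forall>\<^sub>F y in lev_nhd d n x. poly_eval (\<delta> $$ (i div n, j div n)) y $$ (i mod n, j mod n) = ?A y $$ (i, j)"
      using eventually_lev_nhd_level by eventually_elim (simp add: poly_mat_eval_index[OF _ d ij])
    ultimately show ?thesis by (rule Lim_transform_eventually)
  qed
  have "(g \<longlongrightarrow> op_norm (?A x) + (\<Sum>i<dim_row \<delta> * n. \<Sum>j<dim_col \<delta> * n. cmod (?A x $$ (i, j) - ?A x $$ (i, j)))) (lev_nhd d n x)"
    unfolding g_def by (intro tendsto_intros ent) auto
  then have "(g \<longlongrightarrow> op_norm (?A x)) (lev_nhd d n x)" by simp
  then have "\<forall>\<^sub>F y in lev_nhd d n x. g y < 1" using lt by (rule order_tendstoD)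
  then show "\<forall>\<^sub>F y in lev_nhd d n x. y \<in> B_free d \<delta>"
    using eventually_lev_nhd_level
  proof eventually_elim
    fix y assume y: "g y < 1" "y \<in> M_level d n"
    note cx = poly_mat_eval_carrier[OF x d, of \<delta>] and cy = poly_mat_eval_carrier[OF y(2) d, of \<delta>]
    have "?A y = ?A x + (?A y - ?A x)" by (rule eq_matI) (use cx cy in auto)
    also have "op_norm \<dots> \<le> op_norm (?A x) + op_norm (?A y - ?A x)"
      by (rule op_norm_add) (use cx cy in auto)
    also have "op_norm (?A y - ?A x) \<le> (\<Sum>i<dim_row \<delta> * n. \<Sum>j<dim_col \<delta> * n. cmod (?A y $$ (i, j) - ?A x $$ (i, j)))"
      using op_norm_le_sum[of "?A y - ?A x"] cx cy by simp
    finally show "y \<in> B_free d \<delta>" using y M_level_space[OF y(2) n] by (auto simp: B_free_def g_def)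
  qed
qed

lemma pt_dsum_space: "x \<in> M_space d \<Longrightarrow> y \<in> M_space d \<Longrightarrow> d \<ge> 1 \<Longrightarrow> pt_dsum x y \<in> M_space d"
  using M_space_level[of x d] M_space_level[of y d] pt_dsum_level[of x d "pt_size x" y "pt_size y"] M_level_space
  by (metis le_add1 order_trans)

text \<open>Closure under direct summands makes a local nc-identity around \<open>pt_dsum x y\<close> available at
  \<open>x\<close> and \<open>y\<close> themselves.\<close>

definition free_basic :: "nat \<Rightarrow> nc_point set \<Rightarrow> bool" where
  "free_basic d W \<longleftrightarrow> free_domain d W \<and> nc_set d W \<and> (\<forall>n\<ge>1. level_open d n W) \<and>
     (\<forall>x\<in>M_space d. \<forall>y\<in>M_space d. pt_dsum x y \<in> W \<longrightarrow> x \<in> W \<and> y \<in> W)"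

lemma free_basic_B_free:
  assumes d: "d \<ge> 1" and \<delta>: "elements_mat \<delta> \<subseteq> free_polys d"
  shows "free_basic d (B_free d \<delta>)"
proof -
  have "free_domain d (B_free d \<delta>)"
    unfolding free_domain_def free_topology_def openin_topology_generated_by_iff
    by (rule generate_topology_on.Basis) (use \<delta> in blast)
  moreover have key: "pt_dsum x y \<in> B_free d \<delta> \<longleftrightarrow> x \<in> B_free d \<delta> \<and> y \<in> B_free d \<delta>"
    if "x \<in> M_space d" "y \<in> M_space d" for x y
    using op_norm_poly_mat_eval_dsum[of x d "pt_size x" y "pt_size y" \<delta>] M_space_level[OF that(1) d] M_space_level[OF that(2) d]
      that d \<delta> pt_dsum_space[OF that d] by (auto simp: B_free_def)
  moreover have "nc_set d (B_free d \<delta>)"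
    using key unfolding nc_set_def by (auto simp: B_free_def)
  ultimately show ?thesis using level_open_B_free[OF d \<delta>] by (auto simp: free_basic_def)
qed

lemma level_open_Int: "level_open d n U \<Longrightarrow> level_open d n V \<Longrightarrow> level_open d n (U \<inter> V)"
  unfolding level_open_iff by (auto intro: eventually_conj)

lemma free_domain_Int: "free_domain d U \<Longrightarrow> free_domain d V \<Longrightarrow> free_domain d (U \<inter> V)"
  unfolding free_domain_def by (rule openin_Int)

lemma free_basic_Int: "free_basic d U \<Longrightarrow> free_basic d V \<Longrightarrow> free_basic d (U \<inter> V)"
  unfolding free_basic_def nc_set_def using free_domain_Int[of d U V] level_open_Int[of d _ U V] by blast

text \<open>The topology is given by generators. Since \<open>free_basic\<close> survives finite
  intersections, the induction over the generated topology can supply such neighbourhoods.\<close>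

lemma ex_free_basic:
  assumes d: "d \<ge> 1" and "free_domain d D" "x \<in> D"
  shows "\<exists>W. free_basic d W \<and> x \<in> W \<and> W \<subseteq> D"
proof -
  have "generate_topology_on {B_free d \<delta> |\<delta>. elements_mat \<delta> \<subseteq> free_polys d} D"
    using assms(2) by (simp add: free_domain_def free_topology_def openin_topology_generated_by_iff)
  then show ?thesis using assms(3)
  proof (induction arbitrary: x)
    case (Int a b)
    have "x \<in> a" "x \<in> b" using Int.prems by auto
    from Int.IH(1)[OF this(1)] Int.IH(2)[OF this(2)]
    obtain U V where "free_basic d U" "x \<in> U" "U \<subseteq> a" "free_basic d V" "x \<in> V" "V \<subseteq> b" by blast
    then show ?case using free_basic_Int[of d U V] by (intro exI[of _ "U \<inter> V"]) auto
  next
    case (UN K)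
    then obtain k where k: "k \<in> K" "x \<in> k" by blast
    from UN.IH[OF this] obtain W where "free_basic d W" "x \<in> W" "W \<subseteq> k" by blast
    then show ?case using k by (intro exI[of _ W]) auto
  next
    case (Basis s)
    then show ?case using free_basic_B_free[OF d] by (intro exI[of _ s]) auto
  qed auto
qed

lemma free_domain_subset_space: "d \<ge> 1 \<Longrightarrow> free_domain d D \<Longrightarrow> D \<subseteq> M_space d"
  unfolding subset_iff by (metis ex_free_basic free_basic_def nc_set_def subsetD)

lemma free_domain_M_space:
  assumes d: "d \<ge> 1"
  shows "free_domain d (M_space d)"
proof -
  \<comment> \<open>The empty matrix of polynomials has empty evaluations, of norm zero, and so
    imposes no condition.\<close>
  let ?\<delta> = "Matrix.mat 0 0 (\<lambda>_. 0) :: free_poly mat"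
  have "op_norm (poly_mat_eval ?\<delta> x) < 1" for x
    by (rule le_less_trans[OF op_norm_le_sum]) (simp add: poly_mat_eval_def Let_def)
  then have "B_free d ?\<delta> = M_space d" by (auto simp: B_free_def)
  moreover have "free_basic d (B_free d ?\<delta>)" by (rule free_basic_B_free[OF d]) auto
  ultimately show ?thesis by (simp add: free_basic_def)
qed

section \<open>The Zariski-free topology\<close>

definition shear :: "nat \<Rightarrow> complex \<Rightarrow> complex mat" where
  "shear n c = four_block_mat (1\<^sub>m n) (c \<cdot>\<^sub>m 1\<^sub>m n) (0\<^sub>m n n) (1\<^sub>m n)"

lemma shear_carrier [simp]: "shear n c \<in> carrier_mat (n + n) (n + n)"
  unfolding shear_def by (rule four_block_carrier_mat) auto

lemma shear_mult: "shear n c * shear n c' = shear n (c + c')"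
proof -
  have "c' \<cdot>\<^sub>m 1\<^sub>m n + c \<cdot>\<^sub>m 1\<^sub>m n = (c + c') \<cdot>\<^sub>m (1\<^sub>m n :: complex mat)"
    by (rule eq_matI) auto
  then show ?thesis
    unfolding shear_def by (subst mult_four_block_mat[of _ n n _ n _ n _ _ n _ n]) auto
qed

lemma shear_zero: "shear n 0 = 1\<^sub>m (n + n)"
  unfolding shear_def by (rule eq_matI) auto

lemma shear_inverse: "mat_inv' (shear n c) = shear n (- c)" "invertible_mat (shear n c)"
proof -
  have 1: "shear n c * shear n (- c) = 1\<^sub>m (n + n)" by (simp add: shear_mult shear_zero)
  show "mat_inv' (shear n c) = shear n (- c)" by (rule mat_inv'_eqI[OF _ _ 1]) auto
  show "invertible_mat (shear n c)" by (rule invertible_matI[OF _ _ 1]) auto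
qed

lemma shear_conj_dsum:
  assumes A: "A \<in> carrier_mat n n" and B: "B \<in> carrier_mat n n"
  shows "mat_inv' (shear n c) * mat_dsum A B * shear n c = four_block_mat A (c \<cdot>\<^sub>m (A - B)) (0\<^sub>m n n) B"
proof -
  have sB: "- c \<cdot>\<^sub>m 1\<^sub>m n * B = - c \<cdot>\<^sub>m B" using B by (simp add: mult_smult_assoc_mat[of _ n n _ n])
  have As: "A * (c \<cdot>\<^sub>m 1\<^sub>m n) = c \<cdot>\<^sub>m A" using A by (simp add: mult_smult_distrib[of _ n n _ n])
  have *: "c \<cdot>\<^sub>m A + - c \<cdot>\<^sub>m B = c \<cdot>\<^sub>m (A - B)"
    by (rule eq_matI) (use A B in \<open>auto simp: algebra_simps\<close>)
  have "mat_inv' (shear n c) * mat_dsum A B = four_block_mat A (- c \<cdot>\<^sub>m B) (0\<^sub>m n n) B"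
    unfolding shear_inverse(1) unfolding shear_def mat_dsum_def
    by (subst mult_four_block_mat[of _ n n _ n _ n _ _ n _ n]) (use A B sB in auto)
  also have "\<dots> * shear n c = four_block_mat A (c \<cdot>\<^sub>m (A - B)) (0\<^sub>m n n) B"
    unfolding shear_def
    by (subst mult_four_block_mat[of _ n n _ n _ n _ _ n _ n]) (use A B As * in auto)
  finally show ?thesis .
qed

lemma pt_conj_nth: "k < length x \<Longrightarrow> pt_conj s x ! k = mat_inv' s * (x ! k) * s"
  by (simp add: pt_conj_def)

lemma pt_conj_level:
  assumes "x \<in> M_level d n" "s \<in> carrier_mat n n" "invertible_mat s"
  shows "pt_conj s x \<in> M_level d n"
  using assms mat_inv'(1)[OF assms(2,3)] by (auto simp: pt_conj_def M_level_def)

text \<open>A locally bounded nc-function is continuous on each level: its value at the sheared point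
  with blocks \<open>y\<close>, \<open>c(y - x)\<close>, \<open>0\<close>, \<open>x\<close> has the blocks \<open>f y\<close>, \<open>c(f y - f x)\<close>, \<open>0\<close>, \<open>f x\<close>,
  and it stays bounded while \<open>c\<close> may be taken large as \<open>y\<close> tends to \<open>x\<close>.\<close>

lemma freely_holomorphic_tendsto:
  assumes f: "freely_holomorphic d D f" and d: "d \<ge> 1" and n: "n \<ge> 1"
    and x: "x \<in> D" "x \<in> M_level d n" and ij: "i < n" "j < n"
  shows "((\<lambda>y. f y $$ (i, j)) \<longlongrightarrow> f x $$ (i, j)) (lev_nhd d n x)"
proof -
  have gr: "graded d D f" using f by (simp add: freely_holomorphic_def)
  obtain U V C where U: "free_domain d U" "x \<in> U" "U \<subseteq> D" "nc_function d U f"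
    and V: "free_domain d V" "x \<in> V" "\<forall>y\<in>V. op_norm (f y) \<le> C"
    using f x(1) unfolding freely_holomorphic_def by meson
  obtain W where W: "free_basic d W" "x \<in> W" "W \<subseteq> U \<inter> V"
    using ex_free_basic[OF d free_domain_Int[OF U(1) V(1)]] U V by blast
  have C: "C \<ge> 0" using V(2,3) op_norm_nonneg[of "f x"] order_trans by blast
  have lo: "level_open d m W" if "m \<ge> 1" for m using W that by (auto simp: free_basic_def)
  have ncW: "pt_dsum y y' \<in> W" if "y \<in> W" "y' \<in> W" for y y'
    using W that by (auto simp: free_basic_def nc_set_def)
  \<comment> \<open>Openness of \<open>W\<close> is applied at level \<open>n + n\<close>, at the
    point \<open>pt_dsum x x\<close>: for \<open>y\<close> close to \<open>x\<close> the sheared sum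
    of \<open>y\<close> and \<open>x\<close> is close to it and so stays in
    \<open>W\<close>.\<close>
  have xx: "pt_dsum x x \<in> W \<inter> M_level d (n + n)" using ncW W pt_dsum_level[OF x(2) x(2)] by auto
  have "level_open d (n + n) W" using lo n by simp
  then obtain e where e: "e > 0" "\<forall>Y\<in>M_level d (n + n).
      (\<forall>k<d. \<forall>i<n + n. \<forall>j<n + n. cmod (Y ! k $$ (i, j) - pt_dsum x x ! k $$ (i, j)) < e) \<longrightarrow> Y \<in> W"
    using xx unfolding level_open_def by blast
  have evW: "\<forall>\<^sub>F y in lev_nhd d n x. y \<in> W"
    using lo[OF n] W(2) x(2) unfolding level_open_iff by blast
  show ?thesis
  proof (rule tendstoI)
    fix \<epsilon> :: real assume \<epsilon>: "\<epsilon> > 0"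
    \<comment> \<open>With this value \<open>c * \<delta> \<le> C\<close> yields
      \<open>\<delta> < \<epsilon>\<close>. The matching radius \<open>e / (1 + c)\<close> keeps
      both an entry of the difference, in the diagonal block, and its \<open>c\<close>-fold, in the
      corner, below \<open>e\<close>.\<close>
    define c where "c = (C + 1) / \<epsilon>"
    have c: "c > 0" using C \<epsilon> by (simp add: c_def)
    have "\<forall>\<^sub>F y in lev_nhd d n x. \<forall>k<d. \<forall>i<n. \<forall>j<n. cmod (y ! k $$ (i, j) - x ! k $$ (i, j)) < e / (1 + c)"
      unfolding eventually_lev_nhd using e(1) c by (intro exI[of _ "e / (1 + c)"]) auto
    then show "\<forall>\<^sub>F y in lev_nhd d n x. dist (f y $$ (i, j)) (f x $$ (i, j)) < \<epsilon>"
      using evW eventually_lev_nhd_level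
    proof eventually_elim
      fix y assume near: "\<forall>k<d. \<forall>i<n. \<forall>j<n. cmod (y ! k $$ (i, j) - x ! k $$ (i, j)) < e / (1 + c)"
        and y: "y \<in> W" "y \<in> M_level d n"
      let ?s = "shear n (of_real c)" and ?p = "pt_dsum y x"
      have p: "?p \<in> W" "?p \<in> M_level d (n + n)" using ncW y W pt_dsum_level[OF y(2) x(2)] by auto
      have lev: "pt_conj ?s ?p \<in> M_level d (n + n)"
        by (rule pt_conj_level[OF p(2) shear_carrier shear_inverse(2)])
      have "pt_conj ?s ?p \<in> W"
      proof (rule e(2)[rule_format, OF lev])
        fix k i j assume k: "k < d" and ij: "i < n + n" "j < n + n"
        note cx = M_level_nth[OF x(2) k] and cy = M_level_nth[OF y(2) k]
        have eq: "pt_conj ?s ?p ! k = four_block_mat (y ! k) (of_real c \<cdot>\<^sub>m (y ! k - x ! k)) (0\<^sub>m n n) (x ! k)"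
        proof -
          have "k < length ?p" using k p(2) by (simp add: M_level_def)
          show ?thesis
            unfolding pt_conj_nth[OF \<open>k < length ?p\<close>] pt_dsum_nth[OF y(2) x(2) k] by (rule shear_conj_dsum[OF cy cx])
        qed
        have lt: "e / (1 + c) \<le> e" using e(1) c by (simp add: field_simps)
        have near': "cmod (y ! k $$ (i, j) - x ! k $$ (i, j)) < e / (1 + c)" if "i < n" "j < n" for i j
          using near k that by blast
        have near_c: "c * cmod (y ! k $$ (i, j) - x ! k $$ (i, j)) < e" if "i < n" "j < n" for i j
        proof -
          have "c * cmod (y ! k $$ (i, j) - x ! k $$ (i, j)) \<le> (1 + c) * cmod (y ! k $$ (i, j) - x ! k $$ (i, j))"
            by (intro mult_right_mono) auto
          also have "\<dots> < e" using near'[OF that] c by (simp add: field_simps)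
          finally show ?thesis .
        qed
        consider "i < n" "j < n" | "i < n" "\<not> j < n" | "\<not> i < n" by blast
        then show "cmod (pt_conj ?s ?p ! k $$ (i, j) - pt_dsum x x ! k $$ (i, j)) < e"
        proof cases
          case 1
          then show ?thesis using near'[of i j] lt cx cy ij
            unfolding eq pt_dsum_nth[OF x(2) x(2) k] by (simp add: mat_dsum_index)
        next
          case 2
          then show ?thesis using near_c[of i "j - n"] cx cy ij c
            unfolding eq pt_dsum_nth[OF x(2) x(2) k] by (simp add: mat_dsum_index norm_mult)
        next
          case 3
          then show ?thesis using cx cy ij e(1)
            unfolding eq pt_dsum_nth[OF x(2) x(2) k] by (simp add: mat_dsum_index)
        qed
      qed
      then have cU: "pt_conj ?s ?p \<in> U" and cV: "pt_conj ?s ?p \<in> V" using W by auto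
      have fx: "f x \<in> carrier_mat n n" and fy: "f y \<in> carrier_mat n n"
        using gr n x y W(3) U(3) unfolding graded_def by blast+
      have "f (pt_conj ?s ?p) = mat_inv' ?s * f ?p * ?s"
      proof -
        have "?p \<in> U \<inter> M_level d (n + n)" "n + n \<ge> 1" using p W n by auto
        then show ?thesis
          using U(4) cU shear_carrier[of n "of_real c"] shear_inverse(2)[of n "of_real c"]
          unfolding nc_function_def by blast
      qed
      also have "f ?p = mat_dsum (f y) (f x)"
        using U(2,4) y(1) W(3) unfolding nc_function_def by blast
      also have "mat_inv' ?s * mat_dsum (f y) (f x) * ?s = four_block_mat (f y) (of_real c \<cdot>\<^sub>m (f y - f x)) (0\<^sub>m n n) (f x)"
        by (rule shear_conj_dsum[OF fy fx])
      finally have fp: "f (pt_conj ?s ?p) = four_block_mat (f y) (of_real c \<cdot>\<^sub>m (f y - f x)) (0\<^sub>m n n) (f x)" .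
      have "cmod (f (pt_conj ?s ?p) $$ (i, n + j)) \<le> op_norm (f (pt_conj ?s ?p))"
        by (rule cmod_entry_le_op_norm) (use fx fy ij in \<open>auto simp: fp\<close>)
      also have "\<dots> \<le> C" using V(3) cV by blast
      finally have "c * cmod (f y $$ (i, j) - f x $$ (i, j)) \<le> C"
        using fx fy ij c by (simp add: fp norm_mult)
      then have "(C + 1) * cmod (f y $$ (i, j) - f x $$ (i, j)) \<le> C * \<epsilon>"
        using \<epsilon> by (simp add: c_def field_simps)
      also have "\<dots> < (C + 1) * \<epsilon>" using \<epsilon> by simp
      finally show "dist (f y $$ (i, j)) (f x $$ (i, j)) < \<epsilon>"
        using C by (simp add: dist_norm)
    qed
  qed
qed

section \<open>A base of nc-sets for the Zariski-free topology\<close>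

definition zariski_basic :: "nat \<Rightarrow> nc_point set \<Rightarrow> bool" where
  "zariski_basic d N \<longleftrightarrow> openin (zariski_free_topology d) N \<and> nc_set d N \<and> (\<forall>n\<ge>1. level_open d n N)"

lemma openin_zariskiI:
  "free_domain d D \<Longrightarrow> finite \<V> \<Longrightarrow> (\<And>T. T \<in> \<V> \<Longrightarrow> free_variety d D T) \<Longrightarrow>
   openin (zariski_free_topology d) (D - \<Union>\<V>)"
  unfolding zariski_free_topology_def openin_topology_generated_by_iff
  by (rule generate_topology_on.Basis) blast

lemma openin_zariski_free_domain: "free_domain d D \<Longrightarrow> openin (zariski_free_topology d) D"
  using openin_zariskiI[of d D "{}"] by simp

lemma zariski_basic_Int: "zariski_basic d M \<Longrightarrow> zariski_basic d N \<Longrightarrow> zariski_basic d (M \<inter> N)"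
  unfolding zariski_basic_def nc_set_def
  using openin_Int[of "zariski_free_topology d" M N] level_open_Int[of d _ M N] by blast

lemma freely_holomorphic_dsum:
  assumes g: "freely_holomorphic d D g" and d: "d \<ge> 1" and xy: "pt_dsum x y \<in> D" "x \<in> M_space d" "y \<in> M_space d"
  shows "g (pt_dsum x y) = mat_dsum (g x) (g y)"
proof -
  obtain U where U: "free_domain d U" "pt_dsum x y \<in> U" "nc_function d U g"
    using g xy(1) unfolding freely_holomorphic_def by meson
  obtain W where "free_basic d W" "pt_dsum x y \<in> W" "W \<subseteq> U"
    using ex_free_basic[OF d U(1,2)] by blast
  then have "x \<in> U" "y \<in> U" using xy by (auto simp: free_basic_def)
  then show ?thesis using U(3) by (auto simp: nc_function_def)
qed

lemma nonvanishing_entry: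
  assumes "A \<in> carrier_mat n n" "A \<noteq> 0\<^sub>m n n"
  shows "\<exists>i<n. \<exists>j<n. A $$ (i, j) \<noteq> (0 :: complex)"
proof (rule ccontr)
  assume "\<not> ?thesis"
  then have "A = 0\<^sub>m n n" by (intro eq_matI) (use assms in auto)
  then show False using assms by simp
qed

text \<open>If \<open>g\<close> does not vanish at \<open>y\<close>, then
  \<open>g (pt_dsum y z) = mat_dsum (g y) (g z)\<close> does not vanish either, whatever
  \<open>z\<close> is. So removing varieties preserves closure under direct sums. On each level
  \<open>g\<close> is continuous, so a variety is avoided near \<open>y\<close>, and finiteness of
  \<open>\<V>\<close> allows this for all its members at once.\<close>

lemma ex_zariski_basic_subbase:
  assumes d: "d \<ge> 1" and D: "free_domain d D" and \<V>: "finite \<V>" "\<And>T. T \<in> \<V> \<Longrightarrow> free_variety d D T"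
    and x: "x \<in> D - \<Union>\<V>"
  shows "\<exists>N. zariski_basic d N \<and> x \<in> N \<and> N \<subseteq> D - \<Union>\<V>"
proof -
  obtain W where W: "free_basic d W" "x \<in> W" "W \<subseteq> D" using ex_free_basic[OF d D] x by blast
  let ?N = "W - \<Union>\<V>"
  have Wsp: "W \<subseteq> M_space d" using W(1) by (auto simp: free_basic_def nc_set_def)
  \<comment> \<open>The function of the defining family that detects \<open>y \<notin> T\<close>. It
    depends on both \<open>T\<close> and \<open>y\<close>.\<close>
  have witness: "\<exists>g. freely_holomorphic d D g \<and> (\<forall>z\<in>T. g z = 0\<^sub>m (pt_size z) (pt_size z))
      \<and> g y \<in> carrier_mat (pt_size y) (pt_size y) \<and> g y \<noteq> 0\<^sub>m (pt_size y) (pt_size y)"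
    if T: "T \<in> \<V>" and y: "y \<in> ?N" for T y
  proof -
    obtain E where E: "\<forall>g\<in>E. freely_holomorphic d D g"
      "T = {x\<in>D. \<forall>g\<in>E. g x = 0\<^sub>m (pt_size x) (pt_size x)}"
      using \<V>(2)[OF T] unfolding free_variety_def by blast
    have "y \<notin> T" "y \<in> D" using y T W by auto
    then obtain g where g: "g \<in> E" "g y \<noteq> 0\<^sub>m (pt_size y) (pt_size y)" using E(2) by blast
    moreover have "g y \<in> carrier_mat (pt_size y) (pt_size y)"
      using E(1) g(1) M_space_level[of y d] \<open>y \<in> D\<close> y Wsp d unfolding freely_holomorphic_def graded_def by blast
    ultimately show ?thesis using E by (intro exI[of _ g]) auto
  qed
  have "?N = (D - \<Union>\<V>) \<inter> W" using W by auto
  then have op: "openin (zariski_free_topology d) ?N"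
    using openin_Int[OF openin_zariskiI[OF D \<V>] openin_zariski_free_domain] W(1) by (simp add: free_basic_def)
  have nc: "nc_set d ?N"
    unfolding nc_set_def
  proof (intro conjI ballI)
    show "?N \<subseteq> M_space d" using Wsp by auto
    fix y z assume y: "y \<in> ?N" and z: "z \<in> ?N"
    have yz: "pt_dsum y z \<in> W" using W(1) y z by (auto simp: free_basic_def nc_set_def)
    have "pt_dsum y z \<notin> T" if T: "T \<in> \<V>" for T
    proof
      assume in_T: "pt_dsum y z \<in> T"
      obtain g where g: "freely_holomorphic d D g" "\<forall>z\<in>T. g z = 0\<^sub>m (pt_size z) (pt_size z)"
        "g y \<in> carrier_mat (pt_size y) (pt_size y)" "g y \<noteq> 0\<^sub>m (pt_size y) (pt_size y)"
        using witness[OF T y] by blast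
      have ly: "y \<in> M_level d (pt_size y)" and lz: "z \<in> M_level d (pt_size z)" "pt_size z \<ge> 1"
        using M_space_level y z Wsp d by blast+
      have gz: "g z \<in> carrier_mat (pt_size z) (pt_size z)"
        using g(1) lz z W(3) unfolding freely_holomorphic_def graded_def by blast
      have "mat_dsum (g y) (g z) = g (pt_dsum y z)"
        using freely_holomorphic_dsum[OF g(1) d, of y z] yz y z W(3) Wsp by (metis DiffD1 subsetD)
      also have "\<dots> = 0\<^sub>m (pt_size y + pt_size z) (pt_size y + pt_size z)"
        using g(2) in_T pt_size_M_level[OF pt_dsum_level[OF ly lz(1)] d] by auto
      finally have "g y = 0\<^sub>m (pt_size y) (pt_size y)"
        using mat_dsum_inject[OF g(3) zero_carrier_mat gz zero_carrier_mat] by (simp add: mat_dsum_zero)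
      then show False using g(4) by simp
    qed
    then show "pt_dsum y z \<in> ?N" using yz by auto
  qed
  have "level_open d n ?N" if n: "n \<ge> 1" for n
    unfolding level_open_iff
  proof
    fix y assume y: "y \<in> ?N \<inter> M_level d n"
    have sz: "pt_size y = n" using y pt_size_M_level d by auto
    have "\<forall>\<^sub>F z in lev_nhd d n y. z \<notin> T" if T: "T \<in> \<V>" for T
    proof -
      obtain g where g: "freely_holomorphic d D g" "\<forall>z\<in>T. g z = 0\<^sub>m (pt_size z) (pt_size z)"
        "g y \<in> carrier_mat n n" "g y \<noteq> 0\<^sub>m n n"
        using witness[OF T, of y] y unfolding sz by blast
      obtain i j where ij: "i < n" "j < n" "g y $$ (i, j) \<noteq> 0" using nonvanishing_entry[OF g(3,4)] by blast
      have "\<forall>\<^sub>F z in lev_nhd d n y. g z $$ (i, j) \<noteq> 0"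
        by (rule tendsto_imp_eventually_ne[OF freely_holomorphic_tendsto[OF g(1) d n _ _ ij(1,2)] ij(3)])
           (use y W in auto)
      then show ?thesis using eventually_lev_nhd_level
      proof eventually_elim
        fix z assume z: "g z $$ (i, j) \<noteq> 0" "z \<in> M_level d n"
        show "z \<notin> T" using g(2) z ij pt_size_M_level[OF z(2) d] by auto
      qed
    qed
    then have "\<forall>\<^sub>F z in lev_nhd d n y. \<forall>T\<in>\<V>. z \<notin> T" using \<V>(1) by (simp add: eventually_ball_finite)
    moreover have "\<forall>\<^sub>F z in lev_nhd d n y. z \<in> W"
      using W(1) y n unfolding free_basic_def level_open_iff by blast
    ultimately show "\<forall>\<^sub>F z in lev_nhd d n y. z \<in> ?N" by eventually_elim auto
  qed
  then have "zariski_basic d ?N" using op nc by (auto simp: zariski_basic_def)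
  then show ?thesis using W x by (intro exI[of _ ?N]) auto
qed

lemma ex_zariski_basic:
  assumes d: "d \<ge> 1" and "openin (zariski_free_topology d) V" "x \<in> V"
  shows "\<exists>N. zariski_basic d N \<and> x \<in> N \<and> N \<subseteq> V"
  using assms(2,3) unfolding zariski_free_topology_def openin_topology_generated_by_iff
proof (induction arbitrary: x)
  case (Int a b)
  have "x \<in> a" "x \<in> b" using Int.prems by auto
  from Int.IH(1)[OF this(1)] Int.IH(2)[OF this(2)]
  obtain M N where "zariski_basic d M" "x \<in> M" "M \<subseteq> a" "zariski_basic d N" "x \<in> N" "N \<subseteq> b" by blast
  then show ?case using zariski_basic_Int[of d M N] by (intro exI[of _ "M \<inter> N"]) auto
next
  case (UN K)
  then obtain k where k: "k \<in> K" "x \<in> k" by blast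
  from UN.IH[OF this] obtain N where "zariski_basic d N" "x \<in> N" "N \<subseteq> k" by blast
  then show ?case using k by (intro exI[of _ N]) auto
next
  case (Basis s)
  then obtain D \<V> where "s = D - \<Union>\<V>" "free_domain d D" "finite \<V>" "\<forall>T\<in>\<V>. free_variety d D T" by blast
  then show ?case using ex_zariski_basic_subbase[OF d, of D \<V> x] Basis.prems by blast
qed auto

lemma zariski_admissible:
  assumes d: "d \<ge> 1"
  shows "nc_admissible_topology d (zariski_free_topology d)"
proof -
  have "topspace (zariski_free_topology d) = M_space d"
  proof
    show "M_space d \<subseteq> topspace (zariski_free_topology d)"
      by (rule openin_subset[OF openin_zariski_free_domain[OF free_domain_M_space[OF d]]])
    show "topspace (zariski_free_topology d) \<subseteq> M_space d"
      unfolding zariski_free_topology_def topology_generated_by_topspace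
      using free_domain_subset_space[OF d] by blast
  qed
  moreover have "\<exists>\<B>'\<subseteq>{N. zariski_basic d N}. V = \<Union>\<B>'" if "openin (zariski_free_topology d) V" for V
  proof -
    have "V = \<Union>{N. zariski_basic d N \<and> N \<subseteq> V}" using ex_zariski_basic[OF d that] by blast
    then show ?thesis by (intro exI[of _ "{N. zariski_basic d N \<and> N \<subseteq> V}"]) auto
  qed
  ultimately show ?thesis
    unfolding nc_admissible_topology_def
    by (intro conjI exI[of _ "{N. zariski_basic d N}"]) (auto simp: zariski_basic_def)
qed

section \<open>The charts\<close>

lemma poly_sum_superset:
  fixes p :: free_poly
  assumes "finite T" "Poly_Mapping.keys p \<subseteq> T"
  shows "(\<Sum>w\<in>Poly_Mapping.keys p. Poly_Mapping.lookup p w * h w) = (\<Sum>w\<in>T. Poly_Mapping.lookup p w * h w)"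
  using assms by (intro sum.mono_neutral_left) (auto simp: in_keys_iff)

lemma ex_free_poly_linear_mult:
  assumes k: "k < d" and p: "p \<in> free_polys d"
  shows "\<exists>q\<in>free_polys d. \<forall>x\<in>M_space d. poly_eval q x = (x ! k - a \<cdot>\<^sub>m 1\<^sub>m (dim_row (x ! k))) * poly_eval p x"
proof -
  let ?K = "Poly_Mapping.keys p" and ?c = "Poly_Mapping.lookup p"
  \<comment> \<open>The coefficients of \<open>x_k * p\<close>: multiplication by the variable
    prepends the letter \<open>k\<close>, so a word not starting with \<open>k\<close> has
    coefficient zero and \<open>k # w'\<close> inherits that of \<open>w'\<close>.\<close>
  define sh where "sh = (\<lambda>w. case w of [] \<Rightarrow> 0 | j # w' \<Rightarrow> if j = k then ?c w' else 0)"
  define h where "h = (\<lambda>w. sh w - a * ?c w)"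
  \<comment> \<open>A common finite set of words for all sums below; the support of the result can
    be smaller because coefficients may cancel.\<close>
  let ?T = "(#) k ` ?K \<union> ?K"
  have sub: "{w. h w \<noteq> 0} \<subseteq> ?T"
  proof
    fix w assume "w \<in> {w. h w \<noteq> 0}"
    then show "w \<in> ?T" by (cases w) (auto simp: h_def sh_def in_keys_iff split: if_splits)
  qed
  have fin: "finite ?T" by simp
  define q where "q = Poly_Mapping.Abs_poly_mapping h"
  have lq: "Poly_Mapping.lookup q = h"
    unfolding q_def by (rule lookup_Abs_poly_mapping) (rule finite_subset[OF sub fin])
  have kq: "Poly_Mapping.keys q \<subseteq> ?T" using sub by (auto simp: in_keys_iff lq)
  have q: "q \<in> free_polys d"
  proof -
    have "?K \<subseteq> lists {..<d}" using p by (simp add: free_polys_def)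
    moreover have "k # w \<in> lists {..<d}" if "w \<in> ?K" for w
      using k subsetD[OF calculation that] by simp
    then have "(#) k ` ?K \<subseteq> lists {..<d}" by (rule image_subsetI)
    ultimately have "Poly_Mapping.keys q \<subseteq> lists {..<d}" using order_trans[OF kq] by (simp only: Un_subset_iff simp_thms)
    then show ?thesis unfolding free_polys_def by simp
  qed
  have "poly_eval q x = (x ! k - a \<cdot>\<^sub>m 1\<^sub>m (dim_row (x ! k))) * poly_eval p x" if "x \<in> M_space d" for x
  proof -
    define n where "n = pt_size x"
    have d: "d \<ge> 1" using k by simp
    have x: "x \<in> M_level d n" using M_space_level[OF that d] by (simp add: n_def)
    note X = M_level_nth[OF x k]
    note pc = poly_eval_carrier[OF x d, of p] and qc = poly_eval_carrier[OF x d, of q]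
    show ?thesis
    proof (rule eq_matI)
      fix i j assume "i < dim_row ((x ! k - a \<cdot>\<^sub>m 1\<^sub>m (dim_row (x ! k))) * poly_eval p x)"
        "j < dim_col ((x ! k - a \<cdot>\<^sub>m 1\<^sub>m (dim_row (x ! k))) * poly_eval p x)"
      then have ij: "i < n" "j < n" using X pc by auto
      let ?e = "\<lambda>w. word_eval x w $$ (i, j)"
      have "poly_eval q x $$ (i, j) = (\<Sum>w\<in>?T. (sh w - a * ?c w) * ?e w)"
        unfolding poly_eval_index[OF x d ij] poly_sum_superset[OF fin kq] by (simp add: lq h_def)
      also have "\<dots> = (\<Sum>w\<in>?T. sh w * ?e w) - a * (\<Sum>w\<in>?T. ?c w * ?e w)"
        by (simp add: left_diff_distrib sum_subtractf sum_distrib_left mult.assoc)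
      also have "(\<Sum>w\<in>?T. ?c w * ?e w) = poly_eval p x $$ (i, j)"
        unfolding poly_eval_index[OF x d ij] by (rule poly_sum_superset[symmetric]) auto
      also have "(\<Sum>w\<in>?T. sh w * ?e w) = (\<Sum>w\<in>(#) k ` ?K. sh w * ?e w)"
        by (rule sum.mono_neutral_right) (auto simp: sh_def in_keys_iff split: list.splits)
      also have "\<dots> = (\<Sum>w\<in>?K. ?c w * ?e (k # w))"
        by (subst sum.reindex) (auto simp: sh_def)
      also have "\<dots> = (\<Sum>w\<in>?K. \<Sum>l<n. x ! k $$ (i, l) * (?c w * word_eval x w $$ (l, j)))"
      proof (intro sum.cong refl)
        fix w assume "w \<in> ?K"
        then have "word_eval x w \<in> carrier_mat n n"
          using p by (intro word_eval_carrier[OF x d]) (auto simp: free_polys_def)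
        then show "?c w * ?e (k # w) = (\<Sum>l<n. x ! k $$ (i, l) * (?c w * word_eval x w $$ (l, j)))"
          using X ij by (simp add: word_eval_Cons scalar_prod_def atLeast0LessThan sum_distrib_left mult_ac)
      qed
      also have "\<dots> = (\<Sum>l<n. x ! k $$ (i, l) * poly_eval p x $$ (l, j))"
        by (subst sum.swap) (auto simp: poly_eval_index[OF x d _ ij(2)] sum_distrib_left intro!: sum.cong)
      finally have "poly_eval q x $$ (i, j) = (\<Sum>l<n. x ! k $$ (i, l) * poly_eval p x $$ (l, j)) - a * poly_eval p x $$ (i, j)" .
      also have "\<dots> = (\<Sum>l<n. (x ! k $$ (i, l) - a * (if i = l then 1 else 0)) * poly_eval p x $$ (l, j))"
      proof -
        let ?P = "\<lambda>l. poly_eval p x $$ (l, j)"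
        have "(\<Sum>l<n. (x ! k $$ (i, l) - a * (if i = l then 1 else 0)) * ?P l) =
            (\<Sum>l<n. x ! k $$ (i, l) * ?P l - (if l = i then a * ?P i else 0))"
          by (intro sum.cong refl) (auto simp: left_diff_distrib)
        also have "\<dots> = (\<Sum>l<n. x ! k $$ (i, l) * ?P l) - (\<Sum>l<n. if l = i then a * ?P i else 0)"
          by (rule sum_subtractf)
        also have "(\<Sum>l<n. if l = i then a * ?P i else 0) = a * ?P i"
          using ij(1) by (subst sum.delta) auto
        finally show ?thesis ..
      qed
      also have "\<dots> = ((x ! k - a \<cdot>\<^sub>m 1\<^sub>m (dim_row (x ! k))) * poly_eval p x) $$ (i, j)"
        using X pc ij by (simp add: scalar_prod_def atLeast0LessThan)
      finally show "poly_eval q x $$ (i, j) = ((x ! k - a \<cdot>\<^sub>m 1\<^sub>m (dim_row (x ! k))) * poly_eval p x) $$ (i, j)" .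
    qed (use X pc qc in auto)
  qed
  then show ?thesis using q by blast
qed

lemma ex_free_poly_root_prod:
  assumes k: "k < d"
  shows "\<exists>p\<in>free_polys d. \<forall>x\<in>M_space d. poly_eval p x = c \<cdot>\<^sub>m root_prod as (x ! k)"
proof (induction as)
  case Nil
  have d: "d \<ge> 1" using k by simp
  let ?p = "Poly_Mapping.single [] c"
  have "?p \<in> free_polys d" by (auto simp: free_polys_def)
  moreover have "poly_eval ?p x = c \<cdot>\<^sub>m root_prod [] (x ! k)" if "x \<in> M_space d" for x
  proof -
    have x: "x \<in> M_level d (pt_size x)" using M_space_level[OF that d] by auto
    show ?thesis
      by (rule eq_matI) (use M_level_nth[OF x k] in \<open>auto simp: poly_eval_def word_eval_Nil poly_sum_superset[of "{[]}"]\<close>)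
  qed
  ultimately show ?case by blast
next
  case (Cons a as)
  then obtain p where p: "p \<in> free_polys d" "\<And>x. x \<in> M_space d \<Longrightarrow> poly_eval p x = c \<cdot>\<^sub>m root_prod as (x ! k)" by blast
  obtain q where q: "q \<in> free_polys d" "\<And>x. x \<in> M_space d \<Longrightarrow>
      poly_eval q x = (x ! k - a \<cdot>\<^sub>m 1\<^sub>m (dim_row (x ! k))) * poly_eval p x"
    using ex_free_poly_linear_mult[OF k p(1)] by blast
  have "poly_eval q x = c \<cdot>\<^sub>m root_prod (a # as) (x ! k)" if x: "x \<in> M_space d" for x
  proof -
    have X: "x ! k \<in> carrier_mat (pt_size x) (pt_size x)"
      using M_space_level[OF x] M_level_nth[of x d "pt_size x" k] k by auto
    show ?thesis using X unfolding q(2)[OF x] p(2)[OF x]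
      using mult_smult_distrib[OF minus_carrier_mat[of "a \<cdot>\<^sub>m 1\<^sub>m (dim_row (x ! k))" "pt_size x" "pt_size x" "x ! k"] root_prod_carrier[OF X], of c as]
      by simp
  qed
  then show ?case using q(1) by blast
qed

lemma free_domain_root_prod:
  assumes k: "k < d" and e: "e > 0"
  shows "free_domain d {x \<in> M_space d. op_norm (root_prod as (x ! k)) < e}"
proof -
  have d: "d \<ge> 1" using k by simp
  let ?c = "complex_of_real (1 / e)"
  obtain p where p: "p \<in> free_polys d" "\<And>x. x \<in> M_space d \<Longrightarrow> poly_eval p x = ?c \<cdot>\<^sub>m root_prod as (x ! k)"
    using ex_free_poly_root_prod[OF k, of ?c as] by blast
  let ?\<delta> = "mat 1 1 (\<lambda>_. p)"
  \<comment> \<open>\<open>op_norm_smult\<close> is an inequality; applied to \<open>?c\<close> and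
    to its reciprocal \<open>e\<close> it gives the two directions.\<close>
  have iff: "op_norm (?c \<cdot>\<^sub>m A) < 1 \<longleftrightarrow> op_norm A < e" for A
  proof -
    have 1: "op_norm (?c \<cdot>\<^sub>m A) \<le> op_norm A / e" using op_norm_smult[of ?c A] e by (simp add: norm_divide)
    have "A = complex_of_real e \<cdot>\<^sub>m (?c \<cdot>\<^sub>m A)" using e by (intro eq_matI) auto
    then have 2: "op_norm A \<le> e * op_norm (?c \<cdot>\<^sub>m A)"
      using op_norm_smult[of "complex_of_real e" "?c \<cdot>\<^sub>m A"] e by simp
    show ?thesis
    proof
      assume "op_norm (?c \<cdot>\<^sub>m A) < 1"
      then have "e * op_norm (?c \<cdot>\<^sub>m A) < e * 1" using e by (intro mult_strict_left_mono)
      then show "op_norm A < e" using 2 by linarith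
    next
      assume "op_norm A < e"
      then have "op_norm A / e < 1" using e by simp
      then show "op_norm (?c \<cdot>\<^sub>m A) < 1" using 1 by linarith
    qed
  qed
  have eval: "poly_mat_eval ?\<delta> x = poly_eval p x" for x
    by (rule eq_matI) (auto simp: poly_mat_eval_def Let_def poly_eval_def)
  have "op_norm (poly_mat_eval ?\<delta> x) < 1 \<longleftrightarrow> op_norm (root_prod as (x ! k)) < e" if "x \<in> M_space d" for x
    using iff[of "root_prod as (x ! k)"] unfolding eval p(2)[OF that] .
  then have "B_free d ?\<delta> = {x \<in> M_space d. op_norm (root_prod as (x ! k)) < e}"
    unfolding B_free_def by blast
  moreover have "free_basic d (B_free d ?\<delta>)"
      proof (rule free_basic_B_free[OF d], rule subsetI)
    fix q assume "q \<in> elements_mat ?\<delta>"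
    then show "q \<in> free_polys d" using elements_matD[of q ?\<delta>] p(1) by auto
  qed
  ultimately show ?thesis by (simp add: free_basic_def)
qed

section \<open>Separated discs and their locally constant functions\<close>

definition separated_discs :: "(complex set \<Rightarrow> real) \<Rightarrow> complex set \<Rightarrow> bool" where
  "separated_discs r \<gamma> \<longleftrightarrow> finite \<gamma> \<and> r \<gamma> > 0 \<and> (\<forall>c\<in>\<gamma>. \<forall>c'\<in>\<gamma>. c \<noteq> c' \<longrightarrow> 4 * r \<gamma> < cmod (c - c'))"

lemma \<Delta>_set_balls: "\<Delta>_set r \<gamma> = (\<Union>c\<in>\<gamma>. ball c (r \<gamma>))"
  by (auto simp: \<Delta>_set_def dist_norm norm_minus_commute)

lemma open_\<Delta>_set: "open (\<Delta>_set r \<gamma>)"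
  unfolding \<Delta>_set_balls by auto

lemma separated_discs_disjoint:
  assumes "separated_discs r \<gamma>" "c \<in> \<gamma>" "c' \<in> \<gamma>" "c \<noteq> c'"
  shows "ball c (r \<gamma>) \<inter> ball c' (r \<gamma>) = {}"
proof (rule ccontr)
  assume "\<not> ?thesis"
  then obtain z where z: "dist c z < r \<gamma>" "dist c' z < r \<gamma>" by auto
  have "dist c c' < 2 * r \<gamma>" using z dist_triangle[of c c' z] by (simp add: dist_commute)
  then show False using assms by (fastforce simp: separated_discs_def dist_norm)
qed

lemma iota_eq:
  assumes sep: "separated_discs r \<gamma>" and c: "c \<in> \<gamma>" "z \<in> ball c (r \<gamma>)"
  shows "iota r \<gamma> t z = t c"
proof -
  have "(THE c. c \<in> \<gamma> \<and> cmod (z - c) < r \<gamma>) = c"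
  proof (rule the_equality)
    show "c \<in> \<gamma> \<and> cmod (z - c) < r \<gamma>" using c by (auto simp: dist_norm norm_minus_commute)
    fix c' assume "c' \<in> \<gamma> \<and> cmod (z - c') < r \<gamma>"
    then have "c' \<in> \<gamma>" "z \<in> ball c' (r \<gamma>)" by (auto simp: dist_norm norm_minus_commute)
    then show "c' = c" using separated_discs_disjoint[OF sep c(1), of c'] c(2) by blast
  qed
  then show ?thesis by (simp add: iota_def)
qed

lemma iota_holomorphic:
  assumes sep: "separated_discs r \<gamma>"
  shows "iota r \<gamma> t holomorphic_on \<Delta>_set r \<gamma>"
  unfolding \<Delta>_set_balls
proof (rule holomorphic_on_UN_open)
  fix c assume c: "c \<in> \<gamma>"
  show "iota r \<gamma> t holomorphic_on ball c (r \<gamma>)"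
    by (rule holomorphic_transform[OF holomorphic_on_const[of "t c"]]) (simp add: iota_eq[OF sep c])
qed auto

lemma iota_analytic:
  "separated_discs r \<gamma> \<Longrightarrow> S \<subseteq> \<Delta>_set r \<gamma> \<Longrightarrow> iota r \<gamma> t analytic_on S"
  using iota_holomorphic[of r \<gamma> t] analytic_on_open[OF open_\<Delta>_set] analytic_on_subset by blast

lemma iota_signs:
  assumes "separated_discs r \<gamma>" "t \<in> signs \<gamma>" "z \<in> \<Delta>_set r \<gamma>"
  shows "iota r \<gamma> t z \<in> {-1, 1}"
proof -
  obtain c where "c \<in> \<gamma>" "z \<in> ball c (r \<gamma>)" using assms(3) by (auto simp: \<Delta>_set_balls)
  then show ?thesis using iota_eq[OF assms(1)] assms(2) by (auto simp: signs_def PiE_iff)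
qed

text \<open>A finite subset of open discs stays away from their boundaries, which leaves room for a
  contour between the spectrum and the boundary of each disc.\<close>

lemma finite_shrink_balls:
  assumes "finite (S :: complex set)" "S \<subseteq> (\<Union>c\<in>C. ball c R)" "R > 0"
  shows "\<exists>\<rho>. 0 < \<rho> \<and> \<rho> < R \<and> S \<subseteq> (\<Union>c\<in>C. ball c \<rho>)"
  using assms(1,2)
proof (induction S rule: finite_induct)
  case empty
  then show ?case using assms(3) by (intro exI[of _ "R / 2"]) auto
next
  case (insert a S)
  then obtain \<rho> where \<rho>: "0 < \<rho>" "\<rho> < R" "S \<subseteq> (\<Union>c\<in>C. ball c \<rho>)" by blast
  obtain c where c: "c \<in> C" "dist c a < R" using insert.prems by auto
  define \<rho>' where "\<rho>' = max \<rho> ((dist c a + R) / 2)"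
  have "a \<in> ball c \<rho>'" using c(2) by (simp add: \<rho>'_def less_max_iff_disj)
  then have "a \<in> (\<Union>c\<in>C. ball c \<rho>')" using c(1) by (rule UN_I[rotated])
  moreover have "(\<Union>c\<in>C. ball c \<rho>) \<subseteq> (\<Union>c\<in>C. ball c \<rho>')"
    by (intro UN_mono subset_ball order_refl) (simp add: \<rho>'_def)
  ultimately have sub: "insert a S \<subseteq> (\<Union>c\<in>C. ball c \<rho>')"
    using order_trans[OF \<rho>(3)] by (simp only: insert_subset simp_thms)
  have "0 < \<rho>'" "\<rho>' < R" using \<rho>(1,2) c(2) by (auto simp: \<rho>'_def less_max_iff_disj)
  with sub show ?case by blast
qed

lemma root_poly_lower_bound:
  assumes "\<And>a. a \<in> set as \<Longrightarrow> \<eta> \<le> cmod (z - a)" "\<eta> \<ge> 0"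
  shows "\<eta> ^ length as \<le> cmod (root_poly as z)"
  using assms(1)
proof (induction as)
  case (Cons a as)
  have "\<eta> * \<eta> ^ length as \<le> cmod (z - a) * cmod (root_poly as z)"
    by (rule mult_mono) (use Cons assms(2) in auto)
  then show ?case by (simp add: norm_mult)
qed simp

text \<open>The spectral mapping property: an eigenvector of \<open>y\<close> for \<open>z\<close>
  is one of \<open>p(y)\<close> for \<open>p(z)\<close>, and no eigenvalue exceeds the norm.\<close>

lemma spectrum_root_poly_bound:
  assumes y: "y \<in> carrier_mat m m" and z: "z \<in> spectrum y"
  shows "cmod (root_poly as z) \<le> op_norm (root_prod as y)"
proof -
  obtain v where ev: "eigenvector y v z" using z by (auto simp: spectrum_def eigenvalue_def)
  then have v: "v \<in> carrier_vec m" "v \<noteq> 0\<^sub>v m" "y *\<^sub>v v = z \<cdot>\<^sub>v v"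
    using y unfolding eigenvector_def by auto
  have "vec_norm2 v \<noteq> 0" using vec_norm2_eq_0[of v] v(1,2) by auto
  then have pos: "vec_norm2 v > 0" by (simp add: less_le)
  have "v \<in> carrier_vec (dim_col (root_prod as y))" using v(1) carrier_matD(2)[OF root_prod_carrier[OF y]] by simp
  from op_norm_mult_vec[OF this]
  have "cmod (root_poly as z) * vec_norm2 v \<le> op_norm (root_prod as y) * vec_norm2 v"
    by (simp add: root_prod_eigenvector[OF y v(1,3)] vec_norm2_smult)
  then show ?thesis using pos by simp
qed

text \<open>With \<open>p\<close> vanishing at \<open>x\<^sub>0\<close>, the condition that \<open>p(y)\<close> has norm less than \<open>e\<close> keeps the
  spectrum of \<open>y\<close> in the discs and the resolvent of \<open>y\<close> bounded on their slightly smaller circles,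
  for \<open>y\<close> of any size.\<close>

lemma ex_polynomial_nbhd:
  assumes sep: "separated_discs r \<gamma>" and x0: "x0 \<in> D_set r \<gamma>" and M: "M \<ge> 0"
  obtains as e \<rho> L where "e > 0" "0 < \<rho>" "\<rho> < r \<gamma>" "L \<ge> 0" "op_norm (root_prod as x0) < e"
    "\<And>m y. y \<in> carrier_mat m m \<Longrightarrow> op_norm (root_prod as y) < e \<Longrightarrow> spectrum y \<subseteq> (\<Union>c\<in>\<gamma>. ball c \<rho>)"
    "\<And>m y c z v. y \<in> carrier_mat m m \<Longrightarrow> op_norm (root_prod as y) < e \<Longrightarrow> op_norm y < M \<Longrightarrow>
       c \<in> \<gamma> \<Longrightarrow> cmod (z - c) = \<rho> \<Longrightarrow> v \<in> carrier_vec m \<Longrightarrow>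
       vec_norm2 v \<le> L * vec_norm2 ((z \<cdot>\<^sub>m 1\<^sub>m m - y) *\<^sub>v v)"
proof -
  obtain n where n: "x0 \<in> carrier_mat n n" "spectrum x0 \<subseteq> \<Delta>_set r \<gamma>" using x0 by (auto simp: D_set_def)
  have r: "r \<gamma> > 0" and fin: "finite \<gamma>" using sep by (auto simp: separated_discs_def)
  obtain as where as: "set as \<subseteq> spectrum x0" "root_prod as x0 = 0\<^sub>m n n"
    using ex_annihilating_roots[OF n(1)] by blast
  obtain \<rho>0 where \<rho>0: "0 < \<rho>0" "\<rho>0 < r \<gamma>" "spectrum x0 \<subseteq> (\<Union>c\<in>\<gamma>. ball c \<rho>0)"
    using finite_shrink_balls[OF spectrum_finite[OF n(1)] n(2)[unfolded \<Delta>_set_balls] r] by blast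
  \<comment> \<open>The contour radius lies halfway between \<open>\<rho>0\<close>, whose discs
    contain the spectrum of \<open>x0\<close>, and \<open>r \<gamma>\<close>. The gap
    \<open>\<eta>\<close> is the least distance of a root of \<open>p\<close> from the points
    outside the discs of radius \<open>\<rho>\<close> that the triangle inequality
    guarantees.\<close>
  define \<rho> where "\<rho> = (\<rho>0 + r \<gamma>) / 2"
  define \<eta> where "\<eta> = \<rho> - \<rho>0"
  have \<rho>: "0 < \<rho>" "\<rho> < r \<gamma>" "\<eta> > 0" using \<rho>0 by (auto simp: \<rho>_def \<eta>_def)
  \<comment> \<open>Off the discs \<open>\<eta> ^ length as\<close> is a lower bound of the
    polynomial. Half of it already excludes eigenvalues there; the other half is the margin that
    bounds the resolvent.\<close>
  define e where "e = \<eta> ^ length as / 2"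
  have e: "e > 0" using \<rho> by (simp add: e_def)
  have far: "2 * e \<le> cmod (root_poly as z)" if z: "z \<notin> (\<Union>c\<in>\<gamma>. ball c \<rho>)" for z
  proof -
    have "\<eta> \<le> cmod (z - a)" if a: "a \<in> spectrum x0" for a
    proof (rule ccontr)
      assume "\<not> \<eta> \<le> cmod (z - a)"
      then have "dist a z < \<rho> - \<rho>0" by (simp add: \<eta>_def dist_norm norm_minus_commute)
      moreover obtain c where c: "c \<in> \<gamma>" "dist c a < \<rho>0" using \<rho>0(3) a by auto
      ultimately have "dist c z < \<rho>" using dist_triangle[of c z a] by simp
      then show False using z c by auto
    qed
    then have "\<eta> ^ length as \<le> cmod (root_poly as z)"
      using as(1) \<rho>(3) by (intro root_poly_lower_bound) auto
    then show ?thesis by (simp add: e_def)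
  qed
  \<comment> \<open>A common bound for the modulus on all circles; the sum over
    \<open>\<gamma>\<close> stands in for the maximum of \<open>cmod c\<close>.\<close>
  define R where "R = (\<Sum>c\<in>\<gamma>. cmod c) + r \<gamma>"
  have R: "R \<ge> 0" using r by (simp add: R_def sum_nonneg)
  obtain K where K: "K \<ge> 0" "\<And>m y z v. y \<in> carrier_mat m m \<Longrightarrow> op_norm y \<le> M \<Longrightarrow> cmod z \<le> R \<Longrightarrow> v \<in> carrier_vec m \<Longrightarrow>
     vec_norm2 (root_prod as y *\<^sub>v v - root_poly as z \<cdot>\<^sub>v v) \<le> K * vec_norm2 ((z \<cdot>\<^sub>m 1\<^sub>m m - y) *\<^sub>v v)"
    using root_prod_difference_bound[OF M R, of as] by blast
  have pn: "vec_norm2 (root_prod as y *\<^sub>v v) \<le> e * vec_norm2 v"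
    if "y \<in> carrier_mat m m" "op_norm (root_prod as y) < e" "v \<in> carrier_vec m" for m y v
    using op_norm_mult_vec[of v "root_prod as y"] that carrier_matD[OF root_prod_carrier[OF that(1), of as]]
      mult_right_mono[of "op_norm (root_prod as y)" e "vec_norm2 v"] by simp
  show ?thesis
  proof (rule that)
    show "e > 0" by (rule e)
    show "0 < \<rho>" by (rule \<rho>(1))
    show "\<rho> < r \<gamma>" by (rule \<rho>(2))
    show "K / e \<ge> 0" using K e by simp
    have "op_norm (0\<^sub>m n n) \<le> 0" by (rule order_trans[OF op_norm_le_sum]) simp
    then show "op_norm (root_prod as x0) < e" using as(2) e by simp
  next
    fix m and y :: "complex mat" assume y: "y \<in> carrier_mat m m" "op_norm (root_prod as y) < e"
    show "spectrum y \<subseteq> (\<Union>c\<in>\<gamma>. ball c \<rho>)"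
    proof (rule subsetI, rule ccontr)
      fix z assume z: "z \<in> spectrum y" "z \<notin> (\<Union>c\<in>\<gamma>. ball c \<rho>)"
      show False using far[OF z(2)] spectrum_root_poly_bound[OF y(1) z(1), of as] y(2) e by linarith
    qed
  next
    fix m y c z and v :: "complex vec"
    assume y: "y \<in> carrier_mat m m" "op_norm (root_prod as y) < e" "op_norm y < M"
      and c: "c \<in> \<gamma>" "cmod (z - c) = \<rho>" and v: "v \<in> carrier_vec m"
    have "z \<in> ball c (r \<gamma>)" using c \<rho> by (simp add: dist_norm norm_minus_commute)
    have "z \<notin> (\<Union>c\<in>\<gamma>. ball c \<rho>)"
    proof
      assume "z \<in> (\<Union>c\<in>\<gamma>. ball c \<rho>)"
      then obtain c' where c': "c' \<in> \<gamma>" "z \<in> ball c' \<rho>" by blast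
      have "c' \<noteq> c" using c' c by (auto simp: dist_norm norm_minus_commute)
      moreover have "z \<in> ball c' (r \<gamma>)" using c' \<rho> by simp
      ultimately show False
        using separated_discs_disjoint[OF sep c'(1) c(1)] \<open>z \<in> ball c (r \<gamma>)\<close> by (metis disjoint_iff)
    qed
    then have p: "2 * e \<le> cmod (root_poly as z)" by (rule far)
    have "cmod z \<le> cmod c + cmod (z - c)" using norm_triangle_ineq[of c "z - c"] by simp
    also have "\<dots> \<le> R" using c \<rho> member_le_sum[OF c(1), of cmod] fin by (simp add: R_def)
    finally have zR: "cmod z \<le> R" .
    let ?P = "root_prod as y *\<^sub>v v" let ?q = "root_poly as z \<cdot>\<^sub>v v"
    have Pc: "?P \<in> carrier_vec m" using root_prod_carrier[OF y(1), of as] by (auto intro!: carrier_vecI)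
    \<comment> \<open>Comparing \<open>p(z) v\<close> with \<open>p(y) v\<close> gives
      \<open>2 e |v| \<le> |p(z) v| \<le> e |v| + K |(z - y) v|\<close>, hence
      \<open>e |v| \<le> K |(z - y) v|\<close>. This is the origin of the constant
      \<open>K / e\<close>.\<close>
    have "?q = ?P - (?P - ?q)" using Pc v by (intro eq_vecI) auto
    then have "vec_norm2 ?q \<le> vec_norm2 ?P + vec_norm2 (?P - ?q)"
      using vec_norm2_triangle_minus[of ?P m "?P - ?q"] Pc v by simp
    also have "vec_norm2 (?P - ?q) \<le> K * vec_norm2 ((z \<cdot>\<^sub>m 1\<^sub>m m - y) *\<^sub>v v)"
      by (rule K(2)[OF y(1) _ zR v]) (use y in simp)
    also have "vec_norm2 ?P \<le> e * vec_norm2 v" by (rule pn[OF y(1,2) v])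
    finally have "cmod (root_poly as z) * vec_norm2 v \<le> e * vec_norm2 v + K * vec_norm2 ((z \<cdot>\<^sub>m 1\<^sub>m m - y) *\<^sub>v v)"
      by (simp add: vec_norm2_smult)
    moreover have "2 * e * vec_norm2 v \<le> cmod (root_poly as z) * vec_norm2 v" by (rule mult_right_mono[OF p]) simp
    ultimately have "e * vec_norm2 v \<le> K * vec_norm2 ((z \<cdot>\<^sub>m 1\<^sub>m m - y) *\<^sub>v v)" by simp
    then show "vec_norm2 v \<le> K / e * vec_norm2 ((z \<cdot>\<^sub>m 1\<^sub>m m - y) *\<^sub>v v)" using e by (simp add: field_simps)
  qed
qed

section \<open>Openness of the chart domains\<close>

text \<open>The chart domain before the commutator conditions: the free domain from which the
  varieties are removed.\<close>

definition chart_base :: "(complex set \<Rightarrow> real) \<Rightarrow> complex set \<Rightarrow> nc_point set" where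
  "chart_base r \<gamma> = {p \<in> M_space 2. p ! 1 \<in> D_set r \<gamma>}"

definition commutator_map :: "(complex set \<Rightarrow> real) \<Rightarrow> complex set \<Rightarrow> (complex \<Rightarrow> complex) \<Rightarrow> nc_point \<Rightarrow> complex mat" where
  "commutator_map r \<gamma> t p = p ! 0 * I_map r \<gamma> t (p ! 1) - I_map r \<gamma> t (p ! 1) * p ! 0"

lemma level_2: "p \<in> M_level 2 n \<Longrightarrow> p ! 0 \<in> carrier_mat n n \<and> p ! 1 \<in> carrier_mat n n"
  using M_level_nth[of p 2 n] by simp

lemma space_2_eta: "p \<in> M_space 2 \<Longrightarrow> p = [p ! 0, p ! 1]"
  unfolding M_space_def M_level_def by (cases p; cases "tl p") auto

lemma space_2_level: "p \<in> M_space 2 \<Longrightarrow> \<exists>n\<ge>1. p \<in> M_level 2 n"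
  by (auto simp: M_space_def)

lemma chart_base_iff:
  assumes "p \<in> M_level 2 n" "n \<ge> 1"
  shows "p \<in> chart_base r \<gamma> \<longleftrightarrow> spectrum (p ! 1) \<subseteq> \<Delta>_set r \<gamma>"
  using assms level_2[OF assms(1)] M_level_space[OF assms] by (auto simp: chart_base_def D_set_def)

text \<open>Norm bounds on \<open>u\<close> and \<open>x\<close> themselves thereby become instances
  of \<open>free_domain_root_prod\<close>.\<close>

lemma root_prod_zero: "x \<in> carrier_mat n n \<Longrightarrow> root_prod [0] x = x"
proof -
  assume x: "x \<in> carrier_mat n n"
  then have "x - 0 \<cdot>\<^sub>m 1\<^sub>m n = x" by (intro eq_matI) auto
  then show ?thesis using x by simp
qed

lemma ex_bounded_nbhd:
  assumes sep: "separated_discs r \<gamma>" and p0: "p0 \<in> chart_base r \<gamma>"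
  shows "\<exists>V B. free_domain 2 V \<and> p0 \<in> V \<and> V \<subseteq> chart_base r \<gamma> \<and>
    (\<forall>p\<in>V. op_norm (p ! 0) \<le> B \<and> (\<forall>t\<in>signs \<gamma>. op_norm (I_map r \<gamma> t (p ! 1)) \<le> B))"
proof -
  obtain n where n: "n \<ge> 1" "p0 \<in> M_level 2 n" using p0 space_2_level by (auto simp: chart_base_def)
  note l0 = level_2[OF n(2)]
  define M where "M = max (op_norm (p0 ! 0)) (op_norm (p0 ! 1)) + 1"
  have M: "M > 0" "op_norm (p0 ! 0) < M" "op_norm (p0 ! 1) < M"
    using op_norm_nonneg[of "p0 ! 0"] unfolding M_def by linarith+
  have x0: "p0 ! 1 \<in> D_set r \<gamma>" using p0 by (simp add: chart_base_def)
  obtain as e \<rho> L where e: "e > 0" "0 < \<rho>" "\<rho> < r \<gamma>" "L \<ge> 0" "op_norm (root_prod as (p0 ! 1)) < e"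
    and sp: "\<And>m y. y \<in> carrier_mat m m \<Longrightarrow> op_norm (root_prod as y) < e \<Longrightarrow> spectrum y \<subseteq> (\<Union>c\<in>\<gamma>. ball c \<rho>)"
    and L: "\<And>m y c z v. y \<in> carrier_mat m m \<Longrightarrow> op_norm (root_prod as y) < e \<Longrightarrow> op_norm y < M \<Longrightarrow>
       c \<in> \<gamma> \<Longrightarrow> cmod (z - c) = \<rho> \<Longrightarrow> v \<in> carrier_vec m \<Longrightarrow>
       vec_norm2 v \<le> L * vec_norm2 ((z \<cdot>\<^sub>m 1\<^sub>m m - y) *\<^sub>v v)"
  proof (rule ex_polynomial_nbhd[OF sep x0 less_imp_le[OF M(1)]], goal_cases)
    case (1 as e \<rho> L)
    from 1(1)[OF 1(2-8)] show ?case .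
  qed
  \<comment> \<open>The first condition controls the spectrum and the resolvent of \<open>x\<close>,
    the second gives the bound on \<open>x\<close> under which the resolvent constant
    \<open>L\<close> is valid, and the third bounds \<open>u\<close>.\<close>
  define V where "V = {p \<in> M_space 2. op_norm (root_prod as (p ! 1)) < e} \<inter>
    {p \<in> M_space 2. op_norm (root_prod [0] (p ! 1)) < M} \<inter> {p \<in> M_space 2. op_norm (root_prod [0] (p ! 0)) < M}"
  \<comment> \<open>The functions \<open>iota\<close> have modulus 1 on the circles, so the contour
    estimate gives \<open>card \<gamma> * \<rho> * 1 * L\<close> for every choice of signs.\<close>
  define B where "B = max M (real (card \<gamma>) * (\<rho> * 1 * L))"
  have V: "free_domain 2 V" unfolding V_def using e(1) M(1) by (intro free_domain_Int free_domain_root_prod) auto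
  have "p0 \<in> V" using p0 e(5) M root_prod_zero l0 by (auto simp: V_def chart_base_def simp del: root_prod_Cons)
  moreover have all: "p \<in> chart_base r \<gamma> \<and> op_norm (p ! 0) \<le> B \<and> (\<forall>t\<in>signs \<gamma>. op_norm (I_map r \<gamma> t (p ! 1)) \<le> B)"
    if p: "p \<in> V" for p
  proof -
    have "p \<in> M_space 2" using p by (simp add: V_def)
    then obtain m where m: "m \<ge> 1" "p \<in> M_level 2 m" using space_2_level by blast
    note l = level_2[OF m(2)]
    have P: "op_norm (root_prod as (p ! 1)) < e" "op_norm (p ! 1) < M" "op_norm (p ! 0) < M"
      using p l root_prod_zero by (auto simp: V_def simp del: root_prod_Cons)
    have X: "p ! 1 \<in> carrier_mat m m" using l by blast
    note spX = sp[OF X P(1)]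
    have discs: "(\<Union>c\<in>\<gamma>. ball c \<rho>) \<subseteq> \<Delta>_set r \<gamma>"
      unfolding \<Delta>_set_balls by (intro UN_mono subset_ball order_refl) (use e in simp)
    have base: "p \<in> chart_base r \<gamma>"
      unfolding chart_base_iff[OF m(2,1)] by (rule order_trans[OF spX discs])
    have "op_norm (I_map r \<gamma> t (p ! 1)) \<le> real (card \<gamma>) * (\<rho> * 1 * L)" if t: "t \<in> signs \<gamma>" for t
      unfolding I_map_def
    proof (rule hol_calc_op_norm_bound[OF X _ e(2,3)])
      show "finite \<gamma>" using sep by (simp add: separated_discs_def)
      show "iota r \<gamma> t holomorphic_on (\<Union>c\<in>\<gamma>. ball c (r \<gamma>))"
        using iota_holomorphic[OF sep] by (simp add: \<Delta>_set_balls)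
      show "spectrum (p ! 1) \<subseteq> (\<Union>c\<in>\<gamma>. ball c \<rho>)" by (rule spX)
      show "ball c (r \<gamma>) \<inter> ball c' (r \<gamma>) = {}" if "c \<in> \<gamma>" "c' \<in> \<gamma>" "c \<noteq> c'" for c c'
        by (rule separated_discs_disjoint[OF sep that])
      show "cmod (iota r \<gamma> t z) \<le> 1" if "c \<in> \<gamma>" "cmod (z - c) = \<rho>" for c z
      proof -
        have "z \<in> \<Delta>_set r \<gamma>" using that e(3) by (auto simp: \<Delta>_set_def)
        from iota_signs[OF sep t this] show ?thesis by auto
      qed
      show "vec_norm2 v \<le> L * vec_norm2 ((z \<cdot>\<^sub>m 1\<^sub>m m - p ! 1) *\<^sub>v v)"
        if "c \<in> \<gamma>" "cmod (z - c) = \<rho>" "v \<in> carrier_vec m" for c z v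
        by (rule L[OF X P(1,2) that])
    qed (simp_all add: e(4))
    then have "\<forall>t\<in>signs \<gamma>. op_norm (I_map r \<gamma> t (p ! 1)) \<le> B"
      unfolding B_def by (intro ballI max.coboundedI2)
    moreover have "op_norm (p ! 0) \<le> B" using P(3) by (simp add: B_def)
    ultimately show ?thesis using base by (intro conjI)
  qed
  moreover have "V \<subseteq> chart_base r \<gamma>" using all by (intro subsetI) simp
  ultimately show ?thesis using V by (intro exI[of _ V] exI[of _ B] conjI ballI) simp_all
qed

lemma free_domain_chart_base:
  assumes "separated_discs r \<gamma>"
  shows "free_domain 2 (chart_base r \<gamma>)"
  unfolding free_domain_def
proof (subst openin_subopen, intro ballI)
  fix p assume "p \<in> chart_base r \<gamma>"
  from ex_bounded_nbhd[OF assms this]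
  show "\<exists>T. openin (free_topology 2) T \<and> p \<in> T \<and> T \<subseteq> chart_base r \<gamma>"
    unfolding free_domain_def by blast
qed

lemma nc_set_chart_base: "nc_set 2 (chart_base r \<gamma>)"
  unfolding nc_set_def
proof (intro conjI ballI)
  show "chart_base r \<gamma> \<subseteq> M_space 2" by (auto simp: chart_base_def)
  fix p q assume p: "p \<in> chart_base r \<gamma>" and q: "q \<in> chart_base r \<gamma>"
  obtain n m where n: "n \<ge> 1" "p \<in> M_level 2 n" and m: "m \<ge> 1" "q \<in> M_level 2 m"
    using p q space_2_level by (auto simp: chart_base_def) blast
  show "pt_dsum p q \<in> chart_base r \<gamma>"
    using p q n m level_2[OF n(2)] level_2[OF m(2)] chart_base_iff[OF pt_dsum_level[OF n(2) m(2)]]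
      chart_base_iff[OF n(2,1)] chart_base_iff[OF m(2,1)] spectrum_dsum[of "p ! 1" n "q ! 1" m]
    by (simp add: pt_dsum_nth[OF n(2) m(2)])
qed

lemma I_map_carrier: "x \<in> carrier_mat n n \<Longrightarrow> I_map r \<gamma> t x \<in> carrier_mat n n"
  by (auto simp: I_map_def)

lemma commutator_map_carrier: "p \<in> M_level 2 n \<Longrightarrow> commutator_map r \<gamma> t p \<in> carrier_mat n n"
  using level_2[of p n] I_map_carrier[of "p ! 1" n r \<gamma> t] unfolding commutator_map_def by (intro minus_carrier_mat) auto

lemma commutator_map_dsum:
  assumes sep: "separated_discs r \<gamma>" and p: "p \<in> chart_base r \<gamma>" "p \<in> M_level 2 n"
    and q: "q \<in> chart_base r \<gamma>" "q \<in> M_level 2 m" and nm: "n \<ge> 1" "m \<ge> 1"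
  shows "commutator_map r \<gamma> t (pt_dsum p q) = mat_dsum (commutator_map r \<gamma> t p) (commutator_map r \<gamma> t q)"
proof -
  note P = level_2[OF p(2)] and Q = level_2[OF q(2)]
  have "spectrum (p ! 1) \<union> spectrum (q ! 1) \<subseteq> \<Delta>_set r \<gamma>"
    using p q chart_base_iff[OF p(2) nm(1)] chart_base_iff[OF q(2) nm(2)] by auto
  then have I: "I_map r \<gamma> t (mat_dsum (p ! 1) (q ! 1)) = mat_dsum (I_map r \<gamma> t (p ! 1)) (I_map r \<gamma> t (q ! 1))"
    unfolding I_map_def using P Q by (intro hol_calc_dsum iota_analytic[OF sep]) auto
  have Ip: "I_map r \<gamma> t (p ! 1) \<in> carrier_mat n n" and Iq: "I_map r \<gamma> t (q ! 1) \<in> carrier_mat m m"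
    using P Q I_map_carrier by blast+
  have pq0: "pt_dsum p q ! 0 = mat_dsum (p ! 0) (q ! 0)" and pq1: "pt_dsum p q ! 1 = mat_dsum (p ! 1) (q ! 1)"
    using pt_dsum_nth[OF p(2) q(2)] by auto
  have P0: "p ! 0 \<in> carrier_mat n n" and Q0: "q ! 0 \<in> carrier_mat m m" using P Q by blast+
  show ?thesis
    unfolding commutator_map_def pq0 pq1 I mat_dsum_mult[OF P0 Q0 Ip Iq] mat_dsum_mult[OF Ip Iq P0 Q0]
    by (rule mat_dsum_minus[OF mult_carrier_mat[OF P0 Ip] mult_carrier_mat[OF Q0 Iq]
      mult_carrier_mat[OF Ip P0] mult_carrier_mat[OF Iq Q0]])
qed

lemma commutator_map_conj:
  assumes sep: "separated_discs r \<gamma>" and p: "p \<in> chart_base r \<gamma>" "p \<in> M_level 2 n" "n \<ge> 1"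
    and s: "s \<in> carrier_mat n n" "invertible_mat s"
  shows "commutator_map r \<gamma> t (pt_conj s p) = mat_inv' s * commutator_map r \<gamma> t p * s"
proof -
  note P = level_2[OF p(2)] and si = mat_inv'[OF s]
  let ?u = "p ! 0" and ?x = "p ! 1" and ?i = "mat_inv' s" and ?I = "I_map r \<gamma> t (p ! 1)"
  have I: "I_map r \<gamma> t (?i * ?x * s) = ?i * ?I * s"
    unfolding I_map_def using P p s si chart_base_iff[OF p(2,3)]
    by (intro hol_calc_similar[of _ n] iota_analytic[OF sep]) auto
  have u: "?u \<in> carrier_mat n n" and Ic: "?I \<in> carrier_mat n n" using P I_map_carrier by blast+
  have len: "length p = 2" using p(2) by (simp add: M_level_def)
  have "commutator_map r \<gamma> t (pt_conj s p) = (?i * ?u * s) * (?i * ?I * s) - (?i * ?I * s) * (?i * ?u * s)"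
  proof -
    have "pt_conj s p ! 0 = ?i * ?u * s" "pt_conj s p ! 1 = ?i * ?x * s"
      by (rule pt_conj_nth, simp add: len)+
    then show ?thesis unfolding commutator_map_def by (simp only: I)
  qed
  also have "\<dots> = ?i * (?u * ?I) * s - ?i * (?I * ?u) * s"
    unfolding similar_mult[OF u Ic si(1) s(1) si(3)] similar_mult[OF Ic u si(1) s(1) si(3)] ..
  also have "\<dots> = (?i * (?u * ?I) - ?i * (?I * ?u)) * s"
    using u Ic si s by (intro minus_mult_distrib_mat[symmetric]) auto
  also have "?i * (?u * ?I) - ?i * (?I * ?u) = ?i * commutator_map r \<gamma> t p"
    unfolding commutator_map_def using u Ic si s by (intro mult_minus_distrib_mat[symmetric]) auto
  finally show ?thesis .
qed

text \<open>The nc-identities hold on all of \<open>chart_base\<close>, so only boundedness is a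
  local matter: where both factors have norm at most \<open>B\<close>, their commutator has norm at
  most \<open>B * B + B * B\<close>.\<close>

lemma freely_holomorphic_commutator_map:
  assumes sep: "separated_discs r \<gamma>" and t: "t \<in> signs \<gamma>"
  shows "freely_holomorphic 2 (chart_base r \<gamma>) (commutator_map r \<gamma> t)"
proof -
  let ?D = "chart_base r \<gamma>" and ?g = "commutator_map r \<gamma> t"
  have gr: "graded 2 ?D ?g" unfolding graded_def using commutator_map_carrier by blast
  have "nc_function 2 ?D ?g"
    unfolding nc_function_def
  proof (intro conjI ballI allI impI)
    fix p q assume p: "p \<in> ?D" and q: "q \<in> ?D"
    obtain n where "n \<ge> 1" "p \<in> M_level 2 n" using p space_2_level by (auto simp: chart_base_def)
    moreover obtain m where "m \<ge> 1" "q \<in> M_level 2 m" using q space_2_level by (auto simp: chart_base_def)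
    ultimately show "?g (pt_dsum p q) = mat_dsum (?g p) (?g q)"
      using commutator_map_dsum[OF sep p _ q] by blast
  next
    fix n p and s :: "complex mat" assume "n \<ge> 1" "p \<in> ?D \<inter> M_level 2 n" "s \<in> carrier_mat n n" "invertible_mat s"
    then show "?g (pt_conj s p) = mat_inv' s * ?g p * s"
      using commutator_map_conj[OF sep] by blast
  qed (rule nc_set_chart_base gr)+
  moreover have "\<exists>V C. free_domain 2 V \<and> p \<in> V \<and> V \<subseteq> ?D \<and> (\<forall>q\<in>V. op_norm (?g q) \<le> C)" if p: "p \<in> ?D" for p
  proof -
    obtain V B where V: "free_domain 2 V" "p \<in> V" "V \<subseteq> ?D"
      and B: "\<And>q. q \<in> V \<Longrightarrow> op_norm (q ! 0) \<le> B" "\<And>q. q \<in> V \<Longrightarrow> op_norm (I_map r \<gamma> t (q ! 1)) \<le> B"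
      using ex_bounded_nbhd[OF sep p] t by blast
    have "op_norm (?g q) \<le> B * B + B * B" if q: "q \<in> V" for q
    proof -
      obtain m where "q \<in> M_level 2 m" using q V(3) space_2_level by (auto simp: chart_base_def)
      note Q = level_2[OF this]
      have u: "q ! 0 \<in> carrier_mat m m" and I: "I_map r \<gamma> t (q ! 1) \<in> carrier_mat m m" using Q I_map_carrier by blast+
      have "B \<ge> 0" using B(1)[OF q] op_norm_nonneg order_trans by blast
      then have "op_norm (q ! 0 * I_map r \<gamma> t (q ! 1)) \<le> B * B" "op_norm (I_map r \<gamma> t (q ! 1) * q ! 0) \<le> B * B"
        using op_norm_mult[OF u I] op_norm_mult[OF I u] mult_mono[OF B(1)[OF q] B(2)[OF q]] mult_mono[OF B(2)[OF q] B(1)[OF q]]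
        by (meson op_norm_nonneg order_trans)+
      then show ?thesis
        unfolding commutator_map_def
        using op_norm_minus[OF mult_carrier_mat[OF u I] mult_carrier_mat[OF I u]] by linarith
    qed
    then show ?thesis using V by blast
  qed
  ultimately show ?thesis
    unfolding freely_holomorphic_def using free_domain_chart_base[OF sep] gr nc_set_chart_base by blast
qed

lemma commutator_map_eq_zero:
  assumes "p \<in> M_level 2 n"
  shows "commutator_map r \<gamma> t p = 0\<^sub>m n n \<longleftrightarrow> p ! 0 * I_map r \<gamma> t (p ! 1) = I_map r \<gamma> t (p ! 1) * p ! 0"
proof -
  have c: "p ! 0 * I_map r \<gamma> t (p ! 1) \<in> carrier_mat n n" "I_map r \<gamma> t (p ! 1) * p ! 0 \<in> carrier_mat n n"
    using level_2[OF assms] I_map_carrier by (meson mult_carrier_mat)+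
  have "A = B" if "A - B = 0\<^sub>m n n" "A \<in> carrier_mat n n" "B \<in> carrier_mat n n" for A B :: "complex mat"
  proof (rule eq_matI)
    fix i j assume "i < dim_row B" "j < dim_col B"
    then show "A $$ (i, j) = B $$ (i, j)" using arg_cong[OF that(1), of "\<lambda>M. M $$ (i, j)"] that(2,3) by simp
  qed (use that in auto)
  then show ?thesis unfolding commutator_map_def using c by auto
qed

lemma U_set_iff:
  "p \<in> U_set r \<gamma> \<longleftrightarrow> p \<in> chart_base r \<gamma> \<and>
    (\<forall>t\<in>signs \<gamma>. nonconst_on \<gamma> t \<longrightarrow> p ! 0 * I_map r \<gamma> t (p ! 1) \<noteq> I_map r \<gamma> t (p ! 1) * p ! 0)"
proof -
  let ?Q = "\<lambda>u x. [u, x] \<in> M_space 2 \<and> x \<in> D_set r \<gamma> \<and>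
     (\<forall>t\<in>signs \<gamma>. nonconst_on \<gamma> t \<longrightarrow> u * I_map r \<gamma> t x \<noteq> I_map r \<gamma> t x * u)"
  have 1: "p \<in> U_set r \<gamma> \<longleftrightarrow> (\<exists>u x. p = [u, x] \<and> ?Q u x)" unfolding U_set_def by blast
  show ?thesis
  proof
    assume "p \<in> U_set r \<gamma>"
    then show "p \<in> chart_base r \<gamma> \<and> (\<forall>t\<in>signs \<gamma>. nonconst_on \<gamma> t \<longrightarrow>
        p ! 0 * I_map r \<gamma> t (p ! 1) \<noteq> I_map r \<gamma> t (p ! 1) * p ! 0)"
      unfolding 1 chart_base_def by auto
  next
    assume r: "p \<in> chart_base r \<gamma> \<and> (\<forall>t\<in>signs \<gamma>. nonconst_on \<gamma> t \<longrightarrow>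
        p ! 0 * I_map r \<gamma> t (p ! 1) \<noteq> I_map r \<gamma> t (p ! 1) * p ! 0)"
    then have sp: "p \<in> M_space 2" by (simp add: chart_base_def)
    then have eq: "p = [p ! 0, p ! 1]" by (rule space_2_eta)
    have "?Q (p ! 0) (p ! 1)" using r sp unfolding chart_base_def eq[symmetric] by simp
    then show "p \<in> U_set r \<gamma>" unfolding 1 using eq by blast
  qed
qed

text \<open>Each nonconstant sign function contributes one variety, the zero set of its commutator,
  and a finite \<open>\<gamma>\<close> has only finitely many sign functions.\<close>

lemma openin_U_set:
  assumes sep: "separated_discs r \<gamma>"
  shows "openin (zariski_free_topology 2) (U_set r \<gamma>)"
proof -
  let ?T = "\<lambda>t. {p \<in> chart_base r \<gamma>. commutator_map r \<gamma> t p = 0\<^sub>m (pt_size p) (pt_size p)}"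
  let ?N = "{t \<in> signs \<gamma>. nonconst_on \<gamma> t}"
  have "finite (signs \<gamma>)" using sep unfolding signs_def separated_discs_def by (intro finite_PiE) auto
  then have fin: "finite (?T ` ?N)" by simp
  have var: "free_variety 2 (chart_base r \<gamma>) T" if T: "T \<in> ?T ` ?N" for T
  proof -
    obtain t where t: "t \<in> signs \<gamma>" "T = ?T t" using T by blast
    then show ?thesis
      unfolding free_variety_def using freely_holomorphic_commutator_map[OF sep t(1)]
      by (intro exI[of _ "{commutator_map r \<gamma> t}"]) auto
  qed
  have "p \<in> U_set r \<gamma> \<longleftrightarrow> p \<in> chart_base r \<gamma> - \<Union>(?T ` ?N)" for p
  proof (cases "p \<in> chart_base r \<gamma>")
    case True
    then obtain n where "p \<in> M_level 2 n" using space_2_level by (auto simp: chart_base_def)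
    moreover from this have "pt_size p = n" using pt_size_M_level by auto
    ultimately show ?thesis using True commutator_map_eq_zero[of p n r \<gamma>] unfolding U_set_iff by auto
  qed (simp add: U_set_iff)
  then have "U_set r \<gamma> = chart_base r \<gamma> - \<Union>(?T ` ?N)" by blast
  then show ?thesis using openin_zariskiI[OF free_domain_chart_base[OF sep] fin var] by simp
qed

text \<open>Openness alone would not give this, as a union of nc-sets need not be an nc-set. The
  commutator at a direct sum is the direct sum of the commutators and vanishes only if both
  do.\<close>

lemma nc_set_U_set:
  assumes sep: "separated_discs r \<gamma>"
  shows "nc_set 2 (U_set r \<gamma>)"
  unfolding nc_set_def
proof (intro conjI ballI)
  show "U_set r \<gamma> \<subseteq> M_space 2" using U_set_iff chart_base_def by auto
  fix p q assume p: "p \<in> U_set r \<gamma>" and q: "q \<in> U_set r \<gamma>"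
  then have pq: "p \<in> chart_base r \<gamma>" "q \<in> chart_base r \<gamma>" by (auto simp: U_set_iff)
  obtain n where n: "n \<ge> 1" "p \<in> M_level 2 n" using pq space_2_level by (auto simp: chart_base_def)
  obtain m where m: "m \<ge> 1" "q \<in> M_level 2 m" using pq space_2_level by (auto simp: chart_base_def)
  have "pt_dsum p q ! 0 * I_map r \<gamma> t (pt_dsum p q ! 1) \<noteq> I_map r \<gamma> t (pt_dsum p q ! 1) * pt_dsum p q ! 0"
    if t: "t \<in> signs \<gamma>" "nonconst_on \<gamma> t" for t
  proof
    assume "pt_dsum p q ! 0 * I_map r \<gamma> t (pt_dsum p q ! 1) = I_map r \<gamma> t (pt_dsum p q ! 1) * pt_dsum p q ! 0"
    then have "mat_dsum (commutator_map r \<gamma> t p) (commutator_map r \<gamma> t q) = mat_dsum (0\<^sub>m n n) (0\<^sub>m m m)"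
      unfolding mat_dsum_zero commutator_map_eq_zero[OF pt_dsum_level[OF n(2) m(2)], symmetric]
      using commutator_map_dsum[OF sep pq(1) n(2) pq(2) m(2) n(1) m(1), of t] by simp
    then have "commutator_map r \<gamma> t p = 0\<^sub>m n n"
      using mat_dsum_inject[OF commutator_map_carrier[OF n(2)] zero_carrier_mat commutator_map_carrier[OF m(2)] zero_carrier_mat] by blast
    then show False using p t commutator_map_eq_zero[OF n(2)] by (auto simp: U_set_iff)
  qed
  then show "pt_dsum p q \<in> U_set r \<gamma>"
    using nc_set_chart_base[of r \<gamma>] pq unfolding U_set_iff nc_set_def by blast
qed

section \<open>Transition maps\<close>

lemma I_map_square:
  assumes x: "x \<in> carrier_mat n n" and sp: "spectrum x \<subseteq> \<Delta>_set r \<gamma>"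
    and sep: "separated_discs r \<gamma>" and t: "t \<in> signs \<gamma>"
  shows "I_map r \<gamma> t x * I_map r \<gamma> t x = 1\<^sub>m n"
proof -
  have "I_map r \<gamma> t x * I_map r \<gamma> t x = hol_calc (\<lambda>z. iota r \<gamma> t z * iota r \<gamma> t z) x"
    unfolding I_map_def by (intro hol_calc_mult[symmetric, OF x] iota_analytic[OF sep sp])
  also have "\<dots> = hol_calc (\<lambda>z. 1) x"
    by (rule hol_calc_cong[OF x open_\<Delta>_set sp]) (use iota_signs[OF sep t] in fastforce)
  finally show ?thesis using hol_calc_one[OF x] by simp
qed

text \<open>Makes \<open>S_map\<close> invertible: a branch of the square root has no zeros on discs
  that avoid the origin.\<close>

lemma hol_calc_mult_inverse:
  assumes x: "x \<in> carrier_mat n n" and S: "open S" "spectrum x \<subseteq> S" and f: "f holomorphic_on S" "\<And>z. z \<in> S \<Longrightarrow> f z \<noteq> 0"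
  shows "hol_calc (\<lambda>z. 1 / f z) x * hol_calc f x = 1\<^sub>m n"
proof -
  have an: "h analytic_on spectrum x" if "h holomorphic_on S" for h
    using that S analytic_on_open analytic_on_subset by blast
  have "hol_calc (\<lambda>z. 1 / f z) x * hol_calc f x = hol_calc (\<lambda>z. 1 / f z * f z) x"
    by (intro hol_calc_mult[symmetric, OF x] an f holomorphic_intros)
  also have "\<dots> = hol_calc (\<lambda>z. 1) x"
    by (rule hol_calc_cong[OF x S]) (use f(2) in simp)
  finally show ?thesis using hol_calc_one[OF x] by simp
qed

text \<open>Since \<open>A\<close> is invertible, \<open>A * (J * u * J) * A = A * u * A\<close>
  means \<open>J * u * J = u\<close>, and for an involution this is commutation with
  \<open>u\<close>.\<close>

lemma sandwich_eq_iff_commute: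
  fixes A A' B J u :: "complex mat"
  assumes c: "A \<in> carrier_mat n n" "B \<in> carrier_mat n n" "J \<in> carrier_mat n n" "u \<in> carrier_mat n n"
    and BA: "B * A = 1\<^sub>m n" and A': "A' = A * J" "A' = J * A" and JJ: "J * J = 1\<^sub>m n"
  shows "A' * u * A' = A * u * A \<longleftrightarrow> u * J = J * u"
proof -
  have AB: "A * B = 1\<^sub>m n" by (rule mat_mult_left_right_inverse[OF c(2,1) BA])
  have assoc: "X * Y * Z = X * (Y * Z)" if "X \<in> carrier_mat n n" "Y \<in> carrier_mat n n" "Z \<in> carrier_mat n n" for X Y Z :: "complex mat"
    using that by (rule assoc_mult_mat)
  \<comment> \<open>The left factor \<open>A'\<close> is written as \<open>A * J\<close> and the
    right one as \<open>J * A\<close>, so that both copies of \<open>J\<close> end up next to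
    \<open>u\<close>.\<close>
  have eq: "A' * u * A' = A * (J * u * J) * A"
    unfolding A'(1) by (subst (2) A'(1)[symmetric], subst A'(2)) (use c in \<open>simp add: assoc\<close>)
  have cancel: "A * X * A = A * Y * A \<longleftrightarrow> X = Y" if "X \<in> carrier_mat n n" "Y \<in> carrier_mat n n" for X Y
  proof
    assume "A * X * A = A * Y * A"
    then have "B * (A * X * A) * B = B * (A * Y * A) * B" by simp
    moreover have "B * (A * Z * A) * B = Z" if Z: "Z \<in> carrier_mat n n" for Z
    proof -
      have "B * (A * Z * A) * B = (B * A) * Z * (A * B)" using c Z by (simp add: assoc)
      then show ?thesis using BA AB Z by simp
    qed
    ultimately show "X = Y" using that by simp
  qed simp
  have "A' * u * A' = A * u * A \<longleftrightarrow> J * u * J = u"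
    unfolding eq by (rule cancel) (use c in auto)
  also have "\<dots> \<longleftrightarrow> u * J = J * u"
  proof
    assume h: "J * u * J = u"
    have "u * J = J * u * J * J" using h by simp
    also have "\<dots> = J * u * (J * J)" using c by (simp add: assoc)
    also have "\<dots> = J * u" using c JJ by simp
    finally show "u * J = J * u" .
  next
    assume h: "u * J = J * u"
    have "J * u * J = J * (u * J)" using c by (simp add: assoc)
    also have "\<dots> = J * J * u" using c h by (simp add: assoc)
    finally show "J * u * J = u" using c JJ by simp
  qed
  finally show ?thesis .
qed

definition root_chart_data :: "(complex set \<Rightarrow> real) \<Rightarrow> (complex set \<Rightarrow> complex \<Rightarrow> complex) \<Rightarrow> complex set \<Rightarrow> bool" where
  "root_chart_data r s \<gamma> \<longleftrightarrow> separated_discs r \<gamma> \<and> (\<forall>c\<in>\<gamma>. r \<gamma> < cmod c) \<and>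
     s \<gamma> holomorphic_on \<Delta>_set r \<gamma> \<and> (\<forall>z\<in>\<Delta>_set r \<gamma>. (s \<gamma> z)\<^sup>2 = z)"

text \<open>Two branches \<open>s \<iota>\<close>, \<open>s' \<iota>'\<close> of the square root differ on the overlap of their domains by
  a locally constant sign.  A disc of the family with the smaller radius meets at most one disc of the
  other family, so this sign extends to a function constant on the discs of the former.\<close>

lemma ex_sign_ratio:
  assumes d: "root_chart_data r s \<gamma>" and d': "root_chart_data r s \<gamma>'"
    and t: "t \<in> signs \<gamma>" and t': "t' \<in> signs \<gamma>'" and le: "r \<gamma>' \<le> r \<gamma>"
  shows "\<exists>e\<in>signs \<gamma>'. \<forall>z\<in>\<Delta>_set r \<gamma> \<inter> \<Delta>_set r \<gamma>'.
     s \<gamma>' z * iota r \<gamma>' t' z = s \<gamma> z * iota r \<gamma> t z * iota r \<gamma>' e z"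
proof -
  note D = d[unfolded root_chart_data_def] and D' = d'[unfolded root_chart_data_def]
  have sep: "separated_discs r \<gamma>" and sep': "separated_discs r \<gamma>'" using D D' by auto
  define f where "f = (\<lambda>z. s \<gamma> z * iota r \<gamma> t z)"
  define f' where "f' = (\<lambda>z. s \<gamma>' z * iota r \<gamma>' t' z)"
  have sq: "f z * f z = z" if z: "z \<in> \<Delta>_set r \<gamma>" for z
    using D iota_signs[OF sep t z] z by (auto simp: f_def power2_eq_square)
  have sq': "f' z * f' z = z" if z: "z \<in> \<Delta>_set r \<gamma>'" for z
    using D' iota_signs[OF sep' t' z] z by (auto simp: f'_def power2_eq_square)
  have nz: "z \<noteq> 0" if z: "z \<in> \<Delta>_set r \<gamma>" for z
  proof
    assume "z = 0"
    then obtain c where "c \<in> \<gamma>" "cmod c < r \<gamma>" using z by (auto simp: \<Delta>_set_def)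
    then show False using D by force
  qed
  have hf: "f holomorphic_on \<Delta>_set r \<gamma>" unfolding f_def using D iota_holomorphic[OF sep] by (intro holomorphic_intros) auto
  have hf': "f' holomorphic_on \<Delta>_set r \<gamma>'" unfolding f'_def using D' iota_holomorphic[OF sep'] by (intro holomorphic_intros) auto
  \<comment> \<open>A disc about \<open>c'\<close> that misses the other family imposes no
    condition, and either sign will do. Otherwise the ratio of the branches is examined on the
    overlap.\<close>
  have "\<exists>a\<in>{-1, 1}. \<forall>z\<in>ball c' (r \<gamma>') \<inter> \<Delta>_set r \<gamma>. f' z = f z * a" if c': "c' \<in> \<gamma>'" for c'
  proof (cases "ball c' (r \<gamma>') \<inter> \<Delta>_set r \<gamma> = {}")
    case False
    then obtain c w where c: "c \<in> \<gamma>" "w \<in> ball c' (r \<gamma>')" "w \<in> ball c (r \<gamma>)" by (auto simp: \<Delta>_set_balls)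
    have only: "ball c' (r \<gamma>') \<inter> \<Delta>_set r \<gamma> = ball c' (r \<gamma>') \<inter> ball c (r \<gamma>)"
    proof
      show "ball c' (r \<gamma>') \<inter> \<Delta>_set r \<gamma> \<subseteq> ball c' (r \<gamma>') \<inter> ball c (r \<gamma>)"
      proof
        fix z assume z: "z \<in> ball c' (r \<gamma>') \<inter> \<Delta>_set r \<gamma>"
        then obtain b where b: "b \<in> \<gamma>" "dist b z < r \<gamma>" by (auto simp: \<Delta>_set_balls)
        \<comment> \<open>The path from \<open>c\<close> to \<open>b\<close> through
          \<open>w\<close>, \<open>c'\<close> and \<open>z\<close> has two steps shorter than
          \<open>r \<gamma>\<close> and two shorter than \<open>r \<gamma>'\<close>. As the second
          radius is not larger, the total stays below the separation of distinct centres.\<close>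
        have "dist c b \<le> dist c w + dist w c' + dist c' z + dist z b"
          using dist_triangle[of c b w] dist_triangle[of w b c'] dist_triangle[of c' b z] by linarith
        also have "\<dots> < 4 * r \<gamma>" using c z b le by (simp add: dist_commute)
        finally have "c = b" using sep c(1) b(1) by (fastforce simp: separated_discs_def dist_norm)
        then show "z \<in> ball c' (r \<gamma>') \<inter> ball c (r \<gamma>)" using z b by simp
      qed
    qed (use c in \<open>auto simp: \<Delta>_set_balls\<close>)
    let ?W = "ball c' (r \<gamma>') \<inter> ball c (r \<gamma>)"
    have W: "?W \<subseteq> \<Delta>_set r \<gamma>" "?W \<subseteq> \<Delta>_set r \<gamma>'" using c(1) c' by (auto simp: \<Delta>_set_balls)
    have fnz: "f z \<noteq> 0" if "z \<in> ?W" for z using sq[of z] nz[of z] W that by auto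
    define j where "j = (\<lambda>z. f' z / f z)"
    have "continuous_on ?W j"
      unfolding j_def
      by (intro continuous_on_divide holomorphic_on_imp_continuous_on holomorphic_on_subset[OF hf' W(2)]
        holomorphic_on_subset[OF hf W(1)] ballI fnz)
    moreover have val: "j z \<in> {-1, 1}" if z: "z \<in> ?W" for z
    proof -
      have "z \<in> \<Delta>_set r \<gamma>" "z \<in> \<Delta>_set r \<gamma>'" using W z by blast+
      then have "f' z * f' z = f z * f z" by (simp only: sq sq')
      then have "f' z = f z \<or> f' z = - f z" by (simp add: square_eq_iff)
      then show ?thesis using fnz[OF z] by (auto simp: j_def)
    qed
    moreover have "finite (j ` ?W)" by (rule finite_subset[OF image_subsetI[OF val]]) simp_all
    \<comment> \<open>The overlap of two discs is convex; a continuous function on it with finitely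
      many values is constant.\<close>
    moreover have "connected ?W" by (intro convex_connected convex_Int convex_ball)
    ultimately have "j constant_on ?W" by (intro continuous_finite_range_constant)
    then obtain a where a: "\<And>z. z \<in> ?W \<Longrightarrow> j z = a" unfolding constant_on_def by blast
    have "a \<in> {-1, 1}" using val[of w] a[of w] c by simp
    moreover have "f' z = f z * a" if "z \<in> ?W" for z using a[OF that] fnz[OF that] by (simp add: j_def field_simps)
    ultimately show ?thesis unfolding only by blast
  qed blast
  then obtain a where a: "\<And>c'. c' \<in> \<gamma>' \<Longrightarrow> a c' \<in> {-1, 1}"
    "\<And>c' z. c' \<in> \<gamma>' \<Longrightarrow> z \<in> ball c' (r \<gamma>') \<inter> \<Delta>_set r \<gamma> \<Longrightarrow> f' z = f z * a c'" by metis
  define e where "e = restrict a \<gamma>'"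
  have "e \<in> signs \<gamma>'" using a(1) by (auto simp: e_def signs_def)
  moreover have "f' z = f z * iota r \<gamma>' e z" if z: "z \<in> \<Delta>_set r \<gamma> \<inter> \<Delta>_set r \<gamma>'" for z
  proof -
    obtain c' where c': "c' \<in> \<gamma>'" "z \<in> ball c' (r \<gamma>')" using z by (auto simp: \<Delta>_set_balls)
    then show ?thesis using a(2)[OF c'(1), of z] iota_eq[OF sep' c'] z by (simp add: e_def)
  qed
  ultimately show ?thesis by (auto simp: f_def f'_def)
qed

text \<open>The sign function \<open>e\<close> depends on the two charts only, not on the point.
  Whether it is constant is therefore decided once for all points of the overlap.\<close>

lemma \<Phi>_map_dichotomy_le:
  assumes d: "root_chart_data r s \<gamma>" and d': "root_chart_data r s \<gamma>'"
    and t: "t \<in> signs \<gamma>" and t': "t' \<in> signs \<gamma>'" and le: "r \<gamma>' \<le> r \<gamma>"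
  shows "(\<forall>p\<in>U_set r \<gamma> \<inter> U_set r \<gamma>'. \<Phi>_map r s \<gamma>' t' p = \<Phi>_map r s \<gamma> t p) \<or>
    (\<forall>p\<in>U_set r \<gamma> \<inter> U_set r \<gamma>'. \<Phi>_map r s \<gamma>' t' p \<noteq> \<Phi>_map r s \<gamma> t p)"
proof -
  note D = d[unfolded root_chart_data_def] and D' = d'[unfolded root_chart_data_def]
  have sep: "separated_discs r \<gamma>" and sep': "separated_discs r \<gamma>'" using D D' by auto
  obtain e where e: "e \<in> signs \<gamma>'" and ratio: "\<And>z. z \<in> \<Delta>_set r \<gamma> \<inter> \<Delta>_set r \<gamma>' \<Longrightarrow>
     s \<gamma>' z * iota r \<gamma>' t' z = s \<gamma> z * iota r \<gamma> t z * iota r \<gamma>' e z"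
    using ex_sign_ratio[OF d d' t t' le] by blast
  let ?f = "\<lambda>z. s \<gamma> z * iota r \<gamma> t z" and ?f' = "\<lambda>z. s \<gamma>' z * iota r \<gamma>' t' z"
  have key: "\<Phi>_map r s \<gamma>' t' p = \<Phi>_map r s \<gamma> t p \<longleftrightarrow> p ! 0 * I_map r \<gamma>' e (p ! 1) = I_map r \<gamma>' e (p ! 1) * p ! 0"
    if p: "p \<in> U_set r \<gamma> \<inter> U_set r \<gamma>'" for p
  proof -
    have base: "p \<in> chart_base r \<gamma>" "p \<in> chart_base r \<gamma>'" using p by (auto simp: U_set_iff)
    obtain n where n: "n \<ge> 1" "p \<in> M_level 2 n" using base space_2_level by (auto simp: chart_base_def)
    let ?x = "p ! 1"
    have u: "p ! 0 \<in> carrier_mat n n" and x: "?x \<in> carrier_mat n n" using level_2[OF n(2)] by auto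
    have sp: "spectrum ?x \<subseteq> \<Delta>_set r \<gamma>" "spectrum ?x \<subseteq> \<Delta>_set r \<gamma>'"
      using base chart_base_iff[OF n(2,1)] by blast+
    let ?S = "\<Delta>_set r \<gamma> \<inter> \<Delta>_set r \<gamma>'"
    have S: "open ?S" "spectrum ?x \<subseteq> ?S" using open_\<Delta>_set sp by auto
    have an: "s \<gamma> analytic_on spectrum ?x" "s \<gamma>' analytic_on spectrum ?x"
      using D D' sp analytic_on_open[OF open_\<Delta>_set] analytic_on_subset by blast+
    have ian: "iota r \<gamma> t analytic_on spectrum ?x" "iota r \<gamma>' t' analytic_on spectrum ?x" "iota r \<gamma>' e analytic_on spectrum ?x"
      using iota_analytic sep sep' sp by blast+
    have Sf: "S_map r s \<gamma> t ?x = hol_calc ?f ?x" "S_map r s \<gamma>' t' ?x = hol_calc ?f' ?x"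
      unfolding S_map_def using hol_calc_mult[OF x an(1) ian(1)] hol_calc_mult[OF x an(2) ian(2)] by auto
    have fan: "?f analytic_on spectrum ?x" by (intro analytic_intros an ian)
    have "hol_calc ?f' ?x = hol_calc (\<lambda>z. ?f z * iota r \<gamma>' e z) ?x"
      by (rule hol_calc_cong[OF x S ratio])
    also have "\<dots> = hol_calc ?f ?x * I_map r \<gamma>' e ?x"
      unfolding I_map_def by (rule hol_calc_mult[OF x fan ian(3)])
    finally have J1: "hol_calc ?f' ?x = hol_calc ?f ?x * I_map r \<gamma>' e ?x" .
    have "hol_calc ?f' ?x = hol_calc (\<lambda>z. iota r \<gamma>' e z * ?f z) ?x"
      by (rule hol_calc_cong[OF x S]) (simp add: ratio)
    also have "\<dots> = I_map r \<gamma>' e ?x * hol_calc ?f ?x"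
      unfolding I_map_def by (rule hol_calc_mult[OF x ian(3) fan])
    finally have J2: "hol_calc ?f' ?x = I_map r \<gamma>' e ?x * hol_calc ?f ?x" .
    have fnz: "?f z \<noteq> 0" if z: "z \<in> \<Delta>_set r \<gamma>" for z
    proof -
      have "z \<noteq> 0" using z D by (force simp: \<Delta>_set_def)
      then have "s \<gamma> z \<noteq> 0" using D z by auto
      then show ?thesis using iota_signs[OF sep t z] by auto
    qed
    have hf: "?f holomorphic_on \<Delta>_set r \<gamma>" using D iota_holomorphic[OF sep] by (intro holomorphic_intros) auto
    have inv: "hol_calc (\<lambda>z. 1 / ?f z) ?x * hol_calc ?f ?x = 1\<^sub>m n"
      by (rule hol_calc_mult_inverse[OF x open_\<Delta>_set sp(1) hf fnz])
    have "\<Phi>_map r s \<gamma>' t' p = \<Phi>_map r s \<gamma> t p \<longleftrightarrow>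
        hol_calc ?f' ?x * p ! 0 * hol_calc ?f' ?x = hol_calc ?f ?x * p ! 0 * hol_calc ?f ?x"
      unfolding \<Phi>_map_def Let_def Sf by simp
    also have "\<dots> \<longleftrightarrow> p ! 0 * I_map r \<gamma>' e ?x = I_map r \<gamma>' e ?x * p ! 0"
      by (rule sandwich_eq_iff_commute[OF hol_calc_carrier[OF x] hol_calc_carrier[OF x] I_map_carrier[OF x] u
        inv J1 J2 I_map_square[OF x sp(2) sep' e]])
    finally show ?thesis .
  qed
  show ?thesis
  proof (cases "nonconst_on \<gamma>' e")
    case True
    then show ?thesis using key e by (auto simp: U_set_iff)
  next
    case False
    have "p ! 0 * I_map r \<gamma>' e (p ! 1) = I_map r \<gamma>' e (p ! 1) * p ! 0" if p: "p \<in> U_set r \<gamma> \<inter> U_set r \<gamma>'" for p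
    proof -
      have base: "p \<in> chart_base r \<gamma>'" using p by (auto simp: U_set_iff)
      obtain n where n: "n \<ge> 1" "p \<in> M_level 2 n" using base space_2_level by (auto simp: chart_base_def)
      have u: "p ! 0 \<in> carrier_mat n n" and x: "p ! 1 \<in> carrier_mat n n" using level_2[OF n(2)] by auto
      have sp: "spectrum (p ! 1) \<subseteq> \<Delta>_set r \<gamma>'" using base chart_base_iff[OF n(2,1)] by blast
      obtain a where a: "\<And>c. c \<in> \<gamma>' \<Longrightarrow> e c = a" using False unfolding nonconst_on_def by blast
      have "I_map r \<gamma>' e (p ! 1) = hol_calc (\<lambda>z. a) (p ! 1)"
        unfolding I_map_def
      proof (rule hol_calc_cong[OF x open_\<Delta>_set sp])
        fix z assume "z \<in> \<Delta>_set r \<gamma>'"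
        then obtain c where "c \<in> \<gamma>'" "z \<in> ball c (r \<gamma>')" by (auto simp: \<Delta>_set_balls)
        then show "iota r \<gamma>' e z = a" using iota_eq[OF sep'] a by simp
      qed
      then have "I_map r \<gamma>' e (p ! 1) = a \<cdot>\<^sub>m 1\<^sub>m n" using hol_calc_const[OF x] by simp
      then show ?thesis
        using u mult_smult_distrib[OF u, of "1\<^sub>m n" n a] mult_smult_assoc_mat[of "1\<^sub>m n" n n "p ! 0" n a] by simp
    qed
    then show ?thesis using key by blast
  qed
qed

section \<open>Intersections of patches\<close>

text \<open>The chart coordinates are the first two entries of the image, whichever branch is used
  for the third. Hence every \<open>\<Phi>_map\<close> is injective, and two sheets can meet only
  over one and the same point.\<close>

lemma \<Phi>_map_take: "p \<in> U_set r \<gamma> \<Longrightarrow> take 2 (\<Phi>_map r s \<gamma>' t p) = p"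
  using space_2_eta[of p] by (simp add: U_set_iff chart_base_def \<Phi>_map_def Let_def numeral_2_eq_2)

lemma inj_on_\<Phi>_map: "inj_on (\<Phi>_map r s \<gamma> t) (U_set r \<gamma>)"
  by (rule inj_on_inverseI) (rule \<Phi>_map_take)

lemma \<Phi>_map_eq_imp:
  assumes "p \<in> U_set r \<gamma>" "q \<in> U_set r \<gamma>'" "\<Phi>_map r s \<gamma> t p = \<Phi>_map r s \<gamma>' t' q"
  shows "p = q"
  using assms \<Phi>_map_take by metis

text \<open>The pointwise comparison wants the smaller radius on the second family; exchanging the
  two charts covers the other case.\<close>

lemma G_patch_dichotomy:
  assumes d: "root_chart_data r s \<gamma>" and d': "root_chart_data r s \<gamma>'"
    and t: "t \<in> signs \<gamma>" and t': "t' \<in> signs \<gamma>'"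
  shows "(\<forall>p\<in>U_set r \<gamma> \<inter> U_set r \<gamma>'. \<Phi>_map r s \<gamma>' t' p = \<Phi>_map r s \<gamma> t p) \<or> G_patch r s \<gamma> t \<inter> G_patch r s \<gamma>' t' = {}"
proof -
  have "(\<forall>p\<in>U_set r \<gamma> \<inter> U_set r \<gamma>'. \<Phi>_map r s \<gamma>' t' p = \<Phi>_map r s \<gamma> t p) \<or>
    (\<forall>p\<in>U_set r \<gamma> \<inter> U_set r \<gamma>'. \<Phi>_map r s \<gamma>' t' p \<noteq> \<Phi>_map r s \<gamma> t p)"
  proof (cases "r \<gamma>' \<le> r \<gamma>")
    case True
    show ?thesis by (rule \<Phi>_map_dichotomy_le[OF d d' t t' True])
  next
    case False
    then have "r \<gamma> \<le> r \<gamma>'" by simp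
    from \<Phi>_map_dichotomy_le[OF d' d t' t this] show ?thesis by (metis Int_commute)
  qed
  moreover have "G_patch r s \<gamma> t \<inter> G_patch r s \<gamma>' t' = {}"
    if ne: "\<forall>p\<in>U_set r \<gamma> \<inter> U_set r \<gamma>'. \<Phi>_map r s \<gamma>' t' p \<noteq> \<Phi>_map r s \<gamma> t p"
  proof (rule ccontr)
    assume "G_patch r s \<gamma> t \<inter> G_patch r s \<gamma>' t' \<noteq> {}"
    then obtain p q where pq: "p \<in> U_set r \<gamma>" "q \<in> U_set r \<gamma>'" "\<Phi>_map r s \<gamma> t p = \<Phi>_map r s \<gamma>' t' q"
      unfolding G_patch_def by auto
    from \<Phi>_map_eq_imp[OF this] have "p = q" .
    then show False using ne pq by (metis IntI)
  qed
  ultimately show ?thesis by blast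
qed

text \<open>Coordinate functions respect direct sums and similarities by definition of these
  operations. The map \<open>f\<close> is kept general because a transition map is known to be the
  identity only on \<open>N\<close>.\<close>

lemma nc_function_proj:
  assumes N: "nc_set d N" and f: "\<And>x. x \<in> N \<Longrightarrow> f x = x" and k: "k < d"
  shows "nc_function d N (\<lambda>x. f x ! k)"
proof -
  have d: "d \<ge> 1" using k by simp
  have lev: "\<exists>n. x \<in> M_level d n" if "x \<in> N" for x
    using N that M_space_level[OF _ d] unfolding nc_set_def by blast
  have "f (pt_dsum x y) ! k = mat_dsum (f x ! k) (f y ! k)" if xy: "x \<in> N" "y \<in> N" for x y
  proof -
    have "pt_dsum x y \<in> N" using N xy unfolding nc_set_def by blast
    then show ?thesis using f xy lev[OF xy(1)] lev[OF xy(2)] pt_dsum_nth k by metis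
  qed
  moreover have "f (pt_conj s x) ! k = mat_inv' s * (f x ! k) * s"
    if "x \<in> N \<inter> M_level d n" "pt_conj s x \<in> N" for x n s
  proof -
    have "k < length x" using that k by (simp add: M_level_def)
    then show ?thesis using that f[of x] f[of "pt_conj s x"] pt_conj_nth by auto
  qed
  moreover have "graded d N (\<lambda>x. f x ! k)"
    unfolding graded_def using f M_level_nth k by auto
  ultimately show ?thesis using N unfolding nc_function_def by blast
qed

section \<open>Charts and transition maps\<close>

text \<open>The chart is continuous because its inverse sends open sets to generators of the
  topology. The inverse has to be tested against the generators coming from all charts, and there
  the dichotomy leaves only two preimages: an intersection of open sets, or the empty set.\<close>

lemma chart_homeomorphic:
  assumes data: "\<And>\<gamma>. \<gamma> \<in> \<Gamma>_sets \<Longrightarrow> root_chart_data r s \<gamma>" and \<gamma>: "\<gamma> \<in> \<Gamma>_sets" and t: "t \<in> signs \<gamma>"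
  shows "openin (G_topology r s) (G_patch r s \<gamma> t)"
    and "homeomorphic_map (subtopology (G_topology r s) (G_patch r s \<gamma> t))
      (subtopology (zariski_free_topology 2) (U_set r \<gamma>)) (inv_into (U_set r \<gamma>) (\<Phi>_map r s \<gamma> t))"
proof -
  let ?G = "G_patch r s \<gamma> t" and ?U = "U_set r \<gamma>" and ?F = "\<Phi>_map r s \<gamma> t"
  let ?\<tau> = "zariski_free_topology 2" and ?T = "G_topology r s"
  let ?a = "inv_into ?U ?F"
  have dat: "root_chart_data r s \<gamma>" by (rule data[OF \<gamma>])
  then have opU: "openin ?\<tau> ?U" by (intro openin_U_set) (simp add: root_chart_data_def)
  have gen: "openin ?T (?F ` U)" if "U \<subseteq> ?U" "openin ?\<tau> U" for U
    unfolding G_topology_def openin_topology_generated_by_iff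
    by (rule generate_topology_on.Basis) (use that \<gamma> t in blast)
  show opG: "openin ?T ?G" unfolding G_patch_def by (rule gen[OF subset_refl opU])
  have tG: "topspace (subtopology ?T ?G) = ?G" using openin_subset[OF opG] by auto
  have tU: "topspace (subtopology ?\<tau> ?U) = ?U" using openin_subset[OF opU] by auto
  have aF: "?a (?F p) = p" if "p \<in> ?U" for p by (rule inv_into_f_f[OF inj_on_\<Phi>_map that])
  have "continuous_map (subtopology ?T ?G) (subtopology ?\<tau> ?U) ?a"
    unfolding continuous_map tG tU
  proof (intro conjI allI impI)
    show "?a ` ?G \<subseteq> ?U" using aF by (auto simp: G_patch_def)
    fix V assume "openin (subtopology ?\<tau> ?U) V"
    then have V: "openin ?\<tau> V" "V \<subseteq> ?U" using opU by (auto simp: openin_open_subtopology)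
    have "{x \<in> ?G. ?a x \<in> V} = ?F ` V" using aF V(2) by (auto simp: G_patch_def)
    then show "openin (subtopology ?T ?G) {x \<in> ?G. ?a x \<in> V}"
      using gen[OF V(2,1)] V(2) opG by (auto simp: openin_open_subtopology G_patch_def)
  qed
  moreover have "continuous_map (subtopology ?\<tau> ?U) (subtopology ?T ?G) ?F"
    unfolding continuous_map_in_subtopology tU
  proof
    show "?F \<in> ?U \<rightarrow> ?G" by (auto simp: G_patch_def)
    show "continuous_map (subtopology ?\<tau> ?U) ?T ?F"
      unfolding G_topology_def
    proof (rule continuous_on_generated_topo)
      fix W assume "W \<in> {\<Phi>_map r s \<gamma> t ` U |\<gamma> t U. \<gamma> \<in> \<Gamma>_sets \<and> t \<in> signs \<gamma> \<and> U \<subseteq> U_set r \<gamma> \<and> openin ?\<tau> U}"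
      then obtain \<gamma>' t' U where W: "W = \<Phi>_map r s \<gamma>' t' ` U" "\<gamma>' \<in> \<Gamma>_sets" "t' \<in> signs \<gamma>'"
        "U \<subseteq> U_set r \<gamma>'" "openin ?\<tau> U" by blast
      from G_patch_dichotomy[OF dat data[OF W(2)] t W(3)]
      have "?F -` W \<inter> ?U = ?U \<inter> U \<or> ?F -` W \<inter> ?U = {}"
      proof
        assume eq: "\<forall>p\<in>?U \<inter> U_set r \<gamma>'. \<Phi>_map r s \<gamma>' t' p = ?F p"
        have "?F -` W \<inter> ?U = ?U \<inter> U"
        proof
          show "?F -` W \<inter> ?U \<subseteq> ?U \<inter> U"
          proof
            fix p assume p: "p \<in> ?F -` W \<inter> ?U"
            then obtain q where q: "q \<in> U" "?F p = \<Phi>_map r s \<gamma>' t' q" unfolding W(1) by auto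
            then have "p = q" using \<Phi>_map_eq_imp[of p r \<gamma> q \<gamma>' s t t'] p W(4) by blast
            then show "p \<in> ?U \<inter> U" using p q by blast
          qed
          show "?U \<inter> U \<subseteq> ?F -` W \<inter> ?U"
          proof
            fix p assume p: "p \<in> ?U \<inter> U"
            then have "?F p = \<Phi>_map r s \<gamma>' t' p" using eq W(4) by auto
            then show "p \<in> ?F -` W \<inter> ?U" using p unfolding W(1) by auto
          qed
        qed
        then show ?thesis ..
      next
        assume "?G \<inter> G_patch r s \<gamma>' t' = {}"
        then have "?F -` W \<inter> ?U = {}" using W(1,4) unfolding G_patch_def by blast
        then show ?thesis ..
      qed
      then show "openin (subtopology ?\<tau> ?U) (?F -` W \<inter> topspace (subtopology ?\<tau> ?U))"
        unfolding tU using W(5) opU by (auto simp: openin_open_subtopology)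
    next
      show "?F ` topspace (subtopology ?\<tau> ?U) \<subseteq>
         \<Union>{\<Phi>_map r s \<gamma> t ` U |\<gamma> t U. \<gamma> \<in> \<Gamma>_sets \<and> t \<in> signs \<gamma> \<and> U \<subseteq> U_set r \<gamma> \<and> openin ?\<tau> U}"
        unfolding tU using \<gamma> t opU by blast
    qed
  qed
  ultimately have "homeomorphic_maps (subtopology ?T ?G) (subtopology ?\<tau> ?U) ?a ?F"
    unfolding homeomorphic_maps_def tG tU using aF by (intro conjI ballI) (auto simp: G_patch_def[of r s \<gamma> t])
  then show "homeomorphic_map (subtopology ?T ?G) (subtopology ?\<tau> ?U) ?a"
    unfolding homeomorphic_map_maps by blast
qed

lemma chart_transition:
  assumes d: "root_chart_data r s \<gamma>" and d': "root_chart_data r s \<gamma>'"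
    and t: "t \<in> signs \<gamma>" and t': "t' \<in> signs \<gamma>'"
  defines "\<alpha> \<equiv> inv_into (U_set r \<gamma>) (\<Phi>_map r s \<gamma> t)" and "\<beta> \<equiv> inv_into (U_set r \<gamma>') (\<Phi>_map r s \<gamma>' t')"
  defines "A \<equiv> \<alpha> ` (G_patch r s \<gamma> t \<inter> G_patch r s \<gamma>' t')"
  shows "(\<exists>\<N>. (\<forall>N\<in>\<N>. nc_set 2 N) \<and> A = \<Union>\<N>) \<and>
    (\<forall>N. nc_set 2 N \<and> N \<subseteq> A \<longrightarrow> nc_mapping 2 N 2 (U_set r \<gamma>') (\<beta> \<circ> inv_into (G_patch r s \<gamma> t) \<alpha>))"
proof -
  let ?U = "U_set r \<gamma>" and ?U' = "U_set r \<gamma>'" and ?F = "\<Phi>_map r s \<gamma> t" and ?F' = "\<Phi>_map r s \<gamma>' t'"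
  let ?G = "G_patch r s \<gamma> t" and ?G' = "G_patch r s \<gamma>' t'"
  have ncU: "nc_set 2 ?U" "nc_set 2 ?U'" using d d' nc_set_U_set by (auto simp: root_chart_data_def)
  have \<alpha>F: "\<alpha> (?F p) = p" if "p \<in> ?U" for p unfolding \<alpha>_def by (rule inv_into_f_f[OF inj_on_\<Phi>_map that])
  have \<beta>F: "\<beta> (?F' p) = p" if "p \<in> ?U'" for p unfolding \<beta>_def by (rule inv_into_f_f[OF inj_on_\<Phi>_map that])
  have inj\<alpha>: "inj_on \<alpha> ?G" unfolding G_patch_def by (rule inj_onI) (auto simp: \<alpha>F)
  have trans: "p \<in> ?U \<inter> ?U' \<and> (\<beta> \<circ> inv_into ?G \<alpha>) p = p" if p: "p \<in> A" for p
  proof -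
    obtain x where x: "x \<in> ?G" "x \<in> ?G'" "p = \<alpha> x" using p unfolding A_def by blast
    obtain q q' where q: "q \<in> ?U" "x = ?F q" "q' \<in> ?U'" "x = ?F' q'" using x(1,2) unfolding G_patch_def by blast
    have "q = q'" using \<Phi>_map_eq_imp[OF q(1,3)] q by blast
    moreover have "p = q" using x(3) q \<alpha>F by simp
    moreover have "inv_into ?G \<alpha> p = x" unfolding x(3) by (rule inv_into_f_f[OF inj\<alpha> x(1)])
    moreover have "\<beta> x = q'" using q(4) \<beta>F[OF q(3)] by simp
    ultimately show ?thesis using q(1,3) by simp
  qed
  \<comment> \<open>Either way \<open>A\<close> is a union of nc-sets: of none, or of the single
    nc-set \<open>?U \<inter> ?U'\<close>.\<close>
  have "A = {} \<or> A = ?U \<inter> ?U'"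
    using G_patch_dichotomy[OF d d' t t']
  proof
    assume eq: "\<forall>p\<in>?U \<inter> ?U'. ?F' p = ?F p"
    have "p \<in> A" if p: "p \<in> ?U \<inter> ?U'" for p
    proof -
      have "?F p \<in> ?G" using p by (simp add: G_patch_def)
      moreover have "?F p \<in> ?G'" using p eq unfolding G_patch_def by (metis Int_iff imageI)
      ultimately show ?thesis unfolding A_def using \<alpha>F p by (metis IntD1 IntI imageI)
    qed
    then show ?thesis using trans by blast
  qed (simp add: A_def)
  moreover have "nc_set 2 (?U \<inter> ?U')" using ncU unfolding nc_set_def by blast
  ultimately have "\<exists>\<N>. (\<forall>N\<in>\<N>. nc_set 2 N) \<and> A = \<Union>\<N>"
    by (metis Union_empty ccpo_Sup_singleton empty_iff singletonD)
  moreover have "nc_mapping 2 N 2 ?U' (\<beta> \<circ> inv_into ?G \<alpha>)" if N: "nc_set 2 N" "N \<subseteq> A" for N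
    unfolding nc_mapping_def
  proof (intro conjI allI impI)
    have id: "(\<beta> \<circ> inv_into ?G \<alpha>) p = p" "p \<in> ?U'" if "p \<in> N" for p using trans N(2) that by blast+
    then show "(\<beta> \<circ> inv_into ?G \<alpha>) ` N \<subseteq> ?U'" by (intro image_subsetI) metis
    show "nc_function 2 N (\<lambda>x. (\<beta> \<circ> inv_into ?G \<alpha>) x ! k)" if "k < 2" for k
      by (rule nc_function_proj[OF N(1) id(1) that])
  qed (rule N(1) ncU(2))+
  ultimately show ?thesis by blast
qed

theorem theorem8p33:
  fixes r :: "complex set \<Rightarrow> real"
    and s :: "complex set \<Rightarrow> complex \<Rightarrow> complex"
  assumes "\<And>\<gamma>. \<gamma> \<in> \<Gamma>_sets \<Longrightarrow> r \<gamma> > 0"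
    and "\<And>\<gamma> c. \<gamma> \<in> \<Gamma>_sets \<Longrightarrow> c \<in> \<gamma> \<Longrightarrow> r \<gamma> < cmod c"
    and "\<And>\<gamma> c c'. \<gamma> \<in> \<Gamma>_sets \<Longrightarrow> c \<in> \<gamma> \<Longrightarrow> c' \<in> \<gamma> \<Longrightarrow> c \<noteq> c' \<Longrightarrow> r \<gamma> < cmod (c - c') / 4"
    and "\<And>\<gamma>. \<gamma> \<in> \<Gamma>_sets \<Longrightarrow> s \<gamma> holomorphic_on \<Delta>_set r \<gamma>"
    and "\<And>\<gamma> z. \<gamma> \<in> \<Gamma>_sets \<Longrightarrow> z \<in> \<Delta>_set r \<gamma> \<Longrightarrow> (s \<gamma> z)\<^sup>2 = z"
  shows "topological_nc_manifold 2 (zariski_free_topology 2)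
           (G_set r s) (G_topology r s) (G_atlas r s)"
proof -
  have data: "root_chart_data r s \<gamma>" if \<gamma>: "\<gamma> \<in> \<Gamma>_sets" for \<gamma>
  proof -
    have "4 * r \<gamma> < cmod (c - c')" if "c \<in> \<gamma>" "c' \<in> \<gamma>" "c \<noteq> c'" for c c'
      using assms(3)[OF \<gamma> that] by simp
    moreover have "finite \<gamma>" using \<gamma> by (simp add: \<Gamma>_sets_def)
    ultimately show ?thesis
      unfolding root_chart_data_def separated_discs_def using assms(1,2,4,5) \<gamma> by blast
  qed
  have open_U: "openin (zariski_free_topology 2) (U_set r \<gamma>)" "nc_set 2 (U_set r \<gamma>)" if "\<gamma> \<in> \<Gamma>_sets" for \<gamma>
    using data[OF that] openin_U_set nc_set_U_set by (auto simp: root_chart_data_def)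
  \<comment> \<open>Each \<open>U_set r \<gamma>\<close> is itself open, so every patch is among the
    generators and they cover \<open>G_set r s\<close>.\<close>
  have top: "topspace (G_topology r s) = G_set r s"
    unfolding G_topology_def topology_generated_by_topspace G_set_def G_patch_def
    using open_U(1) by blast
  have charts: "(\<Union>(U, \<alpha>, D)\<in>G_atlas r s. U) = G_set r s"
    unfolding G_atlas_def G_set_def by auto
  show ?thesis
    unfolding topological_nc_manifold_def
  proof (intro conjI)
    show "nc_admissible_topology 2 (zariski_free_topology 2)" by (rule zariski_admissible) simp
    show "\<forall>(U, \<alpha>, D)\<in>G_atlas r s. openin (G_topology r s) U \<and> openin (zariski_free_topology 2) D \<and> nc_set 2 D \<and>
        homeomorphic_map (subtopology (G_topology r s) U) (subtopology (zariski_free_topology 2) D) \<alpha>"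
      unfolding G_atlas_def using chart_homeomorphic[OF data] open_U by auto
    show "\<forall>(U, \<alpha>, D)\<in>G_atlas r s. \<forall>(V, \<beta>, E)\<in>G_atlas r s.
        (\<exists>\<N>. (\<forall>N\<in>\<N>. nc_set 2 N) \<and> \<alpha> ` (U \<inter> V) = \<Union>\<N>) \<and>
        (\<forall>N. nc_set 2 N \<and> N \<subseteq> \<alpha> ` (U \<inter> V) \<longrightarrow> nc_mapping 2 N 2 E (\<beta> \<circ> inv_into U \<alpha>))"
      unfolding G_atlas_def by (clarify, intro chart_transition data)
  qed (rule top charts)+
qed

end
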